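(* Fix $t\in\mathbb{N}$ with $t\le T$, and let $\phi_{t,T}:\mathcal{R}_{t,T}^{\infty}\to L^{\infty}(\mathcal{F}_t)$ be a law invariant, concave monetary utility function (the time-$t$ member of a monetary utility process) which is continuous for bounded decreasing sequences. Let $\Psi_{t,T}(X):=-\phi_{t,T}(-X)$ be its insurance version, and let $X^1,\dots,X^n\in\mathcal{R}_{t,T}^{\infty}$ be fixed. Then: (i) $\displaystyle {\rm ess}\sup_{\tilde X^i\sim X^i,\ i=1,\dots,n}\Psi_{t,T}\Big(\frac1n\sum_{i=1}^n\tilde X^i\Big)={\rm ess}\sup_{a\in D_{t,T}}F_{t,T}(a)$, where the left-hand supremum runs over all $\tilde X^1,\dots,\tilde X^n\in\mathcal{R}_{t,T}^{\infty}$ with $\tilde X^i\sim X^i$. (ii) If $a^0\in D_{t,T}$ is a worst scenario of $F_{t,T}$, and $\bar X^1,\dots,\bar X^n\in\mathcal{R}_{t,T}^{\infty}$ with $\bar X^i\sim X^i$ are $a^0$-comonotone, then $(\bar X^1,\dots,\bar X^n)$ is a worst case portfolio of $\Psi_{t,T}$, i.e. ${\rm ess}\sup_{\tilde X^i\sim X^i}\Psi_{t,T}\big(\frac1n\sum_{i=1}^n\tilde X^i\big)=\Psi_{t,T}\big(\frac1n\sum_{i=1}^n\bar X^i\big)$.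
   Context: Let $(\Omega,\mathcal{F},(\mathcal{F}_s)_{s\in\mathbb{N}},P)$ be a filtered probability space with $\mathcal{F}_0=\{\emptyset,\Omega\}$; (in)equalities between random variables/processes hold $P$-a.s.; $T\in\mathbb{N}$ is a fixed horizon. $\mathcal{R}^0$ is the space of adapted processes, $\mathcal{R}^\infty=\{X\in\mathcal{R}^0:\exists m,\ \sup_s|X_s|\le m\}$. $A^1$ is the set of adapted $a$ with $E\sum_{s}|\Delta a_s|<\infty$, where $a_{-1}=0$, $\Delta a_s=a_s-a_{s-1}$; $A^1_+=\{a\in A^1:\Delta a_s\ge0\ \forall s\}$. For $t\le T$, $\pi_{t,T}(X)_s=1_{\{t\le s\}}X_{s\wedge T}$, $\mathcal{R}^\infty_{t,T}=\pi_{t,T}(\mathcal{R}^\infty)$, $A^1_{t,T}=\pi_{t,T}A^1$, and for $X\in\mathcal{R}^\infty$, $a\in A^1$: $\langle X,a\rangle_{t,T}=E\big(\sum_{s=t}^{T}X_s\Delta a_s\mid\mathcal{F}_t\big)$. $D_{t,T}=\{a\in\pi_{t,T}A^1_+:\langle 1,a\rangle_{t,T}=1\}$. A monetary utility function on $\mathcal{R}^\infty_{t,T}$ is a map $\phi:\mathcal{R}^\infty_{t,T}\to L^\infty(\mathcal{F}_t)$ with $\phi(1_AX)=1_A\phi(X)$ for $A\in\mathcal{F}_t$, $\phi(X)\le\phi(Y)$ if $X\le Y$, and $\phi(X+m1_{[t,\infty)})=\phi(X)+m$ for $m\in L^\infty(\mathcal{F}_t)$. It is concave if $\phi(\lambda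 X+(1-\lambda)Y)\ge\lambda\phi(X)+(1-\lambda)\phi(Y)$ for $\lambda\in L^\infty(\mathcal{F}_t)$, $0\le\lambda\le1$; continuous for bounded decreasing sequences if $\phi(X^k)\to\phi(X)$ whenever $(X^k)\subset\mathcal{R}^\infty_{t,T}$ is decreasing with $X^k_s\to X_s$ for all $s$, $X\in\mathcal{R}^\infty_{t,T}$. Its acceptance set is $\mathcal{C}_\phi=\{X:\phi(X)\ge0\}$ and $\phi^{\#}(a)={\rm ess}\inf_{X\in\mathcal{C}_\phi}\langle X,a\rangle_{t,T}$ for $a\in A^1_{t,T}$. A process $X\in\mathcal{R}^\infty_{t,T}$ is identified with the random vector $(X_t,\dots,X_T)$; $X\sim X'$ means equal joint laws; $\phi$ is law invariant if $\phi(X)=\phi(X')$ whenever $X\sim X'$. For $a\in D_{t,T}$: $\Psi_a(\hat X)={\rm ess}\sup_{\tilde X\sim\hat X,\ \tilde X\in\mathcal{R}^\infty_{t,T}}\langle\tilde X,a\rangle_{t,T}$. The average risk function is $F_{t,T}(a)=\frac1n\sum_{i=1}^n\Psi_a(X^i)+\phi_{t,T}^{\#}(a)$, $a\in D_{t,T}$; $a^0$ is a worst scenario of $F_{t,T}$ if $F_{t,T}(a^0)={\rm ess}\sup_{a\in D_{t,T}}F_{t,T}(a)$. Processes $\tilde X^i\sim X^i$ are $a^0$-comonotone if $\Psi_{a^0}(\tilde X^i)=\langle\tilde X^i,a^0\rangle_{t,T}$ for each $i$ and $\Psi_{a^0}(\sum_i\tilde X^i)=\langle\sum_i\tilde X^i,a^0\rangle_{t,T}$.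 *)

theory Defs
  imports "HOL-Probability.Probability"
begin

text \<open>Processes are functions nat => 'a => real (time index first).
  All (in)equalities between random variables are understood M-almost surely.\<close>

type_synonym 'a proc = "nat \<Rightarrow> 'a \<Rightarrow> real"

definition filtered_prob_space :: "'a measure \<Rightarrow> (nat \<Rightarrow> 'a measure) \<Rightarrow> bool" where
  "filtered_prob_space M F \<longleftrightarrow> prob_space M
     \<and> (\<forall>s. subalgebra M (F s))
     \<and> (\<forall>s. sets (F s) \<subseteq> sets (F (Suc s)))
     \<and> sets (F 0) = {{}, space M}"

definition adapted :: "(nat \<Rightarrow> 'a measure) \<Rightarrow> 'a proc \<Rightarrow> bool" where
  "adapted F X \<longleftrightarrow> (\<forall>s. X s \<in> borel_measurable (F s))"

definition Rinf :: "'a measure \<Rightarrow> (nat \<Rightarrow> 'a measure) \<Rightarrow> 'a proc set" where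
  "Rinf M F = {X. adapted F X \<and> (\<exists>m::real. AE \<omega> in M. \<forall>s. \<bar>X s \<omega>\<bar> \<le> m)}"

text \<open>Delta a_s = a_s - a_{s-1}, with a_{-1} = 0\<close>
definition delta :: "'a proc \<Rightarrow> nat \<Rightarrow> 'a \<Rightarrow> real" where
  "delta a s \<omega> = (if s = 0 then a 0 \<omega> else a s \<omega> - a (s - 1) \<omega>)"

definition A1 :: "'a measure \<Rightarrow> (nat \<Rightarrow> 'a measure) \<Rightarrow> 'a proc set" where
  "A1 M F = {a. adapted F a \<and>
     (\<integral>\<^sup>+ \<omega>. (\<Sum>s. ennreal \<bar>delta a s \<omega>\<bar>) \<partial>M) < \<infinity>}"

definition A1plus :: "'a measure \<Rightarrow> (nat \<Rightarrow> 'a measure) \<Rightarrow> 'a proc set" where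
  "A1plus M F = {a \<in> A1 M F. AE \<omega> in M. \<forall>s. delta a s \<omega> \<ge> 0}"

definition pi_tT :: "nat \<Rightarrow> nat \<Rightarrow> 'a proc \<Rightarrow> 'a proc" where
  "pi_tT t T X = (\<lambda>s \<omega>. if t \<le> s then X (min s T) \<omega> else 0)"

definition Rinf_tT :: "'a measure \<Rightarrow> (nat \<Rightarrow> 'a measure) \<Rightarrow> nat \<Rightarrow> nat \<Rightarrow> 'a proc set" where
  "Rinf_tT M F t T = pi_tT t T ` Rinf M F"

definition A1_tT :: "'a measure \<Rightarrow> (nat \<Rightarrow> 'a measure) \<Rightarrow> nat \<Rightarrow> nat \<Rightarrow> 'a proc set" where
  "A1_tT M F t T = pi_tT t T ` A1 M F"

definition pairing :: "'a measure \<Rightarrow> (nat \<Rightarrow> 'a measure) \<Rightarrow> nat \<Rightarrow> nat \<Rightarrow> 'a proc \<Rightarrow> 'a proc \<Rightarrow> 'a \<Rightarrow> real" where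
  "pairing M F t T X a = real_cond_exp M (F t) (\<lambda>\<omega>. \<Sum>s\<in>{t..T}. X s \<omega> * delta a s \<omega>)"

definition D_tT :: "'a measure \<Rightarrow> (nat \<Rightarrow> 'a measure) \<Rightarrow> nat \<Rightarrow> nat \<Rightarrow> 'a proc set" where
  "D_tT M F t T = {a \<in> pi_tT t T ` A1plus M F.
     AE \<omega> in M. pairing M F t T (\<lambda>s \<omega>. 1) a \<omega> = 1}"

definition law_tT :: "'a measure \<Rightarrow> nat \<Rightarrow> nat \<Rightarrow> 'a proc \<Rightarrow> (nat \<Rightarrow> real) measure" where
  "law_tT M t T X = distr M (PiM {t..T} (\<lambda>_. borel)) (\<lambda>\<omega>. \<lambda>s\<in>{t..T}. X s \<omega>)"

definition same_law :: "'a measure \<Rightarrow> nat \<Rightarrow> nat \<Rightarrow> 'a proc \<Rightarrow> 'a proc \<Rightarrow> bool" where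
  "same_law M t T X Y \<longleftrightarrow> law_tT M t T X = law_tT M t T Y"

definition is_ess_sup :: "'a measure \<Rightarrow> ('a \<Rightarrow> ereal) set \<Rightarrow> ('a \<Rightarrow> ereal) \<Rightarrow> bool" where
  "is_ess_sup M S Z \<longleftrightarrow> Z \<in> borel_measurable M
     \<and> (\<forall>Y\<in>S. AE \<omega> in M. Y \<omega> \<le> Z \<omega>)
     \<and> (\<forall>W\<in>borel_measurable M. (\<forall>Y\<in>S. AE \<omega> in M. Y \<omega> \<le> W \<omega>) \<longrightarrow> (AE \<omega> in M. Z \<omega> \<le> W \<omega>))"

definition ess_sup :: "'a measure \<Rightarrow> ('a \<Rightarrow> ereal) set \<Rightarrow> 'a \<Rightarrow> ereal" where
  "ess_sup M S = (SOME Z. is_ess_sup M S Z)"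

definition is_ess_inf :: "'a measure \<Rightarrow> ('a \<Rightarrow> ereal) set \<Rightarrow> ('a \<Rightarrow> ereal) \<Rightarrow> bool" where
  "is_ess_inf M S Z \<longleftrightarrow> Z \<in> borel_measurable M
     \<and> (\<forall>Y\<in>S. AE \<omega> in M. Z \<omega> \<le> Y \<omega>)
     \<and> (\<forall>W\<in>borel_measurable M. (\<forall>Y\<in>S. AE \<omega> in M. W \<omega> \<le> Y \<omega>) \<longrightarrow> (AE \<omega> in M. W \<omega> \<le> Z \<omega>))"

definition ess_inf :: "'a measure \<Rightarrow> ('a \<Rightarrow> ereal) set \<Rightarrow> 'a \<Rightarrow> ereal" where
  "ess_inf M S = (SOME Z. is_ess_inf M S Z)"

definition Linf :: "'a measure \<Rightarrow> 'a measure \<Rightarrow> ('a \<Rightarrow> real) set" where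
  "Linf M G = {f. f \<in> borel_measurable G \<and> (\<exists>m::real. AE \<omega> in M. \<bar>f \<omega>\<bar> \<le> m)}"

definition monetary_utility :: "'a measure \<Rightarrow> (nat \<Rightarrow> 'a measure) \<Rightarrow> nat \<Rightarrow> nat
     \<Rightarrow> ('a proc \<Rightarrow> 'a \<Rightarrow> real) \<Rightarrow> bool" where
  "monetary_utility M F t T \<phi> \<longleftrightarrow>
     (\<forall>X\<in>Rinf_tT M F t T. \<phi> X \<in> Linf M (F t))
   \<and> (\<forall>X\<in>Rinf_tT M F t T. \<forall>A\<in>sets (F t).
        AE \<omega> in M. \<phi> (\<lambda>s \<omega>'. indicator A \<omega>' * X s \<omega>') \<omega> = indicator A \<omega> * \<phi> X \<omega>)
   \<and> (\<forall>X\<in>Rinf_tT M F t T. \<forall>Y\<in>Rinf_tT M F t T.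
        (AE \<omega> in M. \<forall>s. X s \<omega> \<le> Y s \<omega>) \<longrightarrow> (AE \<omega> in M. \<phi> X \<omega> \<le> \<phi> Y \<omega>))
   \<and> (\<forall>X\<in>Rinf_tT M F t T. \<forall>m\<in>Linf M (F t).
        AE \<omega> in M. \<phi> (\<lambda>s \<omega>'. X s \<omega>' + m \<omega>' * indicator {t..} s) \<omega> = \<phi> X \<omega> + m \<omega>)"

definition concave_mu :: "'a measure \<Rightarrow> (nat \<Rightarrow> 'a measure) \<Rightarrow> nat \<Rightarrow> nat
     \<Rightarrow> ('a proc \<Rightarrow> 'a \<Rightarrow> real) \<Rightarrow> bool" where
  "concave_mu M F t T \<phi> \<longleftrightarrow>
     (\<forall>X\<in>Rinf_tT M F t T. \<forall>Y\<in>Rinf_tT M F t T. \<forall>l\<in>Linf M (F t).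
        (AE \<omega> in M. 0 \<le> l \<omega> \<and> l \<omega> \<le> 1) \<longrightarrow>
        (AE \<omega> in M. \<phi> (\<lambda>s \<omega>'. l \<omega>' * X s \<omega>' + (1 - l \<omega>') * Y s \<omega>') \<omega>
                      \<ge> l \<omega> * \<phi> X \<omega> + (1 - l \<omega>) * \<phi> Y \<omega>))"

definition cont_bdd_decr :: "'a measure \<Rightarrow> (nat \<Rightarrow> 'a measure) \<Rightarrow> nat \<Rightarrow> nat
     \<Rightarrow> ('a proc \<Rightarrow> 'a \<Rightarrow> real) \<Rightarrow> bool" where
  "cont_bdd_decr M F t T \<phi> \<longleftrightarrow>
     (\<forall>Xs::nat \<Rightarrow> 'a proc. \<forall>X\<in>Rinf_tT M F t T.
        (\<forall>k. Xs k \<in> Rinf_tT M F t T)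
      \<longrightarrow> (AE \<omega> in M. \<forall>k s. Xs (Suc k) s \<omega> \<le> Xs k s \<omega>)
      \<longrightarrow> (AE \<omega> in M. \<forall>s. (\<lambda>k. Xs k s \<omega>) \<longlonglongrightarrow> X s \<omega>)
      \<longrightarrow> (AE \<omega> in M. (\<lambda>k. \<phi> (Xs k) \<omega>) \<longlonglongrightarrow> \<phi> X \<omega>))"

definition law_invariant :: "'a measure \<Rightarrow> (nat \<Rightarrow> 'a measure) \<Rightarrow> nat \<Rightarrow> nat
     \<Rightarrow> ('a proc \<Rightarrow> 'a \<Rightarrow> real) \<Rightarrow> bool" where
  "law_invariant M F t T \<phi> \<longleftrightarrow>
     (\<forall>X\<in>Rinf_tT M F t T. \<forall>Y\<in>Rinf_tT M F t T.
        same_law M t T X Y \<longrightarrow> (AE \<omega> in M. \<phi> X \<omega> = \<phi> Y \<omega>))"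

definition acceptance_set :: "'a measure \<Rightarrow> (nat \<Rightarrow> 'a measure) \<Rightarrow> nat \<Rightarrow> nat
     \<Rightarrow> ('a proc \<Rightarrow> 'a \<Rightarrow> real) \<Rightarrow> 'a proc set" where
  "acceptance_set M F t T \<phi> = {X \<in> Rinf_tT M F t T. AE \<omega> in M. \<phi> X \<omega> \<ge> 0}"

definition phi_sharp :: "'a measure \<Rightarrow> (nat \<Rightarrow> 'a measure) \<Rightarrow> nat \<Rightarrow> nat
     \<Rightarrow> ('a proc \<Rightarrow> 'a \<Rightarrow> real) \<Rightarrow> 'a proc \<Rightarrow> 'a \<Rightarrow> ereal" where
  "phi_sharp M F t T \<phi> a =
     ess_inf M ((\<lambda>X \<omega>. ereal (pairing M F t T X a \<omega>)) ` acceptance_set M F t T \<phi>)"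

definition insurance :: "('a proc \<Rightarrow> 'a \<Rightarrow> real) \<Rightarrow> 'a proc \<Rightarrow> 'a \<Rightarrow> real" where
  "insurance \<phi> X = (\<lambda>\<omega>. - \<phi> (\<lambda>s \<omega>'. - X s \<omega>') \<omega>)"

definition Psi_a :: "'a measure \<Rightarrow> (nat \<Rightarrow> 'a measure) \<Rightarrow> nat \<Rightarrow> nat
     \<Rightarrow> 'a proc \<Rightarrow> 'a proc \<Rightarrow> 'a \<Rightarrow> ereal" where
  "Psi_a M F t T a Xh =
     ess_sup M ((\<lambda>X \<omega>. ereal (pairing M F t T X a \<omega>)) `
                {X \<in> Rinf_tT M F t T. same_law M t T X Xh})"

definition avg_risk :: "'a measure \<Rightarrow> (nat \<Rightarrow> 'a measure) \<Rightarrow> nat \<Rightarrow> nat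
     \<Rightarrow> ('a proc \<Rightarrow> 'a \<Rightarrow> real) \<Rightarrow> nat \<Rightarrow> (nat \<Rightarrow> 'a proc) \<Rightarrow> 'a proc \<Rightarrow> 'a \<Rightarrow> ereal" where
  "avg_risk M F t T \<phi> n X a =
     (\<lambda>\<omega>. ereal (1 / real n) * (\<Sum>i\<in>{1..n}. Psi_a M F t T a (X i) \<omega>) + phi_sharp M F t T \<phi> a \<omega>)"

definition proc_avg :: "nat \<Rightarrow> (nat \<Rightarrow> 'a proc) \<Rightarrow> 'a proc" where
  "proc_avg n X = (\<lambda>s \<omega>. (\<Sum>i\<in>{1..n}. X i s \<omega>) / real n)"

definition proc_sum :: "nat \<Rightarrow> (nat \<Rightarrow> 'a proc) \<Rightarrow> 'a proc" where
  "proc_sum n X = (\<lambda>s \<omega>. \<Sum>i\<in>{1..n}. X i s \<omega>)"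

definition rearrangements :: "'a measure \<Rightarrow> (nat \<Rightarrow> 'a measure) \<Rightarrow> nat \<Rightarrow> nat
     \<Rightarrow> nat \<Rightarrow> (nat \<Rightarrow> 'a proc) \<Rightarrow> (nat \<Rightarrow> 'a proc) set" where
  "rearrangements M F t T n X =
     {Y. \<forall>i\<in>{1..n}. Y i \<in> Rinf_tT M F t T \<and> same_law M t T (Y i) (X i)}"

definition worst_scenario :: "'a measure \<Rightarrow> (nat \<Rightarrow> 'a measure) \<Rightarrow> nat \<Rightarrow> nat
     \<Rightarrow> ('a proc \<Rightarrow> 'a \<Rightarrow> real) \<Rightarrow> nat \<Rightarrow> (nat \<Rightarrow> 'a proc) \<Rightarrow> 'a proc \<Rightarrow> bool" where
  "worst_scenario M F t T \<phi> n X a0 \<longleftrightarrow> a0 \<in> D_tT M F t T \<and>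
     (AE \<omega> in M. avg_risk M F t T \<phi> n X a0 \<omega>
        = ess_sup M (avg_risk M F t T \<phi> n X ` D_tT M F t T) \<omega>)"

definition a_comonotone :: "'a measure \<Rightarrow> (nat \<Rightarrow> 'a measure) \<Rightarrow> nat \<Rightarrow> nat
     \<Rightarrow> nat \<Rightarrow> 'a proc \<Rightarrow> (nat \<Rightarrow> 'a proc) \<Rightarrow> bool" where
  "a_comonotone M F t T n a0 Y \<longleftrightarrow>
     (\<forall>i\<in>{1..n}. AE \<omega> in M. Psi_a M F t T a0 (Y i) \<omega> = ereal (pairing M F t T (Y i) a0 \<omega>))
   \<and> (AE \<omega> in M. Psi_a M F t T a0 (proc_sum n Y) \<omega> = ereal (pairing M F t T (proc_sum n Y) a0 \<omega>))"

end

theory Submission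
  imports Defs
begin

text \<open>
  Both parts follow from the dual representation
  \<open>\<phi>(X) = ess inf\<^bsub>a \<in> D\<^esub> (\<langle>X, a\<rangle> - \<phi>\<^sup>#(a))\<close>. Given it, (i) is an exchange of two essential suprema,
  the inner one splitting over the components because they are rearranged independently, and (ii) is the
  Fenchel inequality \<open>\<langle>X, a\<^sup>0\<rangle> + \<phi>\<^sup>#(a\<^sup>0) \<le> \<Psi>(X)\<close> at the comonotone portfolio.

  For the representation, processes become functions on the optional measure space
  \<open>{t..T} \<times> \<Omega>\<close>. Continuity from above makes \<open>{H. E \<phi>(X\<^sub>0 + H) \<ge> E \<phi>(X\<^sub>0) + \<epsilon>}\<close> closed
  under bounded almost everywhere limits. A Krein--Smulian argument separates such a convex, upward closed
  set from \<open>0\<close> by an integrable density: one builds inductively a sublinear functional that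
  exceeds \<open>1\<close> on the set and is small on indicators of small events, so that every linear functional below it
  is countably additive, and applies Hahn--Banach. The density is the increment process of a scenario
  \<open>a \<in> D\<close> that is optimal up to \<open>\<epsilon>\<close> in expectation. Letting \<open>\<epsilon>\<close> tend to \<open>0\<close> gives the representation
  almost surely.
\<close>


section \<open>Sublinear functionals and the Hahn--Banach theorem\<close>

text \<open>The obstacle is that the dual of the bounded measurable functions contains charges that
  are only finitely additive, so a bare Hahn--Banach separation would not produce a scenario. The
  functional is therefore first dominated by a supremum of genuine densities with controlled caps
  and masses.

  The separated functional is the real-valued E phi, although the claim is conditional on
  \<open>F t\<close>. Two features of phi restore the conditioning. Cash additivity for
  \<open>F t\<close>-measurable amounts forces the density to have conditional mass 1: a linear
  function of the amount that is bounded above must vanish. Locality lets positions be pasted along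
  events of \<open>F t\<close>, so a bound on expectations controls a conditional infimum.

  Essential suprema and infima are determined only up to null sets. Arguments at a single sample
  point, such as choosing near-maximisers, thus run along countable subfamilies on which all
  inequalities hold simultaneously.\<close>

definition sublinear_on :: "('b \<Rightarrow> real) set \<Rightarrow> (('b \<Rightarrow> real) \<Rightarrow> real) \<Rightarrow> bool" where
  "sublinear_on V p \<longleftrightarrow> (\<forall>f\<in>V. \<forall>g\<in>V. p (\<lambda>x. f x + g x) \<le> p f + p g)
     \<and> (\<forall>f\<in>V. \<forall>c\<ge>0. p (\<lambda>x. c * f x) \<le> c * p f)"

definition linear_subspace :: "('b \<Rightarrow> real) set \<Rightarrow> bool" where
  "linear_subspace V \<longleftrightarrow> V \<noteq> {} \<and> (\<forall>f\<in>V. \<forall>g\<in>V. \<forall>a b. (\<lambda>x. a * f x + b * g x) \<in> V)"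

lemma linear_subspaceD:
  assumes "linear_subspace V"
  shows "f \<in> V \<Longrightarrow> g \<in> V \<Longrightarrow> (\<lambda>x. f x + g x) \<in> V"
    and "f \<in> V \<Longrightarrow> (\<lambda>x. c * f x) \<in> V"
    and "f \<in> V \<Longrightarrow> (\<lambda>x. - f x) \<in> V"
    and "f \<in> V \<Longrightarrow> g \<in> V \<Longrightarrow> (\<lambda>x. f x + c * g x) \<in> V"
    and "f \<in> V \<Longrightarrow> g \<in> V \<Longrightarrow> (\<lambda>x. a * f x + b * g x) \<in> V"
    and "(\<lambda>x. 0) \<in> V"
proof -
  have *: "\<And>f g a b. f \<in> V \<Longrightarrow> g \<in> V \<Longrightarrow> (\<lambda>x. a * f x + b * g x) \<in> V"
    using assms by (auto simp: linear_subspace_def)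
  show "f \<in> V \<Longrightarrow> g \<in> V \<Longrightarrow> (\<lambda>x. f x + g x) \<in> V" using *[of f g 1 1] by simp
  show "f \<in> V \<Longrightarrow> (\<lambda>x. c * f x) \<in> V" using *[of f f c 0] by simp
  show "f \<in> V \<Longrightarrow> (\<lambda>x. - f x) \<in> V" using *[of f f "-1" 0] by simp
  show "f \<in> V \<Longrightarrow> g \<in> V \<Longrightarrow> (\<lambda>x. f x + c * g x) \<in> V" using *[of f g 1 c] by simp
  show "f \<in> V \<Longrightarrow> g \<in> V \<Longrightarrow> (\<lambda>x. a * f x + b * g x) \<in> V" using *[of f g a b] by simp
  obtain f where "f \<in> V" using assms by (auto simp: linear_subspace_def)
  thus "(\<lambda>x. 0) \<in> V" using *[of f f 0 0] by simp
qed

lemma sublinear_on_add: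
  assumes "sublinear_on V p" "f \<in> V" "g \<in> V"
  shows "p (\<lambda>x. f x + g x) \<le> p f + p g"
  using assms unfolding sublinear_on_def by blast

lemma sublinear_on_zero:
  assumes V: "linear_subspace V" and p: "sublinear_on V p"
  shows "p (\<lambda>x. 0) = 0"
proof -
  note z = linear_subspaceD(6)[OF V]
  have "p (\<lambda>x. 0 + 0) \<le> p (\<lambda>x. 0) + p (\<lambda>x. 0)"
    by (rule sublinear_on_add[OF p z z])
  moreover have "\<forall>c\<ge>0. p (\<lambda>x. c * 0) \<le> c * p (\<lambda>x. 0)"
    by (rule bspec[OF conjunct2[OF p[unfolded sublinear_on_def]] z])
  ultimately show ?thesis by (force dest: spec[of _ 0])
qed

lemma sublinear_on_lower:
  assumes V: "linear_subspace V" and p: "sublinear_on V p" and f: "f \<in> V"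
  shows "- p (\<lambda>x. - f x) \<le> p f"
proof -
  have "p (\<lambda>x. f x + - f x) \<le> p f + p (\<lambda>x. - f x)"
    by (rule sublinear_on_add[OF p f linear_subspaceD(3)[OF V f]])
  thus ?thesis using sublinear_on_zero[OF V p] by simp
qed

text \<open>The inequality required by \<open>sublinear_on\<close> is applied once more with factor
  1/c to c f, which gives the reverse one; c = 0 is \<open>sublinear_on_zero\<close>.\<close>

lemma sublinear_on_scale:
  assumes V: "linear_subspace V" and p: "sublinear_on V p" and f: "f \<in> V" and c: "0 \<le> c"
  shows "p (\<lambda>x. c * f x) = c * p f"
proof (cases "c = 0")
  case True
  thus ?thesis using sublinear_on_zero[OF V p] by simp
next
  case False
  hence c': "c > 0" using c by simp
  have 1: "p (\<lambda>x. c * f x) \<le> c * p f" using p f c unfolding sublinear_on_def by blast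
  have "p (\<lambda>x. (1/c) * (c * f x)) \<le> (1/c) * p (\<lambda>x. c * f x)"
    using p linear_subspaceD(2)[OF V f, of c] c' unfolding sublinear_on_def
    by (meson divide_nonneg_pos zero_le_one)
  hence "p f \<le> p (\<lambda>x. c * f x) / c" using c' by simp
  hence "c * p f \<le> p (\<lambda>x. c * f x)" using c' by (simp add: field_simps)
  thus ?thesis using 1 by simp
qed

text \<open>\<open>p'\<close> is the largest sublinear functional below \<open>p\<close> that is at
  most \<open>- \<beta>\<close> on the negatives of \<open>C\<close>: moving by \<open>l * k\<close>
  is rebated by \<open>l * \<beta>\<close>. Any linear functional below \<open>p'\<close> is then at
  least \<open>\<beta>\<close> on \<open>C\<close>. It serves twice: for a singleton
  \<open>C\<close> inside Hahn--Banach, and for the convex set to be separated.\<close>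

lemma sublinear_on_support:
  assumes V: "linear_subspace V" and p: "sublinear_on V p"
    and C: "C \<subseteq> V" "C \<noteq> {}"
    and conv: "\<And>f g u. f \<in> C \<Longrightarrow> g \<in> C \<Longrightarrow> 0 \<le> u \<Longrightarrow> u \<le> 1 \<Longrightarrow> (\<lambda>x. u * f x + (1 - u) * g x) \<in> C"
    and \<beta>: "\<And>f. f \<in> C \<Longrightarrow> \<beta> \<le> p f"
  shows "\<exists>p'. sublinear_on V p' \<and> (\<forall>f\<in>V. p' f \<le> p f) \<and> (\<forall>f\<in>C. p' (\<lambda>x. - f x) \<le> - \<beta>)"
proof -
  define Q where "Q h = {p (\<lambda>x. h x + l * k x) - l * \<beta> | l k. 0 \<le> l \<and> k \<in> C}" for h
  define p' where "p' h = Inf (Q h)" for h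
  have padd: "\<And>f g. f \<in> V \<Longrightarrow> g \<in> V \<Longrightarrow> p (\<lambda>x. f x + g x) \<le> p f + p g"
    using p unfolding sublinear_on_def by blast
  have ne: "Q h \<noteq> {}" for h using C unfolding Q_def by blast
  \<comment> \<open>The bound \<open>\<beta>\<close> below \<open>p\<close> on \<open>C\<close>
    keeps the infimum finite: p (h + l k) >= l p k - p (- h), and l p k covers l times
    \<open>\<beta>\<close>.\<close>
  have low: "- p (\<lambda>x. - h x) \<le> y" if h: "h \<in> V" and y: "y \<in> Q h" for h y
  proof -
    from y obtain l k where lk: "0 \<le> l" "k \<in> C" and y': "y = p (\<lambda>x. h x + l * k x) - l * \<beta>"
      by (auto simp: Q_def)
    have k: "k \<in> V" using lk C by auto
    have "p (\<lambda>x. (h x + l * k x) + - h x) \<le> p (\<lambda>x. h x + l * k x) + p (\<lambda>x. - h x)"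
      by (intro padd linear_subspaceD(3,4)[OF V] h k)
    moreover have "p (\<lambda>x. l * k x) = l * p k" by (rule sublinear_on_scale[OF V p k lk(1)])
    moreover have "l * \<beta> \<le> l * p k" using \<beta>[OF lk(2)] lk(1) by (rule mult_left_mono)
    ultimately show ?thesis unfolding y' by simp
  qed
  have bdd: "bdd_below (Q h)" if "h \<in> V" for h using low[OF that] by (rule bdd_belowI)
  have upper: "p' h \<le> p (\<lambda>x. h x + l * k x) - l * \<beta>" if "h \<in> V" "0 \<le> l" "k \<in> C" for h l k
    unfolding p'_def by (rule cInf_lower[OF _ bdd[OF that(1)]]) (use that in \<open>auto simp: Q_def\<close>)
  have approx: "\<exists>l k. 0 \<le> l \<and> k \<in> C \<and> p (\<lambda>x. h x + l * k x) - l * \<beta> < p' h + e"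
    if "h \<in> V" "0 < e" for h e
  proof -
    have "Inf (Q h) < p' h + e" using that by (simp add: p'_def)
    from cInf_lessD[OF ne this] show ?thesis by (auto simp: Q_def)
  qed
  obtain k0 where k0: "k0 \<in> C" using C by auto
  have "p' (\<lambda>x. f x + g x) \<le> p' f + p' g" if f: "f \<in> V" and g: "g \<in> V" for f g
  proof (rule field_le_epsilon)
    fix e :: real assume "e > 0"
    hence e: "e/2 > 0" by simp
    obtain l1 k1 where 1: "0 \<le> l1" "k1 \<in> C" "p (\<lambda>x. f x + l1 * k1 x) - l1 * \<beta> < p' f + e/2"
      using approx[OF f e] by blast
    obtain l2 k2 where 2: "0 \<le> l2" "k2 \<in> C" "p (\<lambda>x. g x + l2 * k2 x) - l2 * \<beta> < p' g + e/2"
      using approx[OF g e] by blast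
    \<comment> \<open>Convexity merges the two near-minimisers into their average with weights
      proportional to \<open>l1\<close> and \<open>l2\<close>. If both weights vanish, any element
      of \<open>C\<close> will do.\<close>
    obtain k where k: "k \<in> C" "\<And>x. (l1 + l2) * k x = l1 * k1 x + l2 * k2 x"
    proof (cases "l1 + l2 = 0")
      case True
      with 1 2 have "l1 = 0" "l2 = 0" by auto
      thus ?thesis using that[of k0] k0 by simp
    next
      case False
      hence pos: "l1 + l2 > 0" using 1 2 by linarith
      define u where "u = l1 / (l1 + l2)"
      have u: "0 \<le> u" "u \<le> 1" "(l1 + l2) * u = l1" "(l1 + l2) * (1 - u) = l2"
        using pos 1 2 by (auto simp: u_def field_simps)
      show ?thesis
      proof (rule that[of "\<lambda>x. u * k1 x + (1 - u) * k2 x"])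
        show "(\<lambda>x. u * k1 x + (1 - u) * k2 x) \<in> C" using conv 1 2 u by blast
        show "(l1 + l2) * (u * k1 x + (1 - u) * k2 x) = l1 * k1 x + l2 * k2 x" for x
          using u(3,4) by (metis distrib_left mult.assoc)
      qed
    qed
    have "p' (\<lambda>x. f x + g x) \<le> p (\<lambda>x. (f x + g x) + (l1 + l2) * k x) - (l1 + l2) * \<beta>"
      by (rule upper) (use linear_subspaceD(1)[OF V f g] 1 2 k in auto)
    also have "(\<lambda>x. (f x + g x) + (l1 + l2) * k x) = (\<lambda>x. (f x + l1 * k1 x) + (g x + l2 * k2 x))"
      unfolding k(2) by (simp add: algebra_simps)
    also have "p \<dots> \<le> p (\<lambda>x. f x + l1 * k1 x) + p (\<lambda>x. g x + l2 * k2 x)"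
      by (intro padd linear_subspaceD(4)[OF V] f g) (use 1 2 C in auto)
    finally show "p' (\<lambda>x. f x + g x) \<le> p' f + p' g + e"
      using 1 2 by (simp add: algebra_simps)
  qed
  moreover have "p' (\<lambda>x. c * f x) \<le> c * p' f" if f: "f \<in> V" and c: "0 \<le> c" for f c
  proof (cases "c = 0")
    case True
    have "p' (\<lambda>x. 0) \<le> p (\<lambda>x. 0 + 0 * k0 x) - 0 * \<beta>"
      by (rule upper) (use linear_subspaceD(6)[OF V] k0 in auto)
    thus ?thesis using True sublinear_on_zero[OF V p] by simp
  next
    case False
    hence c': "c > 0" using c by simp
    show ?thesis
    proof (rule field_le_epsilon)
      fix e :: real assume e: "e > 0"
      obtain l k where 1: "0 \<le> l" "k \<in> C" "p (\<lambda>x. f x + l * k x) - l * \<beta> < p' f + e/c"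
        using approx[OF f, of "e/c"] e c' by auto
      have k: "k \<in> V" using 1 C by auto
      have "p' (\<lambda>x. c * f x) \<le> p (\<lambda>x. c * f x + (c * l) * k x) - (c * l) * \<beta>"
        by (rule upper) (use linear_subspaceD(2)[OF V f] 1 c' in auto)
      also have "(\<lambda>x. c * f x + (c * l) * k x) = (\<lambda>x. c * (f x + l * k x))"
        by (simp add: algebra_simps)
      also have "p \<dots> = c * p (\<lambda>x. f x + l * k x)"
        by (rule sublinear_on_scale[OF V p linear_subspaceD(4)[OF V f k] c])
      also have "\<dots> - c * l * \<beta> = c * (p (\<lambda>x. f x + l * k x) - l * \<beta>)" by (simp add: algebra_simps)
      also have "\<dots> \<le> c * (p' f + e/c)" using 1(3) c' by (intro mult_left_mono) auto
      finally show "p' (\<lambda>x. c * f x) \<le> c * p' f + e" using c' by (simp add: algebra_simps)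
    qed
  qed
  ultimately have "sublinear_on V p'" unfolding sublinear_on_def by blast
  moreover have "\<forall>f\<in>V. p' f \<le> p f" using upper[of _ 0 k0] k0 by simp
  moreover have "p' (\<lambda>x. - f x) \<le> - \<beta>" if f: "f \<in> C" for f
    using upper[of "\<lambda>x. - f x" 1 f] f C linear_subspaceD(3)[OF V] sublinear_on_zero[OF V p] by auto
  ultimately show ?thesis by blast
qed

text \<open>A minimal sublinear functional is linear. Zorn's lemma is applied to sublinear
  functionals below \<open>q\<close> rather than to linear extensions from subspaces.\<close>

theorem hahn_banach_function_space:
  assumes V: "linear_subspace V" and q: "sublinear_on V q"
  shows "\<exists>l. (\<forall>f\<in>V. \<forall>g\<in>V. \<forall>a b. l (\<lambda>x. a * f x + b * g x) = a * l f + b * l g)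
           \<and> (\<forall>f\<in>V. l f \<le> q f)"
proof -
  \<comment> \<open>Values outside \<open>V\<close> are fixed to 0, so that the pointwise order on
    total functions compares only behaviour on \<open>V\<close> and minimality yields an equation
    between functions.\<close>
  define S where "S = {p. sublinear_on V p \<and> (\<forall>f\<in>V. p f \<le> q f) \<and> (\<forall>f. f \<notin> V \<longrightarrow> p f = 0)}"
  have inS: "(\<lambda>f. if f \<in> V then p f else 0) \<in> S" if "sublinear_on V p" "\<forall>f\<in>V. p f \<le> q f" for p
    using that linear_subspaceD(1,2)[OF V] unfolding S_def sublinear_on_def by auto
  have lower: "- q (\<lambda>x. - f x) \<le> p f" if "p \<in> S" "f \<in> V" for p f
  proof -
    have "- p (\<lambda>x. - f x) \<le> p f" using sublinear_on_lower[OF V _ that(2)] that(1) by (simp add: S_def)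
    moreover have "p (\<lambda>x. - f x) \<le> q (\<lambda>x. - f x)"
      using that linear_subspaceD(3)[OF V] by (simp add: S_def)
    ultimately show ?thesis by simp
  qed
  \<comment> \<open>The order is reversed because Zorn's lemma delivers maximal elements.\<close>
  have "\<exists>m\<in>S. \<forall>a\<in>S. (\<lambda>p p'. p' \<le> p) m a \<longrightarrow> a = m"
  proof (rule predicate_Zorn)
    show "partial_order_on S (relation_of (\<lambda>p p'. p' \<le> p) S)"
      by (rule partial_order_on_relation_ofI) auto
  next
    fix Ch assume Ch: "Ch \<in> Chains (relation_of (\<lambda>p p'. p' \<le> p) S)"
    have ChS: "Ch \<subseteq> S" using Chains_relation_of[OF Ch] .
    have tot: "p \<le> p' \<or> p' \<le> p" if "p \<in> Ch" "p' \<in> Ch" for p p'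
      using Ch that unfolding Chains_def relation_of_def by auto
    show "\<exists>u\<in>S. \<forall>a\<in>Ch. u \<le> a"
    proof (cases "Ch = {}")
      case True
      thus ?thesis using inS[OF q] by blast
    next
      case False
      \<comment> \<open>The pointwise infimum of the chain; it is finite since every member at f is
        at least - q (- f).\<close>
      define r where "r f = (INF p\<in>Ch. p f)" for f
      have bdd: "bdd_below ((\<lambda>p. p f) ` Ch)" if "f \<in> V" for f
        using lower ChS that by (intro bdd_belowI[of _ "- q (\<lambda>x. - f x)"]) auto
      have rle: "r f \<le> p f" if "f \<in> V" "p \<in> Ch" for f p
        unfolding r_def by (rule cINF_lower[OF bdd[OF that(1)] that(2)])
      have rapprox: "\<exists>p\<in>Ch. p f < r f + e" if "f \<in> V" "e > 0" for f e
        using cINF_less_iff[OF False bdd[OF that(1)], of "r f + e"] that by (simp add: r_def)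
      have chS: "sublinear_on V p" "\<And>f. f \<in> V \<Longrightarrow> p f \<le> q f" if "p \<in> Ch" for p
        using ChS that by (auto simp: S_def)
      obtain p0 where p0: "p0 \<in> Ch" using False by auto
      have "r (\<lambda>x. f x + g x) \<le> r f + r g" if f: "f \<in> V" and g: "g \<in> V" for f g
      proof (rule field_le_epsilon)
        fix e :: real assume "e > 0"
        hence e: "e/2 > 0" by simp
        obtain p1 where 1: "p1 \<in> Ch" "p1 f < r f + e/2" using rapprox[OF f e] by auto
        obtain p2 where 2: "p2 \<in> Ch" "p2 g < r g + e/2" using rapprox[OF g e] by auto
        \<comment> \<open>By totality the smaller of \<open>p1\<close> and \<open>p2\<close> is near
          the infimum at f and at g simultaneously.\<close>
        obtain p where p: "p \<in> Ch" "p \<le> p1" "p \<le> p2" using tot[OF 1(1) 2(1)] 1 2 by auto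
        have "r (\<lambda>x. f x + g x) \<le> p (\<lambda>x. f x + g x)"
          using rle[OF linear_subspaceD(1)[OF V f g] p(1)] .
        also have "\<dots> \<le> p f + p g" using chS(1)[OF p(1)] f g unfolding sublinear_on_def by blast
        also have "\<dots> \<le> p1 f + p2 g" using p by (auto simp: le_fun_def intro: add_mono)
        finally show "r (\<lambda>x. f x + g x) \<le> r f + r g + e" using 1 2 by simp
      qed
      moreover have "r (\<lambda>x. c * f x) \<le> c * r f" if f: "f \<in> V" and c: "0 \<le> c" for f c
      proof (rule field_le_epsilon)
        fix e :: real assume e: "e > 0"
        \<comment> \<open>The denominator c + 1 stays positive for c = 0, and c times e / (c + 1) is
          at most e.\<close>
        obtain p where p: "p \<in> Ch" "p f < r f + e / (c + 1)"
          using rapprox[OF f, of "e / (c + 1)"] e c by auto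
        have "r (\<lambda>x. c * f x) \<le> p (\<lambda>x. c * f x)" using rle[OF linear_subspaceD(2)[OF V f] p(1)] .
        also have "\<dots> \<le> c * p f" using chS(1)[OF p(1)] f c unfolding sublinear_on_def by blast
        also have "\<dots> \<le> c * (r f + e / (c + 1))" using p c by (intro mult_left_mono) auto
        also have "\<dots> \<le> c * r f + e" using c e by (simp add: field_simps)
        finally show "r (\<lambda>x. c * f x) \<le> c * r f + e" .
      qed
      ultimately have "sublinear_on V r" unfolding sublinear_on_def by blast
      moreover have "\<forall>f\<in>V. r f \<le> q f" using rle[OF _ p0] chS(2)[OF p0] by force
      ultimately have "(\<lambda>f. if f \<in> V then r f else 0) \<in> S" by (rule inS)
      moreover have "\<forall>p\<in>Ch. (\<lambda>f. if f \<in> V then r f else 0) \<le> p"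
        using rle ChS by (auto simp: le_fun_def S_def subset_iff)
      ultimately show ?thesis by blast
    qed
  qed
  then obtain l where lS: "l \<in> S" and lmin: "\<And>p. p \<in> S \<Longrightarrow> p \<le> l \<Longrightarrow> p = l" by blast
  have l: "sublinear_on V l" "\<forall>f\<in>V. l f \<le> q f" using lS by (auto simp: S_def)
  have odd: "l (\<lambda>x. - f x) = - l f" if f: "f \<in> V" for f
  proof -
    \<comment> \<open>Supporting the singleton {f} at level l f gives a sublinear functional below
      l. By minimality it is l itself, hence l (- f) <= - l f.\<close>
    have "\<exists>p'. sublinear_on V p' \<and> (\<forall>g\<in>V. p' g \<le> l g) \<and> (\<forall>g\<in>{f}. p' (\<lambda>x. - g x) \<le> - l f)"
      using f by (intro sublinear_on_support[OF V l(1)]) (auto simp: algebra_simps)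
    then obtain p' where p': "sublinear_on V p'" "\<forall>g\<in>V. p' g \<le> l g" "p' (\<lambda>x. - f x) \<le> - l f"
      by auto
    have "(\<lambda>g. if g \<in> V then p' g else 0) \<in> S" using p' l by (intro inS) force+
    moreover have "(\<lambda>g. if g \<in> V then p' g else 0) \<le> l" using p' lS by (auto simp: le_fun_def S_def)
    ultimately have "(\<lambda>g. if g \<in> V then p' g else 0) = l" by (rule lmin)
    from fun_cong[OF this, of "\<lambda>x. - f x"] have "l (\<lambda>x. - f x) \<le> - l f"
      using p'(3) linear_subspaceD(3)[OF V f] by simp
    thus ?thesis using sublinear_on_lower[OF V l(1) f] by simp
  qed
  have ladd: "l (\<lambda>x. f x + g x) = l f + l g" if f: "f \<in> V" and g: "g \<in> V" for f g
  proof (rule antisym)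
    show "l (\<lambda>x. f x + g x) \<le> l f + l g" using l(1) f g unfolding sublinear_on_def by blast
    have "l (\<lambda>x. (f x + g x) + - g x) \<le> l (\<lambda>x. f x + g x) + l (\<lambda>x. - g x)"
      by (rule sublinear_on_add[OF l(1) linear_subspaceD(1)[OF V f g] linear_subspaceD(3)[OF V g]])
    thus "l f + l g \<le> l (\<lambda>x. f x + g x)" using odd[OF g] by simp
  qed
  have lscale: "l (\<lambda>x. c * f x) = c * l f" if f: "f \<in> V" for f c
  proof (cases "0 \<le> c")
    case True
    thus ?thesis using sublinear_on_scale[OF V l(1) f] by simp
  next
    case False
    have "l (\<lambda>x. (- c) * - f x) = (- c) * l (\<lambda>x. - f x)"
      using False by (intro sublinear_on_scale[OF V l(1) linear_subspaceD(3)[OF V f]]) simp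
    thus ?thesis using odd[OF f] by simp
  qed
  have "l (\<lambda>x. a * f x + b * g x) = a * l f + b * l g" if "f \<in> V" "g \<in> V" for f g a b
    using ladd[of "\<lambda>x. a * f x" "\<lambda>x. b * g x"] lscale that linear_subspaceD(2)[OF V] by simp
  thus ?thesis using l(2) by blast
qed

section \<open>Almost everywhere limits along convex sets\<close>

text \<open>Near-minimisers of the L2 norm over nested convex sets are Cauchy by the parallelogram
  law, even though no set is assumed closed. A fast subsequence converges almost everywhere, and its
  n-th term still lies in the n-th set.\<close>

lemma (in finite_measure) decreasing_convex_AE_convergent:
  fixes S :: "nat \<Rightarrow> ('a \<Rightarrow> real) set"
  assumes meas: "\<And>n h. h \<in> S n \<Longrightarrow> h \<in> borel_measurable M"
    and bound: "\<And>n h x. h \<in> S n \<Longrightarrow> \<bar>h x\<bar> \<le> m"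
    and ne: "\<And>n. S n \<noteq> {}"
    and decr: "\<And>n. S (Suc n) \<subseteq> S n"
    and mid: "\<And>n h g. h \<in> S n \<Longrightarrow> g \<in> S n \<Longrightarrow> (\<lambda>x. (h x + g x) / 2) \<in> S n"
  shows "\<exists>h. (\<forall>n. h n \<in> S n) \<and> (AE x in M. convergent (\<lambda>n. h n x))"
proof -
  define I where "I h = (\<integral>x. (h x)\<^sup>2 \<partial>M)" for h :: "'a \<Rightarrow> real"
  define s where "s n = Inf (I ` S n)" for n
  have mono: "S k \<subseteq> S n" if "n \<le> k" for n k using decr that by (rule lift_Suc_antimono_le)
  have int2: "integrable M (\<lambda>x. (h x)\<^sup>2)" if "h \<in> S n" for h n
  proof (rule integrable_const_bound[where B="m\<^sup>2"])
    show "AE x in M. norm ((h x)\<^sup>2) \<le> m\<^sup>2"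
      using bound[OF that] by (auto intro!: AE_I2 abs_le_square_iff[THEN iffD1] simp: order_trans[OF _ abs_ge_self])
    show "(\<lambda>x. (h x)\<^sup>2) \<in> borel_measurable M" using meas[OF that] by measurable
  qed
  have int1: "integrable M h" if "h \<in> S n" for h n
    by (rule integrable_const_bound[where B=m]) (use meas[OF that] bound[OF that] in auto)
  have int_prod: "integrable M (\<lambda>x. h x * g x)" if "h \<in> S n" "g \<in> S k" for h g n k
  proof (rule integrable_const_bound[where B="m * m"])
    have "0 \<le> m" using bound[OF that(1)] abs_ge_zero order_trans by blast
    thus "AE x in M. norm (h x * g x) \<le> m * m"
      using bound[OF that(1)] bound[OF that(2)] by (auto intro!: AE_I2 mult_mono simp: abs_mult)
    show "(\<lambda>x. h x * g x) \<in> borel_measurable M" using meas[OF that(1)] meas[OF that(2)] by measurable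
  qed
  have I0: "0 \<le> I h" for h unfolding I_def by simp
  have bdd: "bdd_below (I ` S n)" for n using I0 by (auto intro!: bdd_belowI[of _ 0])
  have s_le: "s n \<le> I h" if "h \<in> S n" for n h
    unfolding s_def by (rule cINF_lower[OF bdd that])
  have Ile: "I h \<le> m\<^sup>2 * measure M (space M)" if "h \<in> S n" for h n
  proof -
    have "I h \<le> (\<integral>x. m\<^sup>2 \<partial>M)" unfolding I_def
      using bound[OF that]
      by (intro integral_mono int2[OF that]) (auto intro!: abs_le_square_iff[THEN iffD1] simp: order_trans[OF _ abs_ge_self])
    thus ?thesis by (simp add: mult.commute)
  qed
  have "incseq s"
  proof (rule incseq_SucI)
    show "s n \<le> s (Suc n)" for n
      unfolding s_def by (rule cINF_superset_mono[OF ne bdd]) (use decr in auto)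
  qed
  moreover have "s n \<le> m\<^sup>2 * measure M (space M)" for n
    using ne[of n] s_le Ile by (metis all_not_in_conv order_trans)
  ultimately obtain L where L: "s \<longlonglongrightarrow> L" "\<And>n. s n \<le> L"
    using incseq_convergent[of s "m\<^sup>2 * measure M (space M)"] by metis
  have "\<exists>g. g \<in> S n \<and> I g < s n + (1/2)^n" for n
  proof -
    have "\<exists>g\<in>S n. I g < s n + (1/2)^n"
      by (rule cINF_less_iff[OF ne bdd, THEN iffD1]) (simp add: s_def)
    thus ?thesis by auto
  qed
  then obtain g where gS: "\<And>n. g n \<in> S n" and gI: "\<And>n. I (g n) < s n + (1/2)^n" by metis
  \<comment> \<open>The squared distance of g n and g k is 2 I (g n) + 2 I (g k) minus 4 times I of
    the midpoint. For n <= k the midpoint lies in \<open>S n\<close>, so its I is at least s n; with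
    s k <= L and (1/2)^k <= (1/2)^n this gives \<open>\<delta> n\<close>.\<close>
  define \<delta> where "\<delta> n = 2 * (L - s n) + 4 * (1/2)^n" for n
  have par: "(\<integral>x. (g n x - g k x)\<^sup>2 \<partial>M) \<le> \<delta> n" if "n \<le> k" for n k
  proof -
    have gk: "g k \<in> S n" using gS mono[OF that] by auto
    note ints = int2[OF gS[of n]] int2[OF gk] int_prod[OF gS[of n] gk]
    have "(\<integral>x. (g n x - g k x)\<^sup>2 \<partial>M) = (\<integral>x. (g n x)\<^sup>2 + (g k x)\<^sup>2 - 2 * (g n x * g k x) \<partial>M)"
      by (simp add: power2_diff mult.assoc)
    also have "\<dots> = I (g n) + I (g k) - 2 * (\<integral>x. g n x * g k x \<partial>M)"
      using ints by (simp add: I_def)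
    finally have 1: "(\<integral>x. (g n x - g k x)\<^sup>2 \<partial>M) = I (g n) + I (g k) - 2 * (\<integral>x. g n x * g k x \<partial>M)" .
    have "I (\<lambda>x. (g n x + g k x) / 2) = (\<integral>x. ((g n x)\<^sup>2 + (g k x)\<^sup>2 + 2 * (g n x * g k x)) / 4 \<partial>M)"
      unfolding I_def by (simp add: power_divide power2_sum mult.assoc)
    also have "\<dots> = (I (g n) + I (g k) + 2 * (\<integral>x. g n x * g k x \<partial>M)) / 4"
      using ints by (simp add: I_def)
    finally have 2: "I (\<lambda>x. (g n x + g k x) / 2) = (I (g n) + I (g k) + 2 * (\<integral>x. g n x * g k x \<partial>M)) / 4" .
    have "s n \<le> I (\<lambda>x. (g n x + g k x) / 2)" by (intro s_le mid gS gk)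
    moreover define a b :: real where "a = (1/2)^n" and "b = (1/2)^k"
    have "b \<le> a" unfolding a_def b_def using that by (intro power_decreasing) auto
    moreover have "I (g n) < s n + a" "I (g k) < s k + b" "\<delta> n = 2 * (L - s n) + 4 * a"
      using gI by (auto simp: a_def b_def \<delta>_def)
    moreover have "D \<le> \<delta>n" if "sn \<le> Im" "b \<le> a" "In < sn + a" "Ik < sk + b"
      "\<delta>n = 2 * (L - sn) + 4 * a" "D = In + Ik - 2 * J" "Im = (In + Ik + 2 * J) / 4" "sk \<le> L"
      for D \<delta>n sn sk Im In Ik J :: real
      using that by (simp add: field_simps)
    ultimately show ?thesis using 1 2 L(2)[of k] by blast
  qed
  have "\<delta> \<longlonglongrightarrow> 2 * (L - L) + 4 * 0" unfolding \<delta>_def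
    by (intro tendsto_intros L LIMSEQ_power_zero) auto
  hence \<delta>0: "\<delta> \<longlonglongrightarrow> 0" by simp
  have "\<exists>N\<ge>n. \<delta> N \<le> (1/4)^n" for n
  proof -
    have "eventually (\<lambda>N. \<delta> N < (1/4)^n) sequentially" using \<delta>0 by (rule order_tendstoD) simp
    thus ?thesis unfolding eventually_sequentially by (meson le_cases less_imp_le order_refl)
  qed
  then obtain N where N: "\<And>n. n \<le> N n" "\<And>n. \<delta> (N n) \<le> (1/4)^n" by metis
  \<comment> \<open>A nondecreasing choice of indices above \<open>N n\<close>, hence above n: the
    n-th chosen term lies in \<open>S n\<close>, and consecutive terms differ by at most 2 (1/4)^n
    in squared norm.\<close>
  define r where "r = rec_nat (N 0) (\<lambda>n p. max p (N (Suc n)))"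
  have rSuc: "r n \<le> r (Suc n)" for n by (simp add: r_def)
  have rN: "N n \<le> r n" for n by (cases n) (auto simp: r_def)
  have \<delta>mono: "\<delta> k \<le> 2 * \<delta> n" if "n \<le> k" for n k
  proof -
    have "s n \<le> s k" using \<open>incseq s\<close> that by (simp add: incseqD)
    moreover have "(1/2::real)^k \<le> (1/2)^n" using that by (intro power_decreasing) auto
    moreover have "s n \<le> L" "s k \<le> L" using L by auto
    ultimately show ?thesis unfolding \<delta>_def by (smt (verit) zero_le_power divide_nonneg_pos)
  qed
  define h where "h n = g (r n)" for n
  have hS: "h n \<in> S n" for n
    using gS[of "r n"] mono[of n "r n"] N(1)[of n] rN[of n] by (auto simp: h_def)
  define d where "d n x = h (Suc n) x - h n x" for n x
  have dm[measurable]: "d n \<in> borel_measurable M" for n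
    unfolding d_def using meas[OF hS] by measurable
  have dint: "integrable M (d n)" for n unfolding d_def using int1[OF hS] by auto
  have dI: "(\<integral>x. (d n x)\<^sup>2 \<partial>M) \<le> 2 * (1/4)^n" for n
  proof -
    have "(\<integral>x. (d n x)\<^sup>2 \<partial>M) = (\<integral>x. (g (r n) x - g (r (Suc n)) x)\<^sup>2 \<partial>M)"
      by (simp add: d_def h_def power2_commute)
    also have "\<dots> \<le> \<delta> (r n)" by (rule par[OF rSuc])
    also have "\<dots> \<le> 2 * \<delta> (N n)" by (rule \<delta>mono[OF rN])
    finally show ?thesis using N(2)[of n] by simp
  qed
  have d2int: "integrable M (\<lambda>x. (d n x)\<^sup>2)" for n
  proof -
    have "integrable M (\<lambda>x. (h (Suc n) x)\<^sup>2 + (h n x)\<^sup>2 - 2 * (h (Suc n) x * h n x))"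
      using int2[OF hS] int_prod[OF hS hS] by auto
    thus ?thesis by (simp add: d_def power2_diff mult.assoc)
  qed
  have dabs: "(\<integral>x. \<bar>d n x\<bar> \<partial>M) \<le> (measure M (space M) + 2) * (1/2)^n" for n
  proof -
    \<comment> \<open>This takes the place of Cauchy--Schwarz: weighted against the rate (1/4)^n of
      the squares, both terms become of order (1/2)^n, which is summable.\<close>
    have "\<bar>y\<bar> \<le> (1/2)^n + 2^n * y\<^sup>2" for y :: real
    proof -
      define a :: real where "a = (1/2)^n"
      have a: "2^n * a = 1" by (simp add: a_def power_one_over)
      have "0 \<le> 2^n * (a - \<bar>y\<bar>)\<^sup>2" by simp
      also have "2^n * (a - \<bar>y\<bar>)\<^sup>2 = (2^n * a) * a - 2 * (2^n * a) * \<bar>y\<bar> + 2^n * y\<^sup>2"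
        by (simp add: power2_diff power2_eq_square algebra_simps)
      finally have "2 * \<bar>y\<bar> \<le> (1/2)^n + 2^n * y\<^sup>2" unfolding a by (simp add: a_def)
      thus ?thesis by simp
    qed
    hence "(\<integral>x. \<bar>d n x\<bar> \<partial>M) \<le> (\<integral>x. (1/2)^n + 2^n * (d n x)\<^sup>2 \<partial>M)"
      using dint d2int by (intro integral_mono) auto
    also have "\<dots> = (1/2)^n * measure M (space M) + 2^n * (\<integral>x. (d n x)\<^sup>2 \<partial>M)"
      using d2int by simp
    also have "\<dots> \<le> (1/2)^n * measure M (space M) + 2^n * (2 * (1/4)^n)"
      using dI[of n] by (intro add_left_mono mult_left_mono) auto
    also have "(2::real)^n * (2 * (1/4)^n) = 2 * (1/2)^n"
      by (simp add: power_mult_distrib[symmetric] mult.left_commute)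
    finally show ?thesis by (simp add: algebra_simps)
  qed
  have "(\<integral>\<^sup>+x. (\<Sum>n. ennreal \<bar>d n x\<bar>) \<partial>M) = (\<Sum>n. \<integral>\<^sup>+x. ennreal \<bar>d n x\<bar> \<partial>M)"
    by (rule nn_integral_suminf) measurable
  also have "\<dots> = (\<Sum>n. ennreal (\<integral>x. \<bar>d n x\<bar> \<partial>M))"
    by (subst nn_integral_eq_integral) (use dint in auto)
  also have "\<dots> \<le> (\<Sum>n. ennreal ((measure M (space M) + 2) * (1/2)^n))"
    by (intro suminf_le) (auto intro!: ennreal_leI dabs)
  also have "\<dots> = ennreal (\<Sum>n. (measure M (space M) + 2) * (1/2)^n)"
    by (intro suminf_ennreal2 summable_mult summable_geometric) auto
  also have "\<dots> < \<infinity>" by simp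
  finally have "(\<integral>\<^sup>+x. (\<Sum>n. ennreal \<bar>d n x\<bar>) \<partial>M) \<noteq> \<infinity>" by simp
  hence "AE x in M. (\<Sum>n. ennreal \<bar>d n x\<bar>) \<noteq> \<infinity>"
    by (intro nn_integral_PInf_AE) auto
  hence "AE x in M. convergent (\<lambda>n. h n x)"
  proof eventually_elim
    case (elim x)
    hence "summable (\<lambda>n. \<bar>d n x\<bar>)" by (intro summable_suminf_not_top) auto
    hence "summable (\<lambda>n. d n x)" by (rule summable_rabs_cancel)
    hence "convergent (\<lambda>n. (\<Sum>i<n. d i x))" by (simp add: summable_iff_convergent)
    hence "convergent (\<lambda>n. (h n x - h 0 x) + h 0 x)"
      by (intro convergent_add convergent_const) (simp add: d_def sum_lessThan_telescope[of "\<lambda>i. h i x"])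
    thus ?case by simp
  qed
  thus ?thesis using hS by blast
qed

section \<open>Separation by integrable densities\<close>

text \<open>Functions with a bound at every point instead of classes modulo null sets: the linear
  functionals act on functions, and null sets enter only through almost everywhere
  hypotheses.\<close>

definition bounded_measurable :: "'b measure \<Rightarrow> ('b \<Rightarrow> real) set" where
  "bounded_measurable M = {f \<in> borel_measurable M. \<exists>m. \<forall>x. \<bar>f x\<bar> \<le> m}"

text \<open>The two bounds have different tasks. The mass bound e makes the integral of f at most e
  m when f <= m and m >= 0; the cap c makes the integral over an event at most c times its measure,
  which is the source of countable additivity.\<close>

definition weight_ball :: "'b measure \<Rightarrow> real \<Rightarrow> real \<Rightarrow> ('b \<Rightarrow> real) set" where
  "weight_ball M c e = {z \<in> borel_measurable M. (\<forall>x. 0 \<le> z x \<and> z x \<le> c) \<and> (\<integral>x. z x \<partial>M) \<le> e}"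

lemma bounded_measurableD:
  assumes "f \<in> bounded_measurable M"
  shows "f \<in> borel_measurable M" and "\<exists>m\<ge>0. \<forall>x. \<bar>f x\<bar> \<le> m"
proof -
  show "f \<in> borel_measurable M" using assms by (simp add: bounded_measurable_def)
  obtain m where m: "\<forall>x. \<bar>f x\<bar> \<le> m" using assms by (auto simp: bounded_measurable_def)
  hence "0 \<le> m" using abs_ge_zero order_trans by blast
  thus "\<exists>m\<ge>0. \<forall>x. \<bar>f x\<bar> \<le> m" using m by blast
qed

lemma bounded_measurableI:
  "f \<in> borel_measurable M \<Longrightarrow> (\<And>x. \<bar>f x\<bar> \<le> m) \<Longrightarrow> f \<in> bounded_measurable M"
  by (auto simp: bounded_measurable_def)

lemma linear_subspace_bounded_measurable: "linear_subspace (bounded_measurable M)"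
  unfolding linear_subspace_def
proof (intro conjI ballI allI)
  show "bounded_measurable M \<noteq> {}" using bounded_measurableI[of "\<lambda>x. 0" M 0] by auto
  fix f g :: "'a \<Rightarrow> real" and a b :: real
  assume f: "f \<in> bounded_measurable M" and g: "g \<in> bounded_measurable M"
  obtain m1 where m1: "\<forall>x. \<bar>f x\<bar> \<le> m1" using bounded_measurableD(2)[OF f] by auto
  obtain m2 where m2: "\<forall>x. \<bar>g x\<bar> \<le> m2" using bounded_measurableD(2)[OF g] by auto
  show "(\<lambda>x. a * f x + b * g x) \<in> bounded_measurable M"
  proof (rule bounded_measurableI)
    show "(\<lambda>x. a * f x + b * g x) \<in> borel_measurable M"
      using bounded_measurableD(1)[OF f] bounded_measurableD(1)[OF g] by measurable
    fix x
    have "\<bar>a * f x + b * g x\<bar> \<le> \<bar>a\<bar> * \<bar>f x\<bar> + \<bar>b\<bar> * \<bar>g x\<bar>"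
      by (metis abs_mult abs_triangle_ineq)
    also have "\<dots> \<le> \<bar>a\<bar> * m1 + \<bar>b\<bar> * m2" using m1 m2 by (intro add_mono mult_left_mono) auto
    finally show "\<bar>a * f x + b * g x\<bar> \<le> \<bar>a\<bar> * m1 + \<bar>b\<bar> * m2" .
  qed
qed

lemma bounded_measurable_mult:
  assumes f: "f \<in> bounded_measurable M" and g: "g \<in> bounded_measurable M"
  shows "(\<lambda>x. f x * g x) \<in> bounded_measurable M"
proof -
  obtain m1 where m1: "m1 \<ge> 0" "\<forall>x. \<bar>f x\<bar> \<le> m1" using bounded_measurableD(2)[OF f] by auto
  obtain m2 where m2: "\<forall>x. \<bar>g x\<bar> \<le> m2" using bounded_measurableD(2)[OF g] by auto
  show ?thesis
  proof (rule bounded_measurableI)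
    show "(\<lambda>x. f x * g x) \<in> borel_measurable M"
      using bounded_measurableD(1)[OF f] bounded_measurableD(1)[OF g] by measurable
    show "\<bar>f x * g x\<bar> \<le> m1 * m2" for x
      unfolding abs_mult using m1 m2 by (intro mult_mono) auto
  qed
qed

lemma weight_ball_bounded: "z \<in> weight_ball M c e \<Longrightarrow> z \<in> bounded_measurable M"
  unfolding weight_ball_def by (auto intro!: bounded_measurableI[where m=c])

context finite_measure
begin

lemma integrable_bounded_measurable: "f \<in> bounded_measurable M \<Longrightarrow> integrable M f"
  using bounded_measurableD[of f M] by (metis integrable_const_bound AE_I2 real_norm_def)

lemma integrable_weight_mult:
  "z \<in> weight_ball M c e \<Longrightarrow> f \<in> bounded_measurable M \<Longrightarrow> integrable M (\<lambda>x. z x * f x)"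
  by (rule integrable_bounded_measurable[OF bounded_measurable_mult[OF weight_ball_bounded]])

text \<open>Averaging over \<open>A\<close>, scaled to mass e: this weight detects a function that
  exceeds 1/e on \<open>A\<close>.\<close>

lemma weight_ball_scaled_indicator:
  assumes A: "A \<in> sets M" "measure M A > 0" and e: "0 \<le> e" and c: "e / measure M A \<le> c"
  shows "(\<lambda>x. e / measure M A * indicator A x) \<in> weight_ball M c e"
proof -
  have "(\<integral>x. e / measure M A * indicator A x \<partial>M) = e" using A by simp
  moreover have "0 \<le> e / measure M A" using A e by simp
  hence "0 \<le> e / measure M A * indicator A x \<and> e / measure M A * indicator A x \<le> c" for x
    using c by (auto simp: indicator_def)
  moreover have "(\<lambda>x. e / measure M A * indicator A x) \<in> borel_measurable M" using A by measurable
  ultimately show ?thesis unfolding weight_ball_def by simp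
qed

text \<open>Restricting weights to events lets a test of the positive part of a function be
  rewritten as a test of the function itself.\<close>

lemma weight_ball_indicator:
  assumes z: "z \<in> weight_ball M c e" and A: "A \<in> sets M"
  shows "(\<lambda>x. z x * indicator A x) \<in> weight_ball M c e"
proof -
  have [measurable]: "z \<in> borel_measurable M" using z by (simp add: weight_ball_def)
  have "(\<integral>x. z x * indicator A x \<partial>M) \<le> (\<integral>x. z x \<partial>M)"
  proof (rule integral_mono)
    show "integrable M z" by (rule integrable_bounded_measurable[OF weight_ball_bounded[OF z]])
    thus "integrable M (\<lambda>x. z x * indicator A x)"
      using integrable_real_mult_indicator[OF A] by simp
    show "z x * indicator A x \<le> z x" for x
      using z by (auto simp: indicator_def weight_ball_def)
  qed
  thus ?thesis using z A by (auto simp: weight_ball_def indicator_def)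
qed

text \<open>The inductive step of the Krein--Smulian argument. If no admissible level \<open>d\<close> existed, the
  offending elements of \<open>C\<close> would form a decreasing sequence of bounded convex sets, and a limit point
  would violate the previous stage.\<close>

lemma krein_smulian_step:
  assumes CV: "C \<subseteq> bounded_measurable M"
    and conv: "\<And>f g u. f \<in> C \<Longrightarrow> g \<in> C \<Longrightarrow> 0 \<le> u \<Longrightarrow> u \<le> 1 \<Longrightarrow> (\<lambda>x. u * f x + (1 - u) * g x) \<in> C"
    and up: "\<And>f g. f \<in> C \<Longrightarrow> g \<in> bounded_measurable M \<Longrightarrow> AE x in M. f x \<le> g x \<Longrightarrow> g \<in> C"
    and fatou: "\<And>h f m. (\<And>n. h n \<in> C) \<Longrightarrow> (\<And>n x. \<bar>h n x\<bar> \<le> m) \<Longrightarrow> f \<in> bounded_measurable M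
        \<Longrightarrow> AE x in M. (\<lambda>n. h n x) \<longlonglongrightarrow> f x \<Longrightarrow> f \<in> C"
    and B: "B \<subseteq> bounded_measurable M"
    and solid: "\<And>z A. z \<in> B \<Longrightarrow> A \<in> sets M \<Longrightarrow> (\<lambda>x. z x * indicator A x) \<in> B"
    and R: "0 < R" "R \<le> R'"
    and stage: "\<And>f. f \<in> C \<Longrightarrow> AE x in M. f x \<le> R \<Longrightarrow> \<exists>z\<in>B. (\<integral>x. z x * f x \<partial>M) > 1"
  shows "\<exists>d. \<forall>f\<in>C. (AE x in M. f x \<le> R') \<longrightarrow> (\<exists>z\<in>B \<union> weight_ball M d (1/R). (\<integral>x. z x * f x \<partial>M) > 1)"
proof (rule ccontr)
  assume neg: "\<not> ?thesis"
  \<comment> \<open>The elements of \<open>C\<close> bounded by \<open>R'\<close> that no weight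
    with cap n detects. Larger caps detect more, so these sets decrease.\<close>
  define S where "S n = {f \<in> C. (\<forall>x. \<bar>f x\<bar> \<le> R') \<and>
      (\<forall>z\<in>B \<union> weight_ball M (real n) (1/R). (\<integral>x. z x * f x \<partial>M) \<le> 1)}" for n
  have WB: "z \<in> bounded_measurable M" if "z \<in> B \<union> weight_ball M d e" for z d e
    using that B weight_ball_bounded by auto
  have R': "R' > 0" using R by simp
  have "\<exists>h. (\<forall>n. h n \<in> S n) \<and> (AE x in M. convergent (\<lambda>n. h n x))"
  proof (rule decreasing_convex_AE_convergent[where m=R'])
    show "h \<in> borel_measurable M" if "h \<in> S n" for n h
      using that CV bounded_measurableD(1) by (auto simp: S_def)
    show "\<bar>h x\<bar> \<le> R'" if "h \<in> S n" for n h x using that by (auto simp: S_def)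
    show "S (Suc n) \<subseteq> S n" for n
    proof -
      have "weight_ball M (real n) (1/R) \<subseteq> weight_ball M (real (Suc n)) (1/R)"
        unfolding weight_ball_def by (auto intro: order_trans)
      thus ?thesis unfolding S_def by blast
    qed
    show "(\<lambda>x. (h x + g x) / 2) \<in> S n" if h: "h \<in> S n" and g: "g \<in> S n" for n h g
    proof -
      have hg: "h \<in> C" "g \<in> C" using h g by (auto simp: S_def)
      have "(\<lambda>x. (1/2) * h x + (1 - 1/2) * g x) \<in> C" using conv[OF hg, of "1/2"] by simp
      hence "(\<lambda>x. (h x + g x) / 2) \<in> C" by (simp add: add_divide_distrib)
      moreover have "\<bar>(h x + g x) / 2\<bar> \<le> R'" for x
      proof -
        have "\<bar>h x\<bar> \<le> R'" "\<bar>g x\<bar> \<le> R'" using h g by (auto simp: S_def)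
        thus ?thesis by (simp add: abs_le_iff)
      qed
      moreover have "(\<integral>x. z x * ((h x + g x) / 2) \<partial>M) \<le> 1" if z: "z \<in> B \<union> weight_ball M (real n) (1/R)" for z
      proof -
        have 1: "integrable M (\<lambda>x. z x * h x)" "integrable M (\<lambda>x. z x * g x)"
          using hg CV WB[OF z] by (auto intro!: integrable_bounded_measurable bounded_measurable_mult)
        have "(\<integral>x. z x * ((h x + g x) / 2) \<partial>M) = (\<integral>x. (z x * h x + z x * g x) / 2 \<partial>M)"
          by (simp add: algebra_simps)
        also have "\<dots> = ((\<integral>x. z x * h x \<partial>M) + (\<integral>x. z x * g x \<partial>M)) / 2" using 1 by simp
        also have "\<dots> \<le> 1" using h g z unfolding S_def by force
        finally show ?thesis .
      qed
      ultimately show ?thesis unfolding S_def by auto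
    qed
    show "S n \<noteq> {}" for n
    proof -
      obtain f where f: "f \<in> C" "AE x in M. f x \<le> R'"
        and fz: "\<And>z. z \<in> B \<union> weight_ball M (real n) (1/R) \<Longrightarrow> (\<integral>x. z x * f x \<partial>M) \<le> 1"
        using neg by (meson not_le)
      have fm[measurable]: "f \<in> borel_measurable M" using f CV bounded_measurableD(1) by auto
      \<comment> \<open>An undetected f is clipped to [0, R']. Upward closure keeps the result in
        \<open>C\<close>, and testing it with z amounts to testing f with z restricted to the event
        that f is nonnegative.\<close>
      define h where "h x = max 0 (min (f x) R')" for x
      have hb: "\<bar>h x\<bar> \<le> R'" for x using R' by (auto simp: h_def)
      have hV: "h \<in> bounded_measurable M"
        by (rule bounded_measurableI[OF _ hb]) (unfold h_def, measurable)
      have "AE x in M. f x \<le> h x" using f(2) by eventually_elim (auto simp: h_def)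
      hence "h \<in> C" using up[OF f(1) hV] by blast
      moreover have "(\<integral>x. z x * h x \<partial>M) \<le> 1" if z: "z \<in> B \<union> weight_ball M (real n) (1/R)" for z
      proof -
        define A where "A = {x \<in> space M. 0 \<le> f x}"
        have A: "A \<in> sets M" unfolding A_def by measurable
        have "(\<lambda>x. z x * indicator A x) \<in> B \<union> weight_ball M (real n) (1/R)"
          using z solid[OF _ A] weight_ball_indicator[OF _ A] by auto
        note le1 = fz[OF this]
        have "(\<integral>x. z x * h x \<partial>M) = (\<integral>x. z x * indicator A x * f x \<partial>M)"
        proof (rule integral_cong_AE)
          show "(\<lambda>x. z x * h x) \<in> borel_measurable M" "(\<lambda>x. z x * indicator A x * f x) \<in> borel_measurable M"
            using bounded_measurableD(1)[OF WB[OF z]] bounded_measurableD(1)[OF hV] A by measurable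
          show "AE x in M. z x * h x = z x * indicator A x * f x"
            using f(2) AE_space by eventually_elim (auto simp: h_def A_def indicator_def)
        qed
        thus ?thesis using le1 by simp
      qed
      ultimately have "h \<in> S n" using hb by (auto simp: S_def)
      thus ?thesis by auto
    qed
  qed
  then obtain h where hS: "\<And>n. h n \<in> S n" and hconv: "AE x in M. convergent (\<lambda>n. h n x)" by blast
  have hC: "h n \<in> C" and hb: "\<bar>h n x\<bar> \<le> R'" for n x using hS[of n] by (auto simp: S_def)
  have hm[measurable]: "h n \<in> borel_measurable M" for n using hC CV bounded_measurableD(1) by auto
  \<comment> \<open>Clipping makes the limit bounded at every point, including those where the
    sequence diverges.\<close>
  define f where "f x = max (- R') (min R' (lim (\<lambda>n. h n x)))" for x
  have fm[measurable]: "f \<in> borel_measurable M" unfolding f_def by measurable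
  have fb: "\<bar>f x\<bar> \<le> R'" for x using R' by (auto simp: f_def)
  have fV: "f \<in> bounded_measurable M" by (rule bounded_measurableI[OF fm fb])
  have hf: "AE x in M. (\<lambda>n. h n x) \<longlonglongrightarrow> f x" using hconv
  proof eventually_elim
    case (elim x)
    hence l: "(\<lambda>n. h n x) \<longlonglongrightarrow> lim (\<lambda>n. h n x)" by (simp add: convergent_LIMSEQ_iff)
    have "lim (\<lambda>n. h n x) \<le> R'"
      by (rule LIMSEQ_le_const2[OF l]) (use hb in \<open>auto simp: abs_le_iff\<close>)
    moreover have "- R' \<le> lim (\<lambda>n. h n x)"
      by (rule LIMSEQ_le_const[OF l]) (use hb[of _ x] in \<open>simp add: abs_le_iff minus_le_iff\<close>)
    ultimately show ?case using l by (simp add: f_def)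
  qed
  have fC: "f \<in> C" by (rule fatou[OF hC hb fV hf])
  \<comment> \<open>A weight admissible for all large n gives every late h n a test value of at most
    1, and dominated convergence carries this over to f.\<close>
  have flim: "(\<integral>x. z x * f x \<partial>M) \<le> 1"
    if z: "\<And>n. n \<ge> n0 \<Longrightarrow> z \<in> B \<union> weight_ball M (real n) (1/R)" for z n0
  proof -
    have zV: "z \<in> bounded_measurable M" using WB[OF z[OF order_refl]] .
    obtain mz where mz: "\<And>x. \<bar>z x\<bar> \<le> mz" using bounded_measurableD(2)[OF zV] by auto
    have [measurable]: "z \<in> borel_measurable M" by (rule bounded_measurableD(1)[OF zV])
    have "(\<lambda>n. \<integral>x. z x * h n x \<partial>M) \<longlonglongrightarrow> (\<integral>x. z x * f x \<partial>M)"
    proof (rule integral_dominated_convergence[where w="\<lambda>x. mz * R'"])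
      show "AE x in M. (\<lambda>n. z x * h n x) \<longlonglongrightarrow> z x * f x"
        using hf by eventually_elim (intro tendsto_intros)
      show "AE x in M. norm (z x * h n x) \<le> mz * R'" for n
        using mz hb R' by (auto intro!: AE_I2 mult_mono simp: abs_mult intro: order_trans[OF abs_ge_zero])
    qed auto
    moreover have "\<exists>N. \<forall>n\<ge>N. (\<integral>x. z x * h n x \<partial>M) \<le> 1"
      using hS z unfolding S_def by blast
    ultimately show ?thesis by (rule LIMSEQ_le_const2)
  qed
  \<comment> \<open>If f exceeded R on an event of positive measure, averaging over that event with
    mass 1/R would give more than 1. The cap this weight requires is finite, so it is admissible
    from some n on.\<close>
  have "AE x in M. f x \<le> R"
  proof -
    define A where "A = {x \<in> space M. R < f x}"
    have A: "A \<in> sets M" unfolding A_def by measurable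
    have "measure M A = 0"
    proof (rule ccontr)
      assume "measure M A \<noteq> 0"
      hence pos: "measure M A > 0" by (simp add: less_le)
      define n0 where "n0 = nat \<lceil>1/R / measure M A\<rceil>"
      have n0: "1/R / measure M A \<le> real n0" unfolding n0_def by linarith
      have le1: "(\<integral>x. (1/R / measure M A * indicator A x) * f x \<partial>M) \<le> 1"
      proof (rule flim[of n0])
        fix n assume "n0 \<le> n"
        hence "1/R / measure M A \<le> real n" using n0 by linarith
        thus "(\<lambda>x. 1/R / measure M A * indicator A x) \<in> B \<union> weight_ball M (real n) (1/R)"
          using weight_ball_scaled_indicator[OF A pos, of "1/R" "real n"] R by simp
      qed
      \<comment> \<open>The excess of f over R on \<open>A\<close>. The constant R alone already
        contributes exactly 1 to the test, so the integral of the excess cannot be positive.\<close>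
      define g where "g x = indicator A x * (f x - R)" for x
      have gV: "g \<in> bounded_measurable M"
      proof (rule bounded_measurableI)
        show "g \<in> borel_measurable M" unfolding g_def using A by measurable
        show "\<bar>g x\<bar> \<le> R' + R" for x
          using fb[of x] R by (cases "x \<in> A") (auto simp: g_def abs_le_iff)
      qed
      have gi: "integrable M g" by (rule integrable_bounded_measurable[OF gV])
      have "(1/R / measure M A * indicator A x) * f x
          = 1/R / measure M A * g x + 1 / measure M A * indicator A x" for x
        using R pos by (simp add: g_def indicator_def field_simps)
      hence "(\<integral>x. (1/R / measure M A * indicator A x) * f x \<partial>M)
          = 1/R / measure M A * (\<integral>x. g x \<partial>M) + 1 / measure M A * measure M A"
        using gi A by (simp add: less_top[symmetric])
      hence "1/R / measure M A * (\<integral>x. g x \<partial>M) \<le> 0" using le1 pos by simp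
      hence "(\<integral>x. g x \<partial>M) \<le> 0" using pos R by (simp add: mult_le_0_iff divide_le_0_iff)
      moreover have g0: "0 \<le> g x" for x by (auto simp: g_def indicator_def A_def)
      hence "0 \<le> (\<integral>x. g x \<partial>M)" by simp
      ultimately have "(\<integral>x. g x \<partial>M) = 0" by simp
      hence "AE x in M. g x = 0" using integral_nonneg_eq_0_iff_AE[OF gi] g0 by simp
      hence "AE x in M. x \<notin> A" by eventually_elim (auto simp: g_def A_def indicator_def)
      hence "measure M A = 0" using AE_iff_null_sets[OF A] measure_eq_0_null_sets by blast
      thus False using pos by simp
    qed
    hence "A \<in> null_sets M" using A by (simp add: null_sets_def emeasure_eq_measure)
    hence "AE x in M. x \<notin> A" by (rule AE_not_in)
    thus ?thesis using AE_space by eventually_elim (auto simp: A_def)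
  qed
  \<comment> \<open>Being in \<open>C\<close> and below R, f is detected by a weight from
    \<open>B\<close>, contrary to the bound inherited by the limit.\<close>
  then obtain z where "z \<in> B" "(\<integral>x. z x * f x \<partial>M) > 1" using stage[OF fC] by blast
  thus False using flim[of 0 z] by simp
qed

text \<open>The stages have thresholds \<open>R k\<close> growing to infinity, and every element of
  \<open>C\<close> is bounded, so some stage detects it. The weights added at stage k have mass 1 /
  R k, which is why the masses tend to 0.\<close>

lemma krein_smulian_weights:
  assumes CV: "C \<subseteq> bounded_measurable M"
    and conv: "\<And>f g u. f \<in> C \<Longrightarrow> g \<in> C \<Longrightarrow> 0 \<le> u \<Longrightarrow> u \<le> 1 \<Longrightarrow> (\<lambda>x. u * f x + (1 - u) * g x) \<in> C"
    and up: "\<And>f g. f \<in> C \<Longrightarrow> g \<in> bounded_measurable M \<Longrightarrow> AE x in M. f x \<le> g x \<Longrightarrow> g \<in> C"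
    and fatou: "\<And>h f m. (\<And>n. h n \<in> C) \<Longrightarrow> (\<And>n x. \<bar>h n x\<bar> \<le> m) \<Longrightarrow> f \<in> bounded_measurable M
        \<Longrightarrow> AE x in M. (\<lambda>n. h n x) \<longlonglongrightarrow> f x \<Longrightarrow> f \<in> C"
    and zero: "(\<lambda>x. 0) \<notin> C"
  shows "\<exists>c e. e \<longlonglongrightarrow> 0 \<and> decseq e \<and> (\<forall>f\<in>C. \<exists>j. \<exists>z\<in>weight_ball M (c j) (e j). (\<integral>x. z x * f x \<partial>M) > 1)"
proof -
  \<comment> \<open>If all constants 1 / (n + 1) were in \<open>C\<close>, closure under bounded
    limits would put 0 into \<open>C\<close>.\<close>
  have "\<exists>r>0. (\<lambda>x. r) \<notin> C"
  proof (rule ccontr)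
    assume "\<not> ?thesis"
    hence "\<And>n. (\<lambda>x. 1 / real (Suc n)) \<in> C" by simp
    moreover have "\<bar>1 / real (Suc n)\<bar> \<le> 1" for n by simp
    moreover have "(\<lambda>x. 0) \<in> bounded_measurable M" by (rule bounded_measurableI[of _ _ 0]) auto
    moreover have "AE x in M. (\<lambda>n. 1 / real (Suc n)) \<longlonglongrightarrow> 0"
      using LIMSEQ_inverse_real_of_nat by (simp add: inverse_eq_divide)
    ultimately have "(\<lambda>x. 0) \<in> C" by (rule fatou)
    thus False using zero by simp
  qed
  then obtain r where r: "r > 0" "(\<lambda>x. r) \<notin> C" by blast
  \<comment> \<open>With R 0 = r the induction can start without any weight: an element of
    \<open>C\<close> below r would put the constant r into \<open>C\<close>.\<close>
  define R where "R k = r * real (Suc k)" for k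
  define e where "e k = 1 / R k" for k
  have Rpos: "0 < R k" for k using r by (simp add: R_def)
  define B where "B c k = (\<Union>j<k. weight_ball M (c j) (e j))" for c :: "nat \<Rightarrow> real" and k
  define P where "P k c \<longleftrightarrow> (\<forall>f\<in>C. (AE x in M. f x \<le> R k) \<longrightarrow> (\<exists>z\<in>B c k. (\<integral>x. z x * f x \<partial>M) > 1))" for k c
  \<comment> \<open>Stage n fixes the first n caps and the next stage leaves them unchanged, so the
    diagonal of the choices is a single sequence of caps.\<close>
  have "\<exists>F. \<forall>n. P n (F n) \<and> (\<forall>j<n. F (Suc n) j = F n j)"
  proof (rule dependent_nat_choice)
    have "False" if "f \<in> C" "AE x in M. f x \<le> R 0" for f
    proof -
      have "(\<lambda>x. r) \<in> C" using that(2)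
        by (intro up[OF that(1)] bounded_measurableI[of _ _ "\<bar>r\<bar>"]) (auto simp: R_def)
      thus False using r by simp
    qed
    thus "\<exists>c. P 0 c" unfolding P_def by blast
  next
    fix c n assume Pn: "P n c"
    have "\<exists>d. \<forall>f\<in>C. (AE x in M. f x \<le> R (Suc n)) \<longrightarrow>
        (\<exists>z\<in>B c n \<union> weight_ball M d (1 / R n). (\<integral>x. z x * f x \<partial>M) > 1)"
    proof (rule krein_smulian_step[OF CV conv up fatou])
      show "B c n \<subseteq> bounded_measurable M" using weight_ball_bounded by (auto simp: B_def)
      show "(\<lambda>x. z x * indicator A x) \<in> B c n" if z: "z \<in> B c n" and A: "A \<in> sets M" for z A
      proof -
        from z obtain j where j: "j < n" and zj: "z \<in> weight_ball M (c j) (e j)" by (auto simp: B_def)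
        thus ?thesis using weight_ball_indicator[OF zj A] by (auto simp: B_def)
      qed
      show "0 < R n" "R n \<le> R (Suc n)" using Rpos r by (auto simp: R_def)
      show "\<exists>z\<in>B c n. (\<integral>x. z x * f x \<partial>M) > 1" if "f \<in> C" "AE x in M. f x \<le> R n" for f
        using Pn that unfolding P_def by blast
    qed
    then obtain d where d: "\<forall>f\<in>C. (AE x in M. f x \<le> R (Suc n)) \<longrightarrow>
        (\<exists>z\<in>B c n \<union> weight_ball M d (1 / R n). (\<integral>x. z x * f x \<partial>M) > 1)" by blast
    have "B (c(n := d)) (Suc n) = B c n \<union> weight_ball M d (1 / R n)"
      unfolding B_def e_def lessThan_Suc by fastforce
    hence "P (Suc n) (c(n := d))" using d by (simp add: P_def)
    thus "\<exists>c'. P (Suc n) c' \<and> (\<forall>j<n. c' j = c j)" by (intro exI[of _ "c(n := d)"]) auto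
  qed
  then obtain F where F: "\<And>n. P n (F n)" "\<And>n j. j < n \<Longrightarrow> F (Suc n) j = F n j" by blast
  define c where "c j = F (Suc j) j" for j
  have Fc: "F k j = c j" if "j < k" for k j
    using that F(2) by (induction k) (auto simp: c_def less_Suc_eq)
  have main: "\<exists>j. \<exists>z\<in>weight_ball M (c j) (e j). (\<integral>x. z x * f x \<partial>M) > 1" if f: "f \<in> C" for f
  proof -
    obtain m where m: "\<forall>x. \<bar>f x\<bar> \<le> m" using bounded_measurableD(2) CV f by blast
    obtain k where "m / r \<le> real k" using real_arch_simple by blast
    hence "m \<le> R k" using r by (simp add: R_def field_simps)
    hence "AE x in M. f x \<le> R k" using m by (auto simp: abs_le_iff intro: order_trans)
    then obtain z where "z \<in> B (F k) k" "(\<integral>x. z x * f x \<partial>M) > 1" using F(1)[of k] f unfolding P_def by blast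
    thus ?thesis using Fc by (auto simp: B_def)
  qed
  have "(\<lambda>k. 1 / r * (1 / real (Suc k))) \<longlonglongrightarrow> 1 / r * 0"
    by (intro tendsto_intros LIMSEQ_inverse_real_of_nat[unfolded inverse_eq_divide])
  hence "e \<longlonglongrightarrow> 0" by (simp add: e_def[abs_def] R_def)
  moreover have "decseq e" using r by (intro decseq_SucI) (auto simp: e_def R_def intro!: divide_left_mono)
  ultimately show ?thesis using main by blast
qed

section \<open>From countably additive functionals to integrable densities\<close>

text \<open>Continuity along events decreasing to the empty set makes l a measure on indicators, and
  positivity for almost everywhere nonnegative functions makes that measure absolutely continuous;
  Radon--Nikodym gives the density. Uniform approximation by step functions extends the formula from
  indicators to bounded functions.\<close>

lemma l1_representation:
  fixes l :: "('a \<Rightarrow> real) \<Rightarrow> real"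
  assumes lin: "\<And>f g a b. f \<in> bounded_measurable M \<Longrightarrow> g \<in> bounded_measurable M
      \<Longrightarrow> l (\<lambda>x. a * f x + b * g x) = a * l f + b * l g"
    and pos: "\<And>f. f \<in> bounded_measurable M \<Longrightarrow> AE x in M. 0 \<le> f x \<Longrightarrow> 0 \<le> l f"
    and cont: "\<And>A. (\<And>n. A n \<in> sets M) \<Longrightarrow> decseq A \<Longrightarrow> (\<Inter>n. A n) = {} \<Longrightarrow> (\<lambda>n. l (indicator (A n))) \<longlonglongrightarrow> 0"
  shows "\<exists>Z. Z \<in> borel_measurable M \<and> (\<forall>x. 0 \<le> Z x) \<and> integrable M Z
      \<and> (\<forall>f\<in>bounded_measurable M. l f = (\<integral>x. Z x * f x \<partial>M))"
proof -
  let ?V = "bounded_measurable M"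
  note V = linear_subspace_bounded_measurable[of M]
  have ind: "indicator A \<in> ?V" if "A \<in> sets M" for A
    by (rule bounded_measurableI[where m=1]) (use that in \<open>auto simp: indicator_def\<close>)
  have l0: "l (\<lambda>x. 0) = 0" using lin[OF linear_subspaceD(6)[OF V] linear_subspaceD(6)[OF V], of 0 0] by simp
  have ladd: "l (\<lambda>x. f x + g x) = l f + l g" if "f \<in> ?V" "g \<in> ?V" for f g using lin[OF that, of 1 1] by simp
  have lscale: "l (\<lambda>x. c * f x) = c * l f" if "f \<in> ?V" for f c using lin[OF that that, of c 0] by simp
  have ldiff: "l (\<lambda>x. f x - g x) = l f - l g" if "f \<in> ?V" "g \<in> ?V" for f g using lin[OF that, of 1 "-1"] by simp
  have lmono: "l f \<le> l g" if "f \<in> ?V" "g \<in> ?V" "AE x in M. f x \<le> g x" for f g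
  proof -
    have "(\<lambda>x. g x - f x) \<in> ?V" using linear_subspaceD(5)[OF V that(2,1), of 1 "-1"] by simp
    hence "0 \<le> l (\<lambda>x. g x - f x)" using that(3) by (intro pos) auto
    thus ?thesis using ldiff[OF that(2,1)] by simp
  qed
  have lcong: "l f = l g" if "f \<in> ?V" "g \<in> ?V" "AE x in M. f x = g x" for f g
  proof (rule antisym)
    show "l f \<le> l g" using that(3) by (intro lmono that(1,2)) (auto elim: eventually_mono)
    show "l g \<le> l f" using that(3) by (intro lmono that(1,2)) (auto elim: eventually_mono)
  qed
  define \<mu> where "\<mu> A = ennreal (l (indicator A))" for A :: "'a set"
  define N where "N = measure_of (space M) (sets M) \<mu>"
  have lsum: "l (indicator (\<Union>i\<in>I. A i)) = (\<Sum>i\<in>I. l (indicator (A i)))"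
    if "finite I" "disjoint_family_on A I" "A ` I \<subseteq> sets M" for I :: "nat set" and A
    using that
  proof (induction I)
    case empty
    have "l (indicator {}) = l (\<lambda>x. 0)" by (rule arg_cong[of _ _ l]) (auto simp: indicator_def)
    thus ?case using l0 by simp
  next
    case (insert i I)
    have "A i \<inter> A j = {}" if "j \<in> I" for j
      using insert.prems(1) insert.hyps(2) that disjoint_family_onD[of A "insert i I" i j] by auto
    hence d: "A i \<inter> (\<Union>j\<in>I. A j) = {}" by auto
    have eq: "indicator (\<Union>j\<in>insert i I. A j) = (\<lambda>x. indicator (A i) x + indicator (\<Union>j\<in>I. A j) x :: real)"
      using d by (auto simp: indicator_def fun_eq_iff)
    have "A i \<in> sets M" "(\<Union>j\<in>I. A j) \<in> sets M" using insert.hyps insert.prems by auto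
    hence "l (indicator (\<Union>j\<in>insert i I. A j)) = l (indicator (A i)) + l (indicator (\<Union>j\<in>I. A j))"
      unfolding eq by (intro ladd ind)
    moreover have "l (indicator (\<Union>j\<in>I. A j)) = (\<Sum>j\<in>I. l (indicator (A j)))"
      using insert.prems by (intro insert.IH disjoint_family_on_mono[of I "insert i I" A]) auto
    ultimately show ?case using insert.hyps by simp
  qed
  have meas: "measure_space (space M) (sets M) \<mu>"
  proof (subst measure_space_def, intro conjI)
    show "sigma_algebra (space M) (sets M)" by (rule sets.sigma_algebra_axioms)
    show "positive (sets M) \<mu>"
    proof -
      have "l (indicator {}) = l (\<lambda>x. 0)" by (rule arg_cong[of _ _ l]) (auto simp: indicator_def)
      thus ?thesis using l0 by (simp add: positive_def \<mu>_def)
    qed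
    show "countably_additive (sets M) \<mu>"
    proof (rule countably_additiveI)
      fix A :: "nat \<Rightarrow> 'a set" assume A: "range A \<subseteq> sets M" "disjoint_family A" "(\<Union>i. A i) \<in> sets M"
      \<comment> \<open>The tails of the union decrease to the empty set; this turns finite into
        countable additivity.\<close>
      define D where "D n = (\<Union>i. A i) - (\<Union>i<n. A i)" for n
      have Ds: "D n \<in> sets M" for n using A unfolding D_def by auto
      have l1: "l (indicator (D n)) = l (indicator (\<Union>i. A i)) - (\<Sum>i<n. l (indicator (A i)))" for n
      proof -
        have eq: "indicator (D n) = (\<lambda>x. indicator (\<Union>i. A i) x - indicator (\<Union>i<n. A i) x :: real)"
          by (auto simp: D_def indicator_def fun_eq_iff)
        have "(\<Union>i<n. A i) \<in> sets M" using A by auto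
        hence "l (indicator (D n)) = l (indicator (\<Union>i. A i)) - l (indicator (\<Union>i<n. A i))"
          unfolding eq using A(3) by (intro ldiff ind)
        moreover have "l (indicator (\<Union>i<n. A i)) = (\<Sum>i<n. l (indicator (A i)))"
          using A by (intro lsum) (auto simp: disjoint_family_on_def)
        ultimately show ?thesis by simp
      qed
      have "(\<lambda>n. l (indicator (D n))) \<longlonglongrightarrow> 0"
      proof (rule cont)
        show "decseq D" unfolding D_def by (force intro!: decseq_SucI)
        show "(\<Inter>n. D n) = {}" unfolding D_def by auto
      qed (rule Ds)
      hence "(\<lambda>n. l (indicator (\<Union>i. A i)) - l (indicator (D n))) \<longlonglongrightarrow> l (indicator (\<Union>i. A i)) - 0"
        by (intro tendsto_intros)
      hence sums: "(\<lambda>i. l (indicator (A i))) sums l (indicator (\<Union>i. A i))"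
        unfolding sums_def by (simp add: l1)
      have nn: "0 \<le> l (indicator (A i))" for i using A by (intro pos ind) auto
      show "(\<Sum>i. \<mu> (A i)) = \<mu> (\<Union>i. A i)"
        unfolding \<mu>_def using sums nn by (simp add: suminf_ennreal2 sums_unique[symmetric] sums_summable)
    qed
  qed
  have sN: "sets N = sets M" "space N = space M" by (auto simp: N_def sets.space_closed)
  have eN: "emeasure N A = ennreal (l (indicator A))" if "A \<in> sets M" for A
    unfolding N_def using meas that
    by (subst emeasure_measure_of_sigma) (auto simp: \<mu>_def measure_space_def)
  have "finite_measure N" by (rule finite_measureI) (simp add: eN sN)
  interpret N: finite_measure N by fact
  have ac: "absolutely_continuous M N"
    unfolding absolutely_continuous_def
  proof
    fix A assume A: "A \<in> null_sets M"
    hence As: "A \<in> sets M" by auto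
    have "l (indicator A) = l (\<lambda>x. 0)"
      using AE_not_in[OF A] by (intro lcong ind As linear_subspaceD(6)[OF V]) (auto elim: eventually_mono)
    thus "A \<in> null_sets N" using As l0 by (auto simp: null_sets_def eN sN)
  qed
  obtain D where D: "D \<in> borel_measurable M" "AE x in M. RN_deriv M N x = ennreal (D x)"
     "AE x in N. 0 < D x" "\<And>x. 0 \<le> D x"
    using real_RN_deriv[OF N.finite_measure_axioms ac sN(1)] by blast
  have dens: "density M (\<lambda>x. ennreal (D x)) = N"
  proof -
    have "density M (RN_deriv M N) = N" by (rule density_RN_deriv[OF ac sN(1)])
    moreover have "density M (RN_deriv M N) = density M (\<lambda>x. ennreal (D x))"
      by (rule density_cong) (use D in auto)
    ultimately show ?thesis by simp
  qed
  have Di: "integrable M D"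
  proof (rule integrableI_nonneg)
    have "(\<integral>\<^sup>+x. ennreal (D x) \<partial>M) = emeasure (density M (\<lambda>x. ennreal (D x))) (space M)"
      using D(1) by (subst emeasure_density) (auto intro!: nn_integral_cong)
    also have "\<dots> < \<infinity>" unfolding dens using N.emeasure_finite[of "space N"] sN by (simp add: less_top[symmetric])
    finally show "(\<integral>\<^sup>+x. ennreal (D x) \<partial>M) < \<infinity>" .
  qed (use D in auto)
  have lN: "l (indicator A) = measure N A" if "A \<in> sets M" for A
    using eN[OF that] pos[OF ind[OF that]] by (simp add: measure_def)
  have rep: "l f = (\<integral>x. f x \<partial>N)" if f: "f \<in> ?V" for f
  proof -
    have "borel_measurable N = borel_measurable M" by (rule measurable_cong_sets[OF sN(1) refl])
    hence VN: "bounded_measurable N = ?V" unfolding bounded_measurable_def by (rule arg_cong)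
    have Nb: "integrable N k" if "k \<in> ?V" for k
      by (rule N.integrable_bounded_measurable) (unfold VN, rule that)
    obtain m where m: "m \<ge> 0" "\<forall>x. \<bar>f x\<bar> \<le> m" using bounded_measurableD(2)[OF f] by blast
    have fm[measurable]: "f \<in> borel_measurable M" by (rule bounded_measurableD(1)[OF f])
    have simple: "l g = (\<integral>x. g x \<partial>N)" if "g = (\<lambda>x. \<Sum>j\<in>J. c j * indicator (A j) x)" "finite J" "A ` J \<subseteq> sets M"
      for g and c :: "int \<Rightarrow> real" and J A
    proof -
      have "l (\<lambda>x. \<Sum>j\<in>J. c j * indicator (A j) x) = (\<Sum>j\<in>J. c j * measure N (A j))
         \<and> (\<lambda>x. \<Sum>j\<in>J. c j * indicator (A j) x) \<in> ?V"
        using that(2,3)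
      proof (induction J)
        case empty
        show ?case using l0 linear_subspaceD(6)[OF V] by simp
      next
        case (insert j J)
        have 1: "(\<lambda>x. c j * indicator (A j) x) \<in> ?V" using insert.prems by (intro linear_subspaceD(2)[OF V] ind) auto
        have 2: "(\<lambda>x. \<Sum>j\<in>J. c j * indicator (A j) x) \<in> ?V" using insert.IH insert.prems by blast
        have Aj: "A j \<in> sets M" using insert.prems by auto
        have eq: "(\<lambda>x. \<Sum>i\<in>insert j J. c i * indicator (A i) x)
            = (\<lambda>x. c j * indicator (A j) x + (\<Sum>i\<in>J. c i * indicator (A i) x))"
          by (rule ext, rule sum.insert[OF insert.hyps(1,2)])
        have "l (\<lambda>x. c j * indicator (A j) x) = c j * measure N (A j)"
          using lscale[OF ind[OF Aj]] lN[OF Aj] by simp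
        moreover have "l (\<lambda>x. \<Sum>i\<in>J. c i * indicator (A i) x) = (\<Sum>i\<in>J. c i * measure N (A i))"
          using insert.IH insert.prems by blast
        ultimately show ?case
          unfolding eq ladd[OF 1 2] sum.insert[OF insert.hyps(1,2)]
          using linear_subspaceD(1)[OF V 1 2] by simp
      qed
      moreover have "(\<integral>x. (\<Sum>j\<in>J. c j * indicator (A j) x) \<partial>N) = (\<Sum>j\<in>J. c j * measure N (A j))"
        using that(3) sN N.emeasure_finite by (subst Bochner_Integration.integral_sum) (auto simp: less_top[symmetric] image_subset_iff)
      ultimately show ?thesis using that(1) by simp
    qed
    have approx: "\<bar>l f - (\<integral>x. f x \<partial>N)\<bar> \<le> 2 * (measure N (space N)) * d" if d: "0 < d" for d
    proof -
      \<comment> \<open>f is rounded down to multiples of d, and \<open>J\<close> contains every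
        level reached because |f| <= m. The rounding error costs at most d times the total mass,
        once for l and once for the integral.\<close>
      define J where "J = {\<lfloor>- m / d\<rfloor>..\<lfloor>m / d\<rfloor>}"
      define A where "A j = {x \<in> space M. \<lfloor>f x / d\<rfloor> = j}" for j
      define g where "g x = (\<Sum>j\<in>J. (d * real_of_int j) * indicator (A j) x)" for x
      have A: "A j \<in> sets M" for j unfolding A_def by measurable
      have gx: "g x = d * real_of_int \<lfloor>f x / d\<rfloor>" if x: "x \<in> space M" for x
      proof -
        have "- m \<le> f x" "f x \<le> m" using m(2)[rule_format, of x] by auto
        hence "- m / d \<le> f x / d" "f x / d \<le> m / d" by (intro divide_right_mono less_imp_le[OF d]; simp)+
        hence j: "\<lfloor>f x / d\<rfloor> \<in> J" unfolding J_def by (auto intro: floor_mono)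
        have "g x = (\<Sum>j\<in>J. if j = \<lfloor>f x / d\<rfloor> then d * real_of_int j else 0)"
          unfolding g_def using x by (intro sum.cong) (auto simp: A_def indicator_def)
        thus ?thesis using j by (simp add: J_def)
      qed
      have gf: "\<bar>f x - g x\<bar> \<le> d" if "x \<in> space M" for x
      proof -
        have "d * real_of_int \<lfloor>f x / d\<rfloor> \<le> d * (f x / d)" using d by (intro mult_left_mono) auto
        moreover have "d * (f x / d) \<le> d * (real_of_int \<lfloor>f x / d\<rfloor> + 1)"
          using d by (intro mult_left_mono) (auto intro: real_of_int_floor_add_one_ge)
        ultimately show ?thesis using gx[OF that] d by (simp add: algebra_simps)
      qed
      have gV: "g \<in> ?V"
      proof (rule bounded_measurableI)
        show "g \<in> borel_measurable M" unfolding g_def using A by measurable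
        show "\<bar>g x\<bar> \<le> (\<Sum>j\<in>J. \<bar>d * real_of_int j\<bar>)" for x
          unfolding g_def by (rule order_trans[OF sum_abs]) (auto intro!: sum_mono simp: indicator_def)
      qed
      have lg: "l g = (\<integral>x. g x \<partial>N)"
      proof (rule simple)
        show "g = (\<lambda>x. \<Sum>j\<in>J. (d * real_of_int j) * indicator (A j) x)" by (rule ext) (rule g_def)
        show "finite J" "A ` J \<subseteq> sets M" using A by (auto simp: J_def)
      qed
      have cV: "(\<lambda>x. c) \<in> ?V" for c :: real by (rule bounded_measurableI[of _ _ "\<bar>c\<bar>"]) auto
      have lc: "l (\<lambda>x. c) = c * measure N (space N)" for c
      proof -
        have "l (\<lambda>x. c) = l (\<lambda>x. c * indicator (space M) x)"
          by (intro lcong cV linear_subspaceD(2)[OF V] ind) auto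
        thus ?thesis using lscale[OF ind[OF sets.top]] lN[OF sets.top] sN by simp
      qed
      have fg: "(\<lambda>x. f x - g x) \<in> ?V" using linear_subspaceD(5)[OF V f gV, of 1 "-1"] by simp
      have "AE x in M. f x - g x \<le> d" "AE x in M. - d \<le> f x - g x"
        using gf by (auto simp: abs_le_iff minus_le_iff intro!: AE_I2) force
      hence "l (\<lambda>x. f x - g x) \<le> d * measure N (space N)" "- d * measure N (space N) \<le> l (\<lambda>x. f x - g x)"
        using lmono[OF fg cV, of d] lmono[OF cV fg, of "- d"] lc by auto
      hence 1: "\<bar>l f - l g\<bar> \<le> d * measure N (space N)" using ldiff[OF f gV] by (simp add: abs_le_iff)
      have "\<bar>(\<integral>x. f x \<partial>N) - (\<integral>x. g x \<partial>N)\<bar> = \<bar>\<integral>x. f x - g x \<partial>N\<bar>" using Nb[OF f] Nb[OF gV] by simp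
      also have "\<dots> \<le> (\<integral>x. \<bar>f x - g x\<bar> \<partial>N)" by (rule integral_abs_bound)
      also have "\<dots> \<le> (\<integral>x. d \<partial>N)" using gf sN Nb[OF fg] by (intro integral_mono) auto
      finally have "\<bar>(\<integral>x. f x \<partial>N) - (\<integral>x. g x \<partial>N)\<bar> \<le> d * measure N (space N)" by (simp add: mult.commute)
      moreover have "\<bar>a - b\<bar> \<le> 2 * K" if "\<bar>b - c\<bar> \<le> K" "\<bar>a - c\<bar> \<le> K" for a b c K :: real
        using that by linarith
      ultimately have "\<bar>l f - (\<integral>x. f x \<partial>N)\<bar> \<le> 2 * (d * measure N (space N))" using 1 unfolding lg by blast
      thus ?thesis by (simp add: mult.commute mult.left_commute)
    qed
    have "\<bar>l f - (\<integral>x. f x \<partial>N)\<bar> \<le> 0 + e" if "0 < e" for e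
    proof -
      \<comment> \<open>The added 1 keeps the divisor positive when \<open>N\<close> has mass
        0.\<close>
      let ?K = "2 * measure N (space N) + 1"
      have "\<bar>l f - (\<integral>x. f x \<partial>N)\<bar> \<le> 2 * (measure N (space N)) * (e / ?K)"
        using approx[of "e / ?K"] that by (simp add: add_nonneg_pos)
      also have "\<dots> = e * (2 * measure N (space N) / ?K)" by simp
      also have "\<dots> \<le> e * 1"
        using that by (intro mult_left_mono divide_le_eq_1_pos[THEN iffD2]) (auto intro: add_nonneg_pos)
      finally show ?thesis by simp
    qed
    thus ?thesis using field_le_epsilon[of "\<bar>l f - (\<integral>x. f x \<partial>N)\<bar>" 0] by fastforce
  qed
  have "l f = (\<integral>x. D x * f x \<partial>M)" if f: "f \<in> ?V" for f
  proof -
    have "(\<integral>x. f x \<partial>N) = (\<integral>x. D x * f x \<partial>M)"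
      unfolding dens[symmetric] using D bounded_measurableD(1)[OF f]
      by (subst integral_real_density) auto
    thus ?thesis using rep[OF f] by simp
  qed
  thus ?thesis using D Di by blast
qed

text \<open>The supremum q of the integrals against the weights is at least 1 on \<open>C\<close>.
  Passing to q' turns this into a lower bound 1 on \<open>C\<close> for every linear functional
  below q', while domination by q forces positivity and continuity along vanishing events.\<close>

theorem l1_strict_separation:
  assumes CV: "C \<subseteq> bounded_measurable M" and ne: "C \<noteq> {}"
    and conv: "\<And>f g u. f \<in> C \<Longrightarrow> g \<in> C \<Longrightarrow> 0 \<le> u \<Longrightarrow> u \<le> 1 \<Longrightarrow> (\<lambda>x. u * f x + (1 - u) * g x) \<in> C"
    and up: "\<And>f g. f \<in> C \<Longrightarrow> g \<in> bounded_measurable M \<Longrightarrow> AE x in M. f x \<le> g x \<Longrightarrow> g \<in> C"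
    and fatou: "\<And>h f m. (\<And>n. h n \<in> C) \<Longrightarrow> (\<And>n x. \<bar>h n x\<bar> \<le> m) \<Longrightarrow> f \<in> bounded_measurable M
        \<Longrightarrow> AE x in M. (\<lambda>n. h n x) \<longlonglongrightarrow> f x \<Longrightarrow> f \<in> C"
    and zero: "(\<lambda>x. 0) \<notin> C"
  shows "\<exists>Z. Z \<in> borel_measurable M \<and> (\<forall>x. 0 \<le> Z x) \<and> integrable M Z
      \<and> (\<forall>f\<in>C. 1 \<le> (\<integral>x. Z x * f x \<partial>M))"
proof -
  let ?V = "bounded_measurable M"
  note V = linear_subspace_bounded_measurable[of M]
  have "\<exists>c e. e \<longlonglongrightarrow> 0 \<and> decseq e \<and> (\<forall>f\<in>C. \<exists>j. \<exists>z\<in>weight_ball M (c j) (e j). (\<integral>x. z x * f x \<partial>M) > 1)"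
    by (rule krein_smulian_weights[OF CV conv up fatou zero])
  then obtain c e where e: "e \<longlonglongrightarrow> 0" "decseq e"
    and KS: "\<And>f. f \<in> C \<Longrightarrow> \<exists>j. \<exists>z\<in>weight_ball M (c j) (e j). (\<integral>x. z x * f x \<partial>M) > 1"
    by blast
  define W where "W = (\<Union>j. weight_ball M (c j) (e j))"
  define q where "q f = (SUP z\<in>W. \<integral>x. z x * f x \<partial>M)" for f
  have Wne: "W \<noteq> {}" using KS ne by (force simp: W_def)
  have zf: "integrable M (\<lambda>x. z x * f x)" if "z \<in> W" "f \<in> ?V" for z f
    using that integrable_weight_mult by (auto simp: W_def)
  have zle: "(\<integral>x. z x * f x \<partial>M) \<le> a * m" if z: "z \<in> weight_ball M b a" and f: "f \<in> ?V" and m: "\<And>x. f x \<le> m" "0 \<le> m" for z f m a b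
  proof -
    have z': "integrable M z" "(\<integral>x. z x \<partial>M) \<le> a" "\<And>x. 0 \<le> z x"
      using integrable_bounded_measurable[OF weight_ball_bounded[OF z]] z by (auto simp: weight_ball_def)
    have "(\<integral>x. z x * f x \<partial>M) \<le> (\<integral>x. z x * m \<partial>M)"
      using z' m by (intro integral_mono integrable_weight_mult[OF z f] mult_left_mono) auto
    also have "\<dots> = (\<integral>x. z x \<partial>M) * m" using z' by simp
    also have "\<dots> \<le> a * m" using z' m by (intro mult_right_mono) auto
    finally show ?thesis .
  qed
  have bdd: "bdd_above ((\<lambda>z. \<integral>x. z x * f x \<partial>M) ` W)" if f: "f \<in> ?V" for f
  proof -
    obtain m where m: "m \<ge> 0" "\<forall>x. \<bar>f x\<bar> \<le> m" using bounded_measurableD(2)[OF f] by blast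
    hence fm: "f x \<le> m" for x using abs_le_D1 by blast
    show ?thesis
    \<comment> \<open>The masses decrease, so e 0 bounds all of them.\<close>
    proof (rule bdd_aboveI2[where M="e 0 * m"])
      fix z assume "z \<in> W"
      then obtain j where "z \<in> weight_ball M (c j) (e j)" by (auto simp: W_def)
      hence "(\<integral>x. z x * f x \<partial>M) \<le> e j * m" by (rule zle[OF _ f fm m(1)])
      also have "\<dots> \<le> e 0 * m" using decseqD[OF e(2), of 0 j] m by (intro mult_right_mono) auto
      finally show "(\<integral>x. z x * f x \<partial>M) \<le> e 0 * m" .
    qed
  qed
  have le_q: "(\<integral>x. z x * f x \<partial>M) \<le> q f" if "z \<in> W" "f \<in> ?V" for z f
    unfolding q_def using that by (intro cSUP_upper bdd)
  have q_le: "q f \<le> b" if "\<And>z. z \<in> W \<Longrightarrow> (\<integral>x. z x * f x \<partial>M) \<le> b" for f b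
    unfolding q_def using that Wne by (intro cSUP_least) auto
  have qsub: "sublinear_on ?V q"
    unfolding sublinear_on_def
  proof (intro conjI ballI allI impI)
    fix f g assume f: "f \<in> ?V" and g: "g \<in> ?V"
    show "q (\<lambda>x. f x + g x) \<le> q f + q g"
    proof (rule q_le)
      fix z assume z: "z \<in> W"
      have "(\<integral>x. z x * (f x + g x) \<partial>M) = (\<integral>x. z x * f x \<partial>M) + (\<integral>x. z x * g x \<partial>M)"
        using zf[OF z f] zf[OF z g] by (simp add: distrib_left)
      thus "(\<integral>x. z x * (f x + g x) \<partial>M) \<le> q f + q g" using le_q[OF z f] le_q[OF z g] by simp
    qed
  next
    fix f a assume f: "f \<in> ?V" and a: "0 \<le> (a::real)"
    show "q (\<lambda>x. a * f x) \<le> a * q f"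
    proof (rule q_le)
      fix z assume z: "z \<in> W"
      have "(\<integral>x. z x * (a * f x) \<partial>M) = a * (\<integral>x. z x * f x \<partial>M)"
        by (simp add: mult.left_commute)
      thus "(\<integral>x. z x * (a * f x) \<partial>M) \<le> a * q f" using le_q[OF z f] a by (simp add: mult_left_mono)
    qed
  qed
  have qC: "1 \<le> q f" if f: "f \<in> C" for f
  proof -
    obtain z where z: "z \<in> W" "(\<integral>x. z x * f x \<partial>M) > 1" using KS[OF f] by (auto simp: W_def)
    have "f \<in> ?V" using f CV by auto
    from le_q[OF z(1) this] z(2) show ?thesis by simp
  qed
  have "\<exists>q'. sublinear_on ?V q' \<and> (\<forall>f\<in>?V. q' f \<le> q f) \<and> (\<forall>f\<in>C. q' (\<lambda>x. - f x) \<le> - 1)"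
    by (rule sublinear_on_support[OF V qsub CV ne conv qC])
  then obtain q' where q': "sublinear_on ?V q'" "\<forall>f\<in>?V. q' f \<le> q f" "\<forall>f\<in>C. q' (\<lambda>x. - f x) \<le> - 1"
    by blast
  obtain l where l: "\<And>f g a b. f \<in> ?V \<Longrightarrow> g \<in> ?V \<Longrightarrow> l (\<lambda>x. a * f x + b * g x) = a * l f + b * l g"
    and lq': "\<And>f. f \<in> ?V \<Longrightarrow> l f \<le> q' f"
    using hahn_banach_function_space[OF V q'(1)] by blast
  have lq: "l f \<le> q f" if "f \<in> ?V" for f using lq'[OF that] q'(2) that by force
  have lneg: "l (\<lambda>x. - f x) = - l f" if "f \<in> ?V" for f using l[OF that that, of "-1" 0] by simp
  have lpos: "0 \<le> l f" if f: "f \<in> ?V" "AE x in M. 0 \<le> f x" for f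
  proof -
    \<comment> \<open>All weights are nonnegative, so q is at most 0 at - f and l inherits
      positivity.\<close>
    have "q (\<lambda>x. - f x) \<le> 0"
    proof (rule q_le)
      fix z assume z: "z \<in> W"
      hence z0: "0 \<le> z x" for x by (auto simp: W_def weight_ball_def)
      have "0 \<le> (\<integral>x. z x * f x \<partial>M)"
        using f(2) by (intro integral_nonneg_AE) (auto elim!: eventually_mono intro: mult_nonneg_nonneg z0)
      thus "(\<integral>x. z x * - f x \<partial>M) \<le> 0" by simp
    qed
    thus ?thesis using lq[OF linear_subspaceD(3)[OF V f(1)]] lneg[OF f(1)] by simp
  qed
  have lcont: "(\<lambda>n. l (indicator (A n))) \<longlonglongrightarrow> 0"
    if A: "\<And>n. A n \<in> sets M" "decseq A" "(\<Inter>n. A n) = {}" for A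
  proof -
    have iV: "indicator (A n) \<in> ?V" for n
      by (rule bounded_measurableI[where m=1]) (use A in \<open>auto simp: indicator_def\<close>)
    have A0: "(\<lambda>n. measure M (A n)) \<longlonglongrightarrow> 0"
      using finite_Lim_measure_decseq[of A] A by auto
    have "\<exists>N. \<forall>n\<ge>N. \<bar>l (indicator (A n))\<bar> < d" if d: "0 < d" for d
    proof -
      \<comment> \<open>Weights from stage J on have mass below d/2. The finitely many earlier ones
        share the cap K and are small on \<open>A n\<close> once its measure is small.\<close>
      obtain J where J: "\<And>j. j \<ge> J \<Longrightarrow> \<bar>e j\<bar> < d/2"
        using LIMSEQ_D[OF e(1), of "d/2"] d by auto
      define K where "K = (\<Sum>j<J. \<bar>c j\<bar>)"
      have K: "\<bar>c j\<bar> \<le> K" if "j < J" for j unfolding K_def using that by (intro member_le_sum) auto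
      have K0: "0 \<le> K" unfolding K_def by (intro sum_nonneg) auto
      obtain N where N: "\<And>n. n \<ge> N \<Longrightarrow> measure M (A n) < d / (2 * (K + 1))"
        using LIMSEQ_D[OF A0, of "d / (2 * (K + 1))"] d K0 by auto
      have "\<bar>l (indicator (A n))\<bar> < d" if n: "n \<ge> N" for n
      proof -
        have "q (indicator (A n)) \<le> d/2"
        proof (rule q_le)
          fix z assume "z \<in> W"
          then obtain j where z: "z \<in> weight_ball M (c j) (e j)" by (auto simp: W_def)
          show "(\<integral>x. z x * indicator (A n) x \<partial>M) \<le> d/2"
          proof (cases "j < J")
            case False
            have "(\<integral>x. z x * indicator (A n) x \<partial>M) \<le> e j * 1"
              by (rule zle[OF z iV]) (auto simp: indicator_def)
            thus ?thesis using J[of j] False by (simp add: abs_less_iff)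
          next
            case True
            have "(\<integral>x. z x * indicator (A n) x \<partial>M) \<le> (\<integral>x. K * indicator (A n) x \<partial>M)"
            proof (rule integral_mono[OF integrable_weight_mult[OF z iV]])
              show "integrable M (\<lambda>x. K * indicator (A n) x)"
                by (intro integrable_bounded_measurable linear_subspaceD(2)[OF V] iV)
              show "z x * indicator (A n) x \<le> K * indicator (A n) x" for x
              proof (rule mult_right_mono)
                have "z x \<le> c j" using z by (auto simp: weight_ball_def)
                thus "z x \<le> K" using K[OF True] by simp
              qed simp
            qed
            also have "\<dots> = K * measure M (A n)" using A by simp
            also have "\<dots> \<le> K * (d / (2 * (K + 1)))" using N[OF n] K0 by (intro mult_left_mono) auto
            also have "\<dots> \<le> d/2" using K0 d by (simp add: field_simps)
            finally show ?thesis .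
          qed
        qed
        moreover have "0 \<le> l (indicator (A n))" by (rule lpos[OF iV]) auto
        ultimately show ?thesis using lq[OF iV[of n]] d by simp
      qed
      thus ?thesis by blast
    qed
    thus ?thesis by (intro LIMSEQ_I) simp
  qed
  have "\<exists>Z. Z \<in> borel_measurable M \<and> (\<forall>x. 0 \<le> Z x) \<and> integrable M Z
      \<and> (\<forall>f\<in>?V. l f = (\<integral>x. Z x * f x \<partial>M))"
    by (rule l1_representation[OF l lpos lcont])
  then obtain Z where Z: "Z \<in> borel_measurable M" "\<forall>x. 0 \<le> Z x" "integrable M Z"
    "\<forall>f\<in>?V. l f = (\<integral>x. Z x * f x \<partial>M)"
    by blast
  have "1 \<le> l f" if f: "f \<in> C" for f
  proof -
    have fV: "f \<in> ?V" using f CV by auto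
    show ?thesis using lq'[OF linear_subspaceD(3)[OF V fV]] q'(3) f lneg[OF fV] by force
  qed
  thus ?thesis using Z CV by (metis subsetD)
qed

end

section \<open>Essential suprema of families\<close>

text \<open>A bounded, strictly increasing transform: a countable subfamily whose pointwise supremum maximises the
  expectation of \<open>squash\<close> attains the essential supremum.\<close>

definition squash :: "ereal \<Rightarrow> real" where
  "squash x = (if x = \<infinity> then 2 else if x = - \<infinity> then - 2 else arctan (real_of_ereal x))"

lemma squash_measurable [measurable]: "squash \<in> borel_measurable borel"
  unfolding squash_def[abs_def] by measurable

lemma squash_bound: "\<bar>squash x\<bar> \<le> 2"
proof -
  have "\<bar>arctan y\<bar> \<le> 2" for y
    using arctan_bounded[of y] pi_less_4 by (auto simp: abs_le_iff)
  thus ?thesis by (auto simp: squash_def)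
qed

text \<open>The values 2 and -2 at the infinities lie beyond the range of arctan because pi/2 <
  2.\<close>

lemma squash_strict_mono: "x < y \<Longrightarrow> squash x < squash y"
proof -
  have "arctan r < 2" "- 2 < arctan r" for r using arctan_bounded[of r] pi_less_4 by auto
  thus "x < y \<Longrightarrow> squash x < squash y"
    by (cases x; cases y) (auto simp: squash_def arctan_less_iff)
qed

lemma squash_mono: "x \<le> y \<Longrightarrow> squash x \<le> squash y"
  using squash_strict_mono[of x y] by (cases "x = y") (auto simp: less_le)

lemma (in finite_measure) is_ess_sup_countable:
  fixes S :: "('a \<Rightarrow> ereal) set"
  assumes S: "S \<subseteq> borel_measurable M"
  shows "\<exists>S'\<subseteq>S. countable S' \<and> is_ess_sup M S (\<lambda>x. SUP f\<in>S'. f x)"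
proof -
  define J where "J S' = (\<integral>x. squash (SUP f\<in>S'. f x) \<partial>M)" for S' :: "('a \<Rightarrow> ereal) set"
  define CS where "CS = {S'. S' \<subseteq> S \<and> countable S'}"
  have sm[measurable]: "(\<lambda>x. SUP f\<in>S'. f x) \<in> borel_measurable M" if "S' \<in> CS" for S'
    using that S by (intro borel_measurable_SUP) (auto simp: CS_def)
  have int: "integrable M (\<lambda>x. squash (SUP f\<in>S'. f x))" if "S' \<in> CS" for S'
    by (rule integrable_const_bound[where B=2]) (use sm[OF that] squash_bound in auto)
  have Jmono: "J S1 \<le> J S2" if "S1 \<in> CS" "S2 \<in> CS" "S1 \<subseteq> S2" for S1 S2
    unfolding J_def using that by (intro integral_mono int squash_mono SUP_subset_mono) auto
  have bdd: "bdd_above (J ` CS)"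
  proof (rule bdd_aboveI2)
    fix S' assume "S' \<in> CS"
    have "J S' \<le> (\<integral>x. 2 \<partial>M)" unfolding J_def
      using squash_bound by (intro integral_mono int \<open>S' \<in> CS\<close>) (auto intro: order_trans[OF abs_ge_self])
    thus "J S' \<le> 2 * measure M (space M)" by simp
  qed
  have CSne: "CS \<noteq> {}" by (auto simp: CS_def intro!: exI[of _ "{}"])
  define j where "j = (SUP S'\<in>CS. J S')"
  have "\<exists>S'\<in>CS. j - 1 / real (Suc n) < J S'" for n
    using less_cSUP_iff[OF CSne bdd, of "j - 1 / real (Suc n)"] unfolding j_def by simp
  then obtain Sn where Sn: "\<And>n. Sn n \<in> CS" "\<And>n. j - 1 / real (Suc n) < J (Sn n)" by metis
  \<comment> \<open>The union of countably many nearly optimal countable families is again countable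
    and attains the maximum of \<open>J\<close>.\<close>
  define S' where "S' = (\<Union>n. Sn n)"
  have S'CS: "S' \<in> CS" using Sn(1) unfolding CS_def S'_def by (auto intro!: countable_UN)
  have "j \<le> J S'"
  proof (rule LIMSEQ_le_const2)
    have "(\<lambda>n. j - 1 / real (Suc n)) \<longlonglongrightarrow> j - 0"
      by (intro tendsto_intros LIMSEQ_inverse_real_of_nat[unfolded inverse_eq_divide])
    thus "(\<lambda>n. j - 1 / real (Suc n)) \<longlonglongrightarrow> j" by simp
    have "J (Sn n) \<le> J S'" for n by (rule Jmono[OF Sn(1) S'CS]) (auto simp: S'_def)
    thus "\<exists>N. \<forall>n\<ge>N. j - 1 / real (Suc n) \<le> J S'" using Sn(2) by (meson less_imp_le order_trans)
  qed
  have upper: "AE x in M. g x \<le> (SUP f\<in>S'. f x)" if g: "g \<in> S" for g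
  proof -
    \<comment> \<open>Adding g cannot raise the maximum, so both squashed suprema agree almost
      everywhere; strict monotonicity then puts g below the old supremum.\<close>
    have S2: "insert g S' \<in> CS" using S'CS g by (auto simp: CS_def)
    have "J (insert g S') \<le> j" unfolding j_def by (rule cSUP_upper[OF S2 bdd])
    hence "J (insert g S') - J S' \<le> 0" using \<open>j \<le> J S'\<close> by simp
    hence le: "(\<integral>x. squash (SUP f\<in>insert g S'. f x) - squash (SUP f\<in>S'. f x) \<partial>M) \<le> 0"
      unfolding J_def using int[OF S2] int[OF S'CS] by simp
    have nn: "0 \<le> squash (SUP f\<in>insert g S'. f x) - squash (SUP f\<in>S'. f x)" for x
      using squash_mono[OF SUP_subset_mono[of S' "insert g S'" "\<lambda>f. f x" "\<lambda>f. f x"]] by auto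
    have "(\<integral>x. squash (SUP f\<in>insert g S'. f x) - squash (SUP f\<in>S'. f x) \<partial>M) = 0"
      by (rule antisym[OF le]) (use nn in \<open>auto intro!: integral_nonneg\<close>)
    hence "AE x in M. squash (SUP f\<in>insert g S'. f x) - squash (SUP f\<in>S'. f x) = 0"
      using integral_nonneg_eq_0_iff_AE[OF Bochner_Integration.integrable_diff[OF int[OF S2] int[OF S'CS]]] nn by simp
    thus ?thesis
    proof eventually_elim
      case (elim x)
      have "\<not> (SUP f\<in>S'. f x) < (SUP f\<in>insert g S'. f x)"
        using squash_strict_mono[of "SUP f\<in>S'. f x" "SUP f\<in>insert g S'. f x"] elim by auto
      moreover have "g x \<le> (SUP f\<in>insert g S'. f x)" by (rule SUP_upper) simp
      ultimately show ?case by (simp add: not_less)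
    qed
  qed
  have "is_ess_sup M S (\<lambda>x. SUP f\<in>S'. f x)"
    unfolding is_ess_sup_def
  proof (intro conjI ballI impI)
    show "(\<lambda>x. SUP f\<in>S'. f x) \<in> borel_measurable M" by (rule sm[OF S'CS])
    show "AE x in M. g x \<le> (SUP f\<in>S'. f x)" if "g \<in> S" for g using upper[OF that] .
    fix W assume W: "\<forall>Y\<in>S. AE x in M. Y x \<le> W x"
    have "AE x in M. \<forall>f\<in>S'. f x \<le> W x"
      using S'CS W by (subst AE_ball_countable) (auto simp: CS_def)
    thus "AE x in M. (SUP f\<in>S'. f x) \<le> W x" by eventually_elim (auto intro: SUP_least)
  qed
  thus ?thesis using S'CS by (auto simp: CS_def)
qed

lemma is_ess_sup_unique:
  assumes "is_ess_sup M S Z" "is_ess_sup M S Z'"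
  shows "AE x in M. Z x = Z' x"
proof -
  have "AE x in M. Z x \<le> Z' x" "AE x in M. Z' x \<le> Z x"
    using assms unfolding is_ess_sup_def by blast+
  thus ?thesis by eventually_elim simp
qed

text \<open>\<open>ess_sup\<close> is a Hilbert choice; the countable construction supplies the
  existence that makes it meaningful.\<close>

lemma (in finite_measure) ess_sup:
  assumes S: "S \<subseteq> borel_measurable M"
  shows "is_ess_sup M S (ess_sup M S)"
  unfolding ess_sup_def using is_ess_sup_countable[OF S] by (metis someI)

lemma (in finite_measure) ess_sup_countable:
  assumes S: "S \<subseteq> borel_measurable M"
  shows "\<exists>S'\<subseteq>S. countable S' \<and> (AE x in M. ess_sup M S x = (SUP f\<in>S'. f x))"
  using is_ess_sup_countable[OF S] is_ess_sup_unique[OF ess_sup[OF S]] by blast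

text \<open>Reflection transfers the exhaustion argument to infima.\<close>

lemma is_ess_inf_iff:
  "is_ess_inf M S Z \<longleftrightarrow> is_ess_sup M ((\<lambda>f x. - f x) ` S) (\<lambda>x. - Z x)"
proof -
  have "(\<forall>W\<in>borel_measurable M. (\<forall>Y\<in>S. AE x in M. W x \<le> Y x) \<longrightarrow> (AE x in M. W x \<le> Z x))
    \<longleftrightarrow> (\<forall>W\<in>borel_measurable M. (\<forall>Y\<in>S. AE x in M. - Y x \<le> W x) \<longrightarrow> (AE x in M. - Z x \<le> W x))"
    (is "?L \<longleftrightarrow> ?R")
  proof
    assume L: ?L
    show ?R
    proof (intro ballI impI)
      fix W assume W: "W \<in> borel_measurable M" "\<forall>Y\<in>S. AE x in M. - Y x \<le> W x"
      have "AE x in M. - W x \<le> Z x"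
        using L[rule_format, of "\<lambda>x. - W x"] W by (auto simp: ereal_uminus_le_reorder)
      thus "AE x in M. - Z x \<le> W x" by (simp add: ereal_uminus_le_reorder)
    qed
  next
    assume R: ?R
    show ?L
    proof (intro ballI impI)
      fix W assume W: "W \<in> borel_measurable M" "\<forall>Y\<in>S. AE x in M. W x \<le> Y x"
      have "AE x in M. - Z x \<le> - W x"
        using R[rule_format, of "\<lambda>x. - W x"] W by auto
      thus "AE x in M. W x \<le> Z x" by simp
    qed
  qed
  moreover have "Z \<in> borel_measurable M \<longleftrightarrow> (\<lambda>x. - Z x) \<in> borel_measurable M"
    using borel_measurable_uminus_ereal[of "\<lambda>x. - Z x" M] by auto
  ultimately show ?thesis unfolding is_ess_inf_def is_ess_sup_def by simp
qed

lemma (in finite_measure) ess_inf_countable: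
  assumes S: "S \<subseteq> borel_measurable M"
  shows "is_ess_inf M S (ess_inf M S)"
    and "\<exists>S'\<subseteq>S. countable S' \<and> (AE x in M. ess_inf M S x = (INF f\<in>S'. f x))"
proof -
  have "(\<lambda>f x. - f x) ` S \<subseteq> borel_measurable M" using S by auto
  from is_ess_sup_countable[OF this] obtain S' where S': "S' \<subseteq> S" "countable ((\<lambda>f x. - f x) ` S')"
      "is_ess_sup M ((\<lambda>f x. - f x) ` S) (\<lambda>x. SUP f\<in>(\<lambda>f x. - f x) ` S'. f x)"
    by (auto simp: subset_image_iff)
  have "(\<lambda>x. SUP f\<in>(\<lambda>f x. - f x) ` S'. f x) = (\<lambda>x. - (INF f\<in>S'. f x))"
    by (auto simp: image_image ereal_SUP_uminus_eq fun_eq_iff)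
  hence inf: "is_ess_inf M S (\<lambda>x. INF f\<in>S'. f x)" using S'(3) by (simp add: is_ess_inf_iff)
  thus ess: "is_ess_inf M S (ess_inf M S)" unfolding ess_inf_def by (rule someI[of "is_ess_inf M S"])
  have "AE x in M. ess_inf M S x = (INF f\<in>S'. f x)"
    using is_ess_sup_unique[OF ess[unfolded is_ess_inf_iff] inf[unfolded is_ess_inf_iff]] by simp
  moreover have "countable S'"
  proof -
    have "(\<lambda>f x. - f x) ` ((\<lambda>f x. - f x) ` S') = S'" by (simp add: image_image)
    thus ?thesis using countable_image[OF S'(2)] by metis
  qed
  ultimately show "\<exists>S'\<subseteq>S. countable S' \<and> (AE x in M. ess_inf M S x = (INF f\<in>S'. f x))"
    using S'(1) by blast
qed

lemma is_ess_inf_lower: "is_ess_inf M S Z \<Longrightarrow> Y \<in> S \<Longrightarrow> AE x in M. Z x \<le> Y x"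
  by (simp add: is_ess_inf_def)

lemma is_ess_sup_upper: "is_ess_sup M S Z \<Longrightarrow> Y \<in> S \<Longrightarrow> AE x in M. Y x \<le> Z x"
  by (simp add: is_ess_sup_def)

lemma is_ess_sup_least:
  "is_ess_sup M S Z \<Longrightarrow> W \<in> borel_measurable M \<Longrightarrow> (\<And>Y. Y \<in> S \<Longrightarrow> AE x in M. Y x \<le> W x)
    \<Longrightarrow> AE x in M. Z x \<le> W x"
  by (simp add: is_ess_sup_def)

lemma is_ess_sup_measurable: "is_ess_sup M S Z \<Longrightarrow> Z \<in> borel_measurable M"
  by (simp add: is_ess_sup_def)

section \<open>Bounded adapted processes and the conditional pairing\<close>

locale filtered_space =
  fixes M :: "'a measure" and F :: "nat \<Rightarrow> 'a measure" and t T :: nat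
  assumes filtered: "filtered_prob_space M F" and tT: "t \<le> T"
begin

sublocale prob_space M using filtered by (simp add: filtered_prob_space_def)

abbreviation "R \<equiv> Rinf_tT M F t T"
abbreviation "L \<equiv> Linf M (F t)"
abbreviation "D \<equiv> D_tT M F t T"
abbreviation "pair \<equiv> pairing M F t T"
abbreviation one :: "'a proc" where "one \<equiv> \<lambda>s \<omega>. indicator {t..} s"

lemma sub: "subalgebra M (F s)" using filtered by (simp add: filtered_prob_space_def)

lemma space_F: "space (F s) = space M" using sub by (simp add: subalgebra_def)

lemma sets_F_mono: "s \<le> r \<Longrightarrow> sets (F s) \<subseteq> sets (F r)"
  by (rule lift_Suc_mono_le[of "\<lambda>s. sets (F s)"]) (use filtered in \<open>auto simp: filtered_prob_space_def\<close>)

lemma measurable_F_mono: "f \<in> borel_measurable (F s) \<Longrightarrow> s \<le> r \<Longrightarrow> f \<in> borel_measurable (F r)"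
  by (rule measurable_from_subalg[of "F r" "F s" f borel]) (auto simp: subalgebra_def space_F dest: sets_F_mono)

lemma measurable_FM: "f \<in> borel_measurable (F s) \<Longrightarrow> f \<in> borel_measurable M"
  using measurable_from_subalg[OF sub] by blast

sublocale cond: sigma_finite_subalgebra M "F t"
  by (rule finite_measure_subalgebra_is_sigma_finite)
    (simp add: finite_measure_subalgebra_def finite_measure_subalgebra_axioms_def finite_measure_axioms sub)

text \<open>The projection \<open>pi_tT\<close> is idempotent, so its image consists of its fixed
  points. Freezing at T preserves adaptedness because \<open>F (min s T)\<close> is contained in
  \<open>F s\<close>.\<close>

lemma Rinf_tT_iff:
  "X \<in> R \<longleftrightarrow> adapted F X \<and> (\<exists>m. AE \<omega> in M. \<forall>s. \<bar>X s \<omega>\<bar> \<le> m) \<and> pi_tT t T X = X"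
proof
  assume "X \<in> R"
  then obtain Y m where Y: "adapted F Y" "AE \<omega> in M. \<forall>s. \<bar>Y s \<omega>\<bar> \<le> m" "X = pi_tT t T Y"
    by (auto simp: Rinf_tT_def Rinf_def)
  have "X s \<in> borel_measurable (F s)" for s
  proof (cases "t \<le> s")
    case True
    have "Y (min s T) \<in> borel_measurable (F s)"
      by (rule measurable_F_mono[of _ "min s T"]) (use Y(1) in \<open>auto simp: adapted_def\<close>)
    thus ?thesis using True by (simp add: Y(3) pi_tT_def)
  qed (simp add: Y(3) pi_tT_def)
  moreover have "AE \<omega> in M. \<forall>s. \<bar>X s \<omega>\<bar> \<le> \<bar>m\<bar>"
    using Y(2)
  proof eventually_elim
    case (elim \<omega>)
    thus ?case unfolding Y(3) pi_tT_def by (simp add: order_trans[OF _ abs_ge_self])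
  qed
  moreover have "pi_tT t T X = X" using tT by (auto simp: Y(3) pi_tT_def fun_eq_iff)
  ultimately show "adapted F X \<and> (\<exists>m. AE \<omega> in M. \<forall>s. \<bar>X s \<omega>\<bar> \<le> m) \<and> pi_tT t T X = X"
    by (auto simp: adapted_def)
next
  assume "adapted F X \<and> (\<exists>m. AE \<omega> in M. \<forall>s. \<bar>X s \<omega>\<bar> \<le> m) \<and> pi_tT t T X = X"
  hence "X \<in> Rinf M F" "X = pi_tT t T X" by (auto simp: Rinf_def)
  thus "X \<in> R" unfolding Rinf_tT_def by (metis imageI)
qed

lemma R_measurable: "X \<in> R \<Longrightarrow> X s \<in> borel_measurable (F s)"
  by (simp add: Rinf_tT_iff adapted_def)

lemma R_bound: "X \<in> R \<Longrightarrow> \<exists>m\<ge>0. AE \<omega> in M. \<forall>s. \<bar>X s \<omega>\<bar> \<le> m"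
proof -
  assume "X \<in> R"
  then obtain m where "AE \<omega> in M. \<forall>s. \<bar>X s \<omega>\<bar> \<le> m" by (auto simp: Rinf_tT_iff)
  hence "AE \<omega> in M. \<forall>s. \<bar>X s \<omega>\<bar> \<le> \<bar>m\<bar>" by eventually_elim (meson abs_ge_self order_trans)
  thus ?thesis by (intro exI[of _ "\<bar>m\<bar>"]) auto
qed

lemma R_before: "X \<in> R \<Longrightarrow> s < t \<Longrightarrow> X s \<omega> = 0"
proof -
  assume "X \<in> R" "s < t"
  hence "X s \<omega> = pi_tT t T X s \<omega>" by (simp add: Rinf_tT_iff)
  thus ?thesis using \<open>s < t\<close> by (simp add: pi_tT_def)
qed

lemma R_after: "X \<in> R \<Longrightarrow> t \<le> s \<Longrightarrow> X s \<omega> = X (min s T) \<omega>"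
proof -
  assume "X \<in> R" "t \<le> s"
  hence "X s \<omega> = pi_tT t T X s \<omega>" by (simp add: Rinf_tT_iff)
  thus ?thesis using \<open>t \<le> s\<close> by (simp add: pi_tT_def)
qed

lemma R_I:
  assumes "\<And>s. t \<le> s \<Longrightarrow> s \<le> T \<Longrightarrow> X s \<in> borel_measurable (F s)"
    and "AE \<omega> in M. \<forall>s\<in>{t..T}. \<bar>X s \<omega>\<bar> \<le> m"
    and "\<And>s \<omega>. s < t \<Longrightarrow> X s \<omega> = 0" and "\<And>s \<omega>. T < s \<Longrightarrow> X s \<omega> = X T \<omega>"
  shows "X \<in> R"
  unfolding Rinf_tT_iff
proof (intro conjI exI)
  have "X s = (\<lambda>\<omega>. 0)" if "s < t" for s using assms(3) that by auto
  moreover have "X s = X T" if "T < s" for s using assms(4) that by auto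
  ultimately show "adapted F X"
    unfolding adapted_def using assms(1) measurable_F_mono[of "X T" T] tT
    by (metis borel_measurable_const less_imp_le not_le order_refl)
  show "AE \<omega> in M. \<forall>s. \<bar>X s \<omega>\<bar> \<le> \<bar>m\<bar>"
    using assms(2)
  proof eventually_elim
    case (elim \<omega>)
    show ?case
    proof
      fix s
      consider "s < t" | "s \<in> {t..T}" | "T < s" by force
      thus "\<bar>X s \<omega>\<bar> \<le> \<bar>m\<bar>"
      proof cases
        case 3
        thus ?thesis using elim[rule_format, of T] tT assms(4)[of s \<omega>] by simp
      qed (use elim assms(3)[of s \<omega>] in force)+
    qed
  qed
  show "pi_tT t T X = X" using assms(3,4) by (auto simp: pi_tT_def fun_eq_iff min_def)
qed

lemma one_R: "one \<in> R"
  by (rule R_I[where m=1]) (use tT in \<open>auto simp: indicator_def\<close>)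

lemma L_const: "(\<lambda>\<omega>. c) \<in> L" by (auto simp: Linf_def intro!: exI[of _ "\<bar>c\<bar>"])

lemma L_bound: "k \<in> L \<Longrightarrow> \<exists>m\<ge>0. AE \<omega> in M. \<bar>k \<omega>\<bar> \<le> m"
proof -
  assume "k \<in> L"
  then obtain m where "AE \<omega> in M. \<bar>k \<omega>\<bar> \<le> m" by (auto simp: Linf_def)
  hence "AE \<omega> in M. \<bar>k \<omega>\<bar> \<le> \<bar>m\<bar>" by eventually_elim (meson abs_ge_self order_trans)
  thus ?thesis by (intro exI[of _ "\<bar>m\<bar>"]) auto
qed

lemma L_uminus: "k \<in> L \<Longrightarrow> (\<lambda>\<omega>. - k \<omega>) \<in> L" by (auto simp: Linf_def)

lemma L_indicator: "A \<in> sets (F t) \<Longrightarrow> indicator A \<in> L"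
  by (auto simp: Linf_def indicator_def intro!: exI[of _ 1])

lemma L_one_minus_indicator: "A \<in> sets (F t) \<Longrightarrow> (\<lambda>\<omega>. 1 - indicator A \<omega>) \<in> L"
  by (auto simp: Linf_def indicator_def intro!: exI[of _ 1])

lemma L_measurable: "k \<in> L \<Longrightarrow> t \<le> s \<Longrightarrow> k \<in> borel_measurable (F s)"
  by (rule measurable_F_mono[of _ t]) (auto simp: Linf_def)

text \<open>Bounded \<open>F t\<close>-measurable coefficients, rather than constants, cover convex
  combinations, cash shifts and pasting along events at once.\<close>

lemma R_lincomb:
  assumes X: "X \<in> R" and Y: "Y \<in> R" and k: "k \<in> L" and k': "k' \<in> L"
  shows "(\<lambda>s \<omega>. k \<omega> * X s \<omega> + k' \<omega> * Y s \<omega>) \<in> R"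
proof -
  obtain m1 where m1: "m1 \<ge> 0" "AE \<omega> in M. \<forall>s. \<bar>X s \<omega>\<bar> \<le> m1" using R_bound[OF X] by blast
  obtain m2 where m2: "m2 \<ge> 0" "AE \<omega> in M. \<forall>s. \<bar>Y s \<omega>\<bar> \<le> m2" using R_bound[OF Y] by blast
  obtain n1 where n1: "n1 \<ge> 0" "AE \<omega> in M. \<bar>k \<omega>\<bar> \<le> n1" using L_bound[OF k] by blast
  obtain n2 where n2: "n2 \<ge> 0" "AE \<omega> in M. \<bar>k' \<omega>\<bar> \<le> n2" using L_bound[OF k'] by blast
  show ?thesis
  proof (rule R_I)
    fix s assume s: "t \<le> s" "s \<le> T"
    have "k \<in> borel_measurable (F s)" "k' \<in> borel_measurable (F s)"
      by (rule L_measurable[OF k s(1)], rule L_measurable[OF k' s(1)])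
    thus "(\<lambda>\<omega>. k \<omega> * X s \<omega> + k' \<omega> * Y s \<omega>) \<in> borel_measurable (F s)"
      using R_measurable[OF X, of s] R_measurable[OF Y, of s] by measurable
  next
    show "AE \<omega> in M. \<forall>s\<in>{t..T}. \<bar>k \<omega> * X s \<omega> + k' \<omega> * Y s \<omega>\<bar> \<le> n1 * m1 + n2 * m2"
      using m1(2) m2(2) n1(2) n2(2)
    proof eventually_elim
      case (elim \<omega>)
      have "\<bar>k \<omega> * X s \<omega>\<bar> \<le> n1 * m1" "\<bar>k' \<omega> * Y s \<omega>\<bar> \<le> n2 * m2" for s
        unfolding abs_mult using elim m1 m2 n1 n2 by (intro mult_mono; auto)+
      thus ?case by (meson abs_triangle_ineq add_mono order_trans)
    qed
  next
    fix s \<omega> assume "T < s"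
    hence "X s \<omega> = X T \<omega>" "Y s \<omega> = Y T \<omega>" using R_after[OF X, of s \<omega>] R_after[OF Y, of s \<omega>] tT by auto
    thus "k \<omega> * X s \<omega> + k' \<omega> * Y s \<omega> = k \<omega> * X T \<omega> + k' \<omega> * Y T \<omega>" by simp
  qed (use R_before[OF X] R_before[OF Y] in auto)
qed

lemma R_add: "X \<in> R \<Longrightarrow> Y \<in> R \<Longrightarrow> (\<lambda>s \<omega>. X s \<omega> + Y s \<omega>) \<in> R"
  using R_lincomb[of X Y, OF _ _ L_const[of 1] L_const[of 1]] by simp

lemma R_scale: "X \<in> R \<Longrightarrow> (\<lambda>s \<omega>. c * X s \<omega>) \<in> R"
  using R_lincomb[of X X, OF _ _ L_const[of c] L_const[of 0]] by simp

lemma R_uminus: "X \<in> R \<Longrightarrow> (\<lambda>s \<omega>. - X s \<omega>) \<in> R"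
  using R_scale[of X "-1"] by simp

lemma R_zero: "(\<lambda>s \<omega>. 0) \<in> R"
  using R_scale[OF one_R, of 0] by simp

lemma R_shift: "X \<in> R \<Longrightarrow> k \<in> L \<Longrightarrow> (\<lambda>s \<omega>. X s \<omega> + k \<omega> * indicator {t..} s) \<in> R"
  using R_lincomb[of X one "\<lambda>\<omega>. 1" k, OF _ one_R L_const[of 1]] by simp

lemma R_sum: "finite I \<Longrightarrow> (\<And>i. i \<in> I \<Longrightarrow> Y i \<in> R) \<Longrightarrow> (\<lambda>s \<omega>. \<Sum>i\<in>I. Y i s \<omega>) \<in> R"
proof (induction I rule: finite_induct)
  case empty
  show ?case using R_zero by simp
next
  case (insert i I)
  have "(\<lambda>s \<omega>. Y i s \<omega> + (\<Sum>i\<in>I. Y i s \<omega>)) \<in> R" by (rule R_add) (use insert in auto)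
  thus ?case using insert.hyps by simp
qed

lemma proc_avg_R: "(\<And>i. i \<in> {1..n} \<Longrightarrow> Y i \<in> R) \<Longrightarrow> proc_avg n Y \<in> R"
  using R_scale[OF R_sum[of "{1..n}" Y], of "1 / real n"] by (simp add: proc_avg_def)

section \<open>Scenarios, their increments and the conditional pairing\<close>

lemma A1_delta_integrable:
  assumes a: "a \<in> A1 M F"
  shows "integrable M (delta a s)"
proof -
  have ad: "a s \<in> borel_measurable M" for s using a measurable_FM by (auto simp: A1_def adapted_def)
  have [measurable]: "delta a s \<in> borel_measurable M"
    unfolding delta_def[abs_def] using ad by (cases "s = 0") auto
  have "(\<integral>\<^sup>+\<omega>. ennreal \<bar>delta a s \<omega>\<bar> \<partial>M) \<le> (\<integral>\<^sup>+\<omega>. (\<Sum>s. ennreal \<bar>delta a s \<omega>\<bar>) \<partial>M)"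
  proof (rule nn_integral_mono)
    fix \<omega>
    have "(\<Sum>s\<in>{s}. ennreal \<bar>delta a s \<omega>\<bar>) \<le> (\<Sum>s. ennreal \<bar>delta a s \<omega>\<bar>)"
      by (rule sum_le_suminf) auto
    thus "ennreal \<bar>delta a s \<omega>\<bar> \<le> (\<Sum>s. ennreal \<bar>delta a s \<omega>\<bar>)" by simp
  qed
  also have "\<dots> < \<infinity>" using a by (simp add: A1_def)
  finally show ?thesis by (intro integrableI_bounded) auto
qed

text \<open>If a is the projection of b, then a vanishes before t and jumps at t to b t, the sum of
  all increments of b up to t. After t, up to T, the increments of a and b agree. Integrability and
  positivity thus pass from b to a.\<close>

lemma D_delta:
  assumes a: "a \<in> D" and s: "s \<in> {t..T}"
  shows "integrable M (delta a s)" and "AE \<omega> in M. 0 \<le> delta a s \<omega>"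
proof -
  obtain b where b: "b \<in> A1 M F" "AE \<omega> in M. \<forall>s. 0 \<le> delta b s \<omega>" "a = pi_tT t T b"
    using a by (auto simp: D_tT_def A1plus_def)
  have sumd: "b r \<omega> = (\<Sum>u\<le>r. delta b u \<omega>)" for r \<omega>
    by (induction r) (auto simp: delta_def)
  have "integrable M (delta a s) \<and> (AE \<omega> in M. 0 \<le> delta a s \<omega>)"
  proof (cases "s = t")
    case True
    have "delta a s \<omega> = b t \<omega>" for \<omega>
      unfolding True b(3) delta_def pi_tT_def using tT by auto
    hence "delta a s = (\<lambda>\<omega>. \<Sum>u\<le>t. delta b u \<omega>)" using sumd[of t] by (simp add: fun_eq_iff)
    moreover have "AE \<omega> in M. 0 \<le> (\<Sum>u\<le>t. delta b u \<omega>)"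
      using b(2) by eventually_elim (auto intro: sum_nonneg)
    ultimately show ?thesis using A1_delta_integrable[OF b(1)] by auto
  next
    case False
    hence "t < s" "t \<le> s - 1" "min (s - 1) T = s - 1" "min s T = s" using s by auto
    hence "delta a s = delta b s" by (auto simp: delta_def b(3) pi_tT_def fun_eq_iff)
    thus ?thesis using A1_delta_integrable[OF b(1)] b(2) by (auto elim: eventually_mono)
  qed
  thus "integrable M (delta a s)" "AE \<omega> in M. 0 \<le> delta a s \<omega>" by auto
qed

lemma R_delta_integrable:
  assumes a: "a \<in> D" and X: "X \<in> R" and s: "s \<in> {t..T}"
  shows "integrable M (\<lambda>\<omega>. X s \<omega> * delta a s \<omega>)"
proof -
  obtain m where m: "m \<ge> 0" "AE \<omega> in M. \<forall>s. \<bar>X s \<omega>\<bar> \<le> m" using R_bound[OF X] by blast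
  have [measurable]: "X s \<in> borel_measurable M" using measurable_FM[OF R_measurable[OF X]] .
  have [measurable]: "delta a s \<in> borel_measurable M" using D_delta(1)[OF a s] by auto
  show ?thesis
  proof (rule Bochner_Integration.integrable_bound)
    show "integrable M (\<lambda>\<omega>. m * delta a s \<omega>)" using D_delta(1)[OF a s] by simp
    show "AE \<omega> in M. norm (X s \<omega> * delta a s \<omega>) \<le> norm (m * delta a s \<omega>)"
      using m(2) by eventually_elim (use m(1) in \<open>auto simp: abs_mult intro!: mult_right_mono\<close>)
  qed measurable
qed

lemma pair_integrand_integrable:
  "a \<in> D \<Longrightarrow> X \<in> R \<Longrightarrow> integrable M (\<lambda>\<omega>. \<Sum>s\<in>{t..T}. X s \<omega> * delta a s \<omega>)"
  by (intro Bochner_Integration.integrable_sum R_delta_integrable)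

lemma pair_measurable_F: "pair X a \<in> borel_measurable (F t)"
  unfolding pairing_def by measurable

lemma pair_measurable [measurable]: "pair X a \<in> borel_measurable M"
  using measurable_FM[OF pair_measurable_F] .

lemma pair_integral:
  assumes a: "a \<in> D" and X: "X \<in> R"
  shows "integrable M (pair X a)" and "(\<integral>\<omega>. pair X a \<omega> \<partial>M) = (\<Sum>s\<in>{t..T}. \<integral>\<omega>. X s \<omega> * delta a s \<omega> \<partial>M)"
  unfolding pairing_def using cond.real_cond_exp_int[OF pair_integrand_integrable[OF a X]]
    R_delta_integrable[OF a X] by (auto simp: Bochner_Integration.integral_sum)

text \<open>\<open>F t\<close>-measurable coefficients come out of the conditional expectation;
  shift, scaling, sums and pasting are instances.\<close>

lemma pair_lincomb:
  assumes a: "a \<in> D" and X: "X \<in> R" and Y: "Y \<in> R" and k: "k \<in> L" and k': "k' \<in> L"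
  shows "AE \<omega> in M. pair (\<lambda>s \<omega>. k \<omega> * X s \<omega> + k' \<omega> * Y s \<omega>) a \<omega> = k \<omega> * pair X a \<omega> + k' \<omega> * pair Y a \<omega>"
proof -
  define f where "f X \<omega> = (\<Sum>s\<in>{t..T}. X s \<omega> * delta a s \<omega>)" for X :: "'a proc" and \<omega>
  have fX: "integrable M (f X)" if "X \<in> R" for X
    using pair_integrand_integrable[OF a that] by (simp add: f_def[abs_def])
  have km: "k \<in> borel_measurable (F t)" "k' \<in> borel_measurable (F t)" using k k' by (auto simp: Linf_def)
  have kf: "integrable M (\<lambda>\<omega>. k \<omega> * f X \<omega>)" if k: "k \<in> L" and X: "X \<in> R" for k X
  proof -
    have "(\<lambda>s \<omega>. k \<omega> * X s \<omega> + 0 * X s \<omega>) \<in> R" by (rule R_lincomb[OF X X k L_const])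
    from fX[OF this] show ?thesis by (simp add: f_def[abs_def] sum_distrib_left mult.assoc)
  qed
  have "f (\<lambda>s \<omega>. k \<omega> * X s \<omega> + k' \<omega> * Y s \<omega>) = (\<lambda>\<omega>. k \<omega> * f X \<omega> + k' \<omega> * f Y \<omega>)"
    by (auto simp: f_def fun_eq_iff sum_distrib_left sum.distrib algebra_simps)
  moreover have "AE \<omega> in M. real_cond_exp M (F t) (\<lambda>\<omega>. k \<omega> * f X \<omega> + k' \<omega> * f Y \<omega>) \<omega>
      = real_cond_exp M (F t) (\<lambda>\<omega>. k \<omega> * f X \<omega>) \<omega> + real_cond_exp M (F t) (\<lambda>\<omega>. k' \<omega> * f Y \<omega>) \<omega>"
    by (rule cond.real_cond_exp_add[OF kf[OF k X] kf[OF k' Y]])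
  moreover have "AE \<omega> in M. real_cond_exp M (F t) (\<lambda>\<omega>. k \<omega> * f X \<omega>) \<omega> = k \<omega> * real_cond_exp M (F t) (f X) \<omega>"
    using km fX[OF X] by (intro cond.real_cond_exp_mult kf[OF k X]) auto
  moreover have "AE \<omega> in M. real_cond_exp M (F t) (\<lambda>\<omega>. k' \<omega> * f Y \<omega>) \<omega> = k' \<omega> * real_cond_exp M (F t) (f Y) \<omega>"
    using km fX[OF Y] by (intro cond.real_cond_exp_mult kf[OF k' Y]) auto
  ultimately have "AE \<omega> in M. real_cond_exp M (F t) (f (\<lambda>s \<omega>. k \<omega> * X s \<omega> + k' \<omega> * Y s \<omega>)) \<omega>
      = k \<omega> * real_cond_exp M (F t) (f X) \<omega> + k' \<omega> * real_cond_exp M (F t) (f Y) \<omega>"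
    by auto
  thus ?thesis by (simp add: pairing_def f_def[abs_def])
qed

lemma pair_one: "a \<in> D \<Longrightarrow> AE \<omega> in M. pair one a \<omega> = 1"
proof -
  assume "a \<in> D"
  \<comment> \<open>The normalisation of \<open>D\<close> uses the constant process 1 and cash
    starts at t; the pairing sees only the times t to T, where they agree.\<close>
  moreover have "pair one a = pair (\<lambda>s \<omega>. 1) a" by (auto simp: pairing_def intro!: arg_cong[of _ _ "real_cond_exp M (F t)"])
  ultimately show ?thesis by (simp add: D_tT_def)
qed

lemma pair_shift:
  assumes a: "a \<in> D" and X: "X \<in> R" and k: "k \<in> L"
  shows "AE \<omega> in M. pair (\<lambda>s \<omega>. X s \<omega> + k \<omega> * indicator {t..} s) a \<omega> = pair X a \<omega> + k \<omega>"
  using pair_lincomb[OF a X one_R L_const[of 1] k] pair_one[OF a] by auto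

lemma pair_scale:
  assumes a: "a \<in> D" and X: "X \<in> R"
  shows "AE \<omega> in M. pair (\<lambda>s \<omega>. c * X s \<omega>) a \<omega> = c * pair X a \<omega>"
  using pair_lincomb[OF a X X L_const[of c] L_const[of 0]] by auto

lemma pair_uminus:
  assumes a: "a \<in> D" and X: "X \<in> R"
  shows "AE \<omega> in M. pair (\<lambda>s \<omega>. - X s \<omega>) a \<omega> = - pair X a \<omega>"
  using pair_scale[OF a X, of "-1"] by simp

lemma pair_sum:
  assumes a: "a \<in> D" and I: "finite I" "\<And>i. i \<in> I \<Longrightarrow> Y i \<in> R"
  shows "AE \<omega> in M. pair (\<lambda>s \<omega>. \<Sum>i\<in>I. Y i s \<omega>) a \<omega> = (\<Sum>i\<in>I. pair (Y i) a \<omega>)"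
  using I
proof (induction I rule: finite_induct)
  case empty
  show ?case using pair_scale[OF a one_R, of 0] by simp
next
  case (insert i I)
  have "AE \<omega> in M. pair (\<lambda>s \<omega>. 1 * Y i s \<omega> + 1 * (\<Sum>i\<in>I. Y i s \<omega>)) a \<omega>
      = 1 * pair (Y i) a \<omega> + 1 * pair (\<lambda>s \<omega>. \<Sum>i\<in>I. Y i s \<omega>) a \<omega>"
    by (intro pair_lincomb[OF a _ _ L_const L_const] R_sum) (use insert in auto)
  moreover have "AE \<omega> in M. pair (\<lambda>s \<omega>. \<Sum>i\<in>I. Y i s \<omega>) a \<omega> = (\<Sum>i\<in>I. pair (Y i) a \<omega>)"
    using insert by auto
  ultimately show ?case using insert.hyps by auto
qed

lemma pair_avg:
  assumes a: "a \<in> D" and Y: "\<And>i. i \<in> {1..n} \<Longrightarrow> Y i \<in> R"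
  shows "AE \<omega> in M. pair (proc_avg n Y) a \<omega> = (\<Sum>i\<in>{1..n}. pair (Y i) a \<omega>) / real n"
proof -
  have "AE \<omega> in M. pair (\<lambda>s \<omega>. (1 / real n) * (\<Sum>i\<in>{1..n}. Y i s \<omega>)) a \<omega>
      = (1 / real n) * pair (\<lambda>s \<omega>. \<Sum>i\<in>{1..n}. Y i s \<omega>) a \<omega>"
    by (intro pair_scale[OF a] R_sum Y) auto
  moreover have "AE \<omega> in M. pair (\<lambda>s \<omega>. \<Sum>i\<in>{1..n}. Y i s \<omega>) a \<omega> = (\<Sum>i\<in>{1..n}. pair (Y i) a \<omega>)"
    by (rule pair_sum[OF a]) (use Y in auto)
  ultimately show ?thesis by eventually_elim (simp add: proc_avg_def)
qed

lemma pair_mono: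
  assumes a: "a \<in> D" and X: "X \<in> R" and Y: "Y \<in> R" and le: "AE \<omega> in M. \<forall>s. X s \<omega> \<le> Y s \<omega>"
  shows "AE \<omega> in M. pair X a \<omega> \<le> pair Y a \<omega>"
  unfolding pairing_def
proof (rule cond.real_cond_exp_mono)
  have "AE \<omega> in M. \<forall>s\<in>{t..T}. 0 \<le> delta a s \<omega>"
    by (rule AE_finite_allI) (use D_delta(2)[OF a] in auto)
  thus "AE \<omega> in M. (\<Sum>s\<in>{t..T}. X s \<omega> * delta a s \<omega>) \<le> (\<Sum>s\<in>{t..T}. Y s \<omega> * delta a s \<omega>)"
    using le by eventually_elim (auto intro!: sum_mono mult_right_mono)
qed (use pair_integrand_integrable[OF a] X Y in auto)

text \<open>A scenario averages with total conditional weight 1: compare X with the constant streams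
  m and - m from t on.\<close>

lemma pair_bound:
  assumes a: "a \<in> D" and X: "X \<in> R" and m: "AE \<omega> in M. \<forall>s. \<bar>X s \<omega>\<bar> \<le> m"
  shows "AE \<omega> in M. \<bar>pair X a \<omega>\<bar> \<le> m"
proof -
  have "AE \<omega> in M. pair X a \<omega> \<le> pair (\<lambda>s \<omega>. m * indicator {t..} s) a \<omega>"
    using m R_before[OF X]
    by (intro pair_mono[OF a X R_scale[OF one_R]]) (auto elim!: eventually_mono simp: indicator_def abs_le_iff not_le)
  moreover have "AE \<omega> in M. pair (\<lambda>s \<omega>. (- m) * indicator {t..} s) a \<omega> \<le> pair X a \<omega>"
  proof (rule pair_mono[OF a R_scale[OF one_R] X])
    show "AE \<omega> in M. \<forall>s. - m * indicator {t..} s \<le> X s \<omega>" using m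
    proof eventually_elim
      case (elim \<omega>)
      have "- m * indicator {t..} s \<le> X s \<omega>" for s
        using elim[rule_format, of s] R_before[OF X, of s \<omega>] by (auto simp: indicator_def not_le)
      thus ?case by blast
    qed
  qed
  ultimately show ?thesis
    using pair_scale[OF a one_R, of m] pair_scale[OF a one_R, of "- m"] pair_one[OF a]
    by eventually_elim (auto simp: abs_le_iff)
qed

end

section \<open>The optional measure space\<close>

context filtered_space
begin

text \<open>Each time section must belong to the sigma-algebra of that time, so that measurability
  for this algebra is adaptedness (\<open>opt_measurable_iff\<close>).\<close>

definition opt_sets :: "(nat \<times> 'a) set set" where
  "opt_sets = {A. A \<subseteq> {t..T} \<times> space M \<and> (\<forall>s\<in>{t..T}. {\<omega> \<in> space M. (s, \<omega>) \<in> A} \<in> sets (F s))}"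

definition opt_alg :: "(nat \<times> 'a) measure" where
  "opt_alg = measure_of ({t..T} \<times> space M) opt_sets (\<lambda>_. 0)"

text \<open>Counting measure times \<open>M\<close>, restricted to the adapted sets: the integral is
  the sum over times of expectations, which is the form of an integrated pairing.\<close>

definition opt :: "(nat \<times> 'a) measure" where
  "opt = restr_to_subalg (count_space {t..T} \<Otimes>\<^sub>M M) opt_alg"

lemma sigma_algebra_opt_sets: "sigma_algebra ({t..T} \<times> space M) opt_sets"
  unfolding sigma_algebra_iff2
proof (intro conjI ballI allI impI)
  show "opt_sets \<subseteq> Pow ({t..T} \<times> space M)" "{} \<in> opt_sets" by (auto simp: opt_sets_def)
  show "{t..T} \<times> space M - A \<in> opt_sets" if A: "A \<in> opt_sets" for A
  proof -
    have "{\<omega> \<in> space M. (s, \<omega>) \<in> {t..T} \<times> space M - A} \<in> sets (F s)" if s: "s \<in> {t..T}" for s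
    proof -
      have "{\<omega> \<in> space M. (s, \<omega>) \<in> {t..T} \<times> space M - A} = space (F s) - {\<omega> \<in> space M. (s, \<omega>) \<in> A}"
        using s by (auto simp: space_F)
      also have "\<dots> \<in> sets (F s)" using A s by (intro sets.compl_sets) (auto simp: opt_sets_def)
      finally show ?thesis .
    qed
    thus ?thesis by (auto simp: opt_sets_def)
  qed
  show "(\<Union>i. A i) \<in> opt_sets" if A: "range A \<subseteq> opt_sets" for A :: "nat \<Rightarrow> _"
  proof -
    have "{\<omega> \<in> space M. (s, \<omega>) \<in> (\<Union>i. A i)} \<in> sets (F s)" if s: "s \<in> {t..T}" for s
    proof -
      have "{\<omega> \<in> space M. (s, \<omega>) \<in> (\<Union>i. A i)} = (\<Union>i. {\<omega> \<in> space M. (s, \<omega>) \<in> A i})" by auto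
      also have "\<dots> \<in> sets (F s)" using A s by (intro sets.countable_UN) (auto simp: opt_sets_def)
      finally show ?thesis .
    qed
    moreover have "(\<Union>i. A i) \<subseteq> {t..T} \<times> space M" using A by (force simp: opt_sets_def)
    ultimately show ?thesis by (auto simp: opt_sets_def)
  qed
qed

lemma sets_opt_alg: "sets opt_alg = opt_sets" and space_opt_alg: "space opt_alg = {t..T} \<times> space M"
  unfolding opt_alg_def
  using sigma_algebra.sets_measure_of_eq[OF sigma_algebra_opt_sets]
    sigma_algebra.space_measure_of_eq[OF sigma_algebra_opt_sets] by auto

lemma subalgebra_opt: "subalgebra (count_space {t..T} \<Otimes>\<^sub>M M) opt_alg"
  unfolding subalgebra_def
proof
  show "space opt_alg = space (count_space {t..T} \<Otimes>\<^sub>M M)" by (simp add: space_opt_alg space_pair_measure)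
  show "sets opt_alg \<subseteq> sets (count_space {t..T} \<Otimes>\<^sub>M M)"
  proof
    fix A assume "A \<in> sets opt_alg"
    hence A: "A \<subseteq> {t..T} \<times> space M" "\<And>s. s \<in> {t..T} \<Longrightarrow> {\<omega> \<in> space M. (s, \<omega>) \<in> A} \<in> sets (F s)"
      by (auto simp: sets_opt_alg opt_sets_def)
    have "A = (\<Union>s\<in>{t..T}. {s} \<times> {\<omega> \<in> space M. (s, \<omega>) \<in> A})" using A(1) by auto
    also have "\<dots> \<in> sets (count_space {t..T} \<Otimes>\<^sub>M M)"
    proof (intro sets.finite_UN pair_measureI)
      show "{\<omega> \<in> space M. (s, \<omega>) \<in> A} \<in> sets M" if "s \<in> {t..T}" for s
        using A(2)[OF that] sub[of s] by (auto simp: subalgebra_def)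
    qed auto
    finally show "A \<in> sets (count_space {t..T} \<Otimes>\<^sub>M M)" .
  qed
qed

text \<open>This makes a density found on \<open>opt\<close> adapted, so that its partial sums over
  time form a scenario.\<close>

lemma opt_measurable_iff:
  "h \<in> borel_measurable opt \<longleftrightarrow> (\<forall>s\<in>{t..T}. (\<lambda>\<omega>. h (s, \<omega>)) \<in> borel_measurable (F s))"
    for h :: "nat \<times> 'a \<Rightarrow> real"
proof -
  have eq: "borel_measurable opt = borel_measurable opt_alg"
    unfolding opt_def by (rule measurable_cong_sets) (auto simp: sets_restr_to_subalg[OF subalgebra_opt])
  show ?thesis
    unfolding eq
  proof (intro iffI ballI)
    fix s assume h: "h \<in> borel_measurable opt_alg" and s: "s \<in> {t..T}"
    have "(\<lambda>\<omega>. (s, \<omega>)) \<in> measurable (F s) opt_alg"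
    proof (rule measurableI)
      show "(s, \<omega>) \<in> space opt_alg" if "\<omega> \<in> space (F s)" for \<omega> using that s by (auto simp: space_opt_alg space_F)
      fix A assume "A \<in> sets opt_alg"
      hence "{\<omega> \<in> space M. (s, \<omega>) \<in> A} \<in> sets (F s)" using s by (auto simp: sets_opt_alg opt_sets_def)
      moreover have "(\<lambda>\<omega>. (s, \<omega>)) -` A \<inter> space (F s) = {\<omega> \<in> space M. (s, \<omega>) \<in> A}" by (auto simp: space_F)
      ultimately show "(\<lambda>\<omega>. (s, \<omega>)) -` A \<inter> space (F s) \<in> sets (F s)" by simp
    qed
    from measurable_compose[OF this h] show "(\<lambda>\<omega>. h (s, \<omega>)) \<in> borel_measurable (F s)" .
  next
    assume h: "\<forall>s\<in>{t..T}. (\<lambda>\<omega>. h (s, \<omega>)) \<in> borel_measurable (F s)"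
    show "h \<in> borel_measurable opt_alg"
    proof (rule measurableI)
      fix B :: "real set" assume B: "B \<in> sets borel"
      have "{\<omega> \<in> space M. (s, \<omega>) \<in> h -` B \<inter> space opt_alg} \<in> sets (F s)" if s: "s \<in> {t..T}" for s
      proof -
        have "(\<lambda>\<omega>. h (s, \<omega>)) -` B \<inter> space (F s) \<in> sets (F s)" using h s B by (intro measurable_sets) auto
        moreover have "{\<omega> \<in> space M. (s, \<omega>) \<in> h -` B \<inter> space opt_alg} = (\<lambda>\<omega>. h (s, \<omega>)) -` B \<inter> space (F s)"
          using s by (auto simp: space_opt_alg space_F)
        ultimately show ?thesis by simp
      qed
      thus "h -` B \<inter> space opt_alg \<in> sets opt_alg" by (auto simp: sets_opt_alg opt_sets_def space_opt_alg)
    qed simp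
  qed
qed

lemma pair_sigma_finite_count: "pair_sigma_finite (count_space {t..T}) M"
proof -
  interpret C: finite_measure "count_space {t..T}" by (rule finite_measure_count_space) simp
  show ?thesis ..
qed

lemma opt_finite_measure: "finite_measure opt"
  unfolding opt_def
proof (rule finite_measure_restr_to_subalg[OF subalgebra_opt])
  show "finite_measure (count_space {t..T} \<Otimes>\<^sub>M M)"
    by (rule finite_measure_pair_measure[OF finite_measure_axioms]) (auto intro: finite_measure_count_space)
qed

lemma opt_AE:
  assumes "AE x in opt. Q x" and s: "s \<in> {t..T}"
  shows "AE \<omega> in M. Q (s, \<omega>)"
proof -
  interpret P: pair_sigma_finite "count_space {t..T}" M by (rule pair_sigma_finite_count)
  have "AE x in count_space {t..T} \<Otimes>\<^sub>M M. Q x"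
    using AE_restr_to_subalg[OF subalgebra_opt] assms(1) unfolding opt_def by blast
  from P.AE_pair[OF this] show ?thesis using s by (simp add: AE_count_space)
qed

lemma opt_integral:
  fixes h :: "nat \<times> 'a \<Rightarrow> real"
  assumes h: "integrable opt h"
  shows "\<And>s. s \<in> {t..T} \<Longrightarrow> integrable M (\<lambda>\<omega>. h (s, \<omega>))"
    and "(\<integral>x. h x \<partial>opt) = (\<Sum>s\<in>{t..T}. \<integral>\<omega>. h (s, \<omega>) \<partial>M)"
proof -
  interpret P: pair_sigma_finite "count_space {t..T}" M by (rule pair_sigma_finite_count)
  have i: "integrable (count_space {t..T} \<Otimes>\<^sub>M M) h"
    using integrable_from_subalg[OF subalgebra_opt] h unfolding opt_def by blast
  show "integrable M (\<lambda>\<omega>. h (s, \<omega>))" if "s \<in> {t..T}" for s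
    using P.AE_integrable_fst'[OF i] that by (simp add: AE_count_space)
  have "(borel_measurable opt :: (nat \<times> 'a \<Rightarrow> real) set) = borel_measurable opt_alg"
    unfolding opt_def by (rule measurable_cong_sets) (auto simp: sets_restr_to_subalg[OF subalgebra_opt])
  hence "h \<in> borel_measurable opt_alg" using borel_measurable_integrable[OF h] by simp
  hence "(\<integral>x. h x \<partial>opt) = (\<integral>x. h x \<partial>(count_space {t..T} \<Otimes>\<^sub>M M))"
    unfolding opt_def by (rule integral_subalgebra2[OF subalgebra_opt])
  also have "\<dots> = (\<integral>s. (\<integral>\<omega>. h (s, \<omega>) \<partial>M) \<partial>count_space {t..T})"
    by (rule P.integral_fst'[OF i, symmetric])
  also have "\<dots> = (\<Sum>s\<in>{t..T}. \<integral>\<omega>. h (s, \<omega>) \<partial>M)"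
    by (rule lebesgue_integral_count_space_finite) simp
  finally show "(\<integral>x. h x \<partial>opt) = (\<Sum>s\<in>{t..T}. \<integral>\<omega>. h (s, \<omega>) \<partial>M)" .
qed

section \<open>Passage between functions on the optional space and processes\<close>

definition opt_proc :: "(nat \<times> 'a \<Rightarrow> real) \<Rightarrow> 'a proc" where
  "opt_proc H = (\<lambda>s \<omega>. if t \<le> s then H (min s T, \<omega>) else 0)"

lemma opt_proc_R:
  assumes H: "H \<in> bounded_measurable opt"
  shows "opt_proc H \<in> R"
proof -
  obtain m where m: "m \<ge> 0" "\<forall>x. \<bar>H x\<bar> \<le> m" using bounded_measurableD(2)[OF H] by blast
  have "H \<in> borel_measurable opt" by (rule bounded_measurableD(1)[OF H])
  hence Hs: "(\<lambda>\<omega>. H (s, \<omega>)) \<in> borel_measurable (F s)" if "s \<in> {t..T}" for s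
    using that by (simp add: opt_measurable_iff)
  show ?thesis
  proof (rule R_I[where m=m])
    show "opt_proc H s \<in> borel_measurable (F s)" if "t \<le> s" "s \<le> T" for s
      using Hs[of s] that by (simp add: opt_proc_def)
  qed (use m tT in \<open>auto simp: opt_proc_def\<close>)
qed

lemma opt_proc_AE_mono:
  assumes "AE x in opt. H x \<le> G x"
  shows "AE \<omega> in M. \<forall>s. opt_proc H s \<omega> \<le> opt_proc G s \<omega>"
proof -
  have "AE \<omega> in M. \<forall>s\<in>{t..T}. H (s, \<omega>) \<le> G (s, \<omega>)"
    by (rule AE_finite_allI) (use opt_AE[OF assms] in auto)
  thus ?thesis by eventually_elim (use tT in \<open>auto simp: opt_proc_def\<close>)
qed

definition scenario :: "(nat \<times> 'a \<Rightarrow> real) \<Rightarrow> 'a proc" where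
  "scenario Z = (\<lambda>s \<omega>. \<Sum>r\<in>{t..min s T}. Z (r, \<omega>))"

lemma delta_scenario: "delta (scenario Z) s \<omega> = (if s \<in> {t..T} then Z (s, \<omega>) else 0)"
proof -
  consider "s = 0" | "0 < s" "s \<le> T" "t \<le> s" | "0 < s" "s < t" | "T < s" by linarith
  thus ?thesis
  proof cases
    case 1
    thus ?thesis using tT by (auto simp: delta_def scenario_def)
  next
    case 2
    hence "{t..min s T} = insert s {t..min (s - 1) T}" "s \<notin> {t..min (s - 1) T}" by auto
    thus ?thesis using 2 by (simp add: delta_def scenario_def)
  next
    case 3
    hence "{t..min s T} = {}" "{t..min (s - 1) T} = {}" by auto
    thus ?thesis using 3 by (simp add: delta_def scenario_def)
  next
    case 4
    hence "min s T = T" "min (s - 1) T = T" by auto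
    thus ?thesis using 4 by (simp add: delta_def scenario_def)
  qed
qed

text \<open>The hypothesis on events of \<open>F t\<close> is the integrated form of conditional
  mass 1, to which the characterisation of conditional expectation applies.\<close>

lemma scenario_D:
  assumes Z: "integrable opt Z" "\<And>x. 0 \<le> Z x"
    and norm: "\<And>A. A \<in> sets (F t) \<Longrightarrow> (\<Sum>s\<in>{t..T}. \<integral>\<omega>. Z (s, \<omega>) * indicator A \<omega> \<partial>M) = measure M A"
  shows "scenario Z \<in> D"
proof -
  have Zs: "integrable M (\<lambda>\<omega>. Z (s, \<omega>))" if "s \<in> {t..T}" for s by (rule opt_integral(1)[OF Z(1) that])
  have Zm: "(\<lambda>\<omega>. Z (s, \<omega>)) \<in> borel_measurable (F s)" if "s \<in> {t..T}" for s
    using borel_measurable_integrable[OF Z(1)] that by (simp add: opt_measurable_iff)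
  have "adapted F (scenario Z)"
    unfolding adapted_def scenario_def
  proof (intro allI borel_measurable_sum)
    fix s r assume "r \<in> {t..min s T}"
    thus "(\<lambda>\<omega>. Z (r, \<omega>)) \<in> borel_measurable (F s)" by (intro measurable_F_mono[OF Zm]) auto
  qed
  moreover have "(\<integral>\<^sup>+\<omega>. (\<Sum>s. ennreal \<bar>delta (scenario Z) s \<omega>\<bar>) \<partial>M) < \<infinity>"
  proof -
    have "(\<Sum>s. ennreal \<bar>delta (scenario Z) s \<omega>\<bar>) = (\<Sum>s\<in>{t..T}. ennreal (Z (s, \<omega>)))" for \<omega>
    proof -
      have "(\<Sum>s. ennreal \<bar>delta (scenario Z) s \<omega>\<bar>) = (\<Sum>s\<in>{t..T}. ennreal \<bar>delta (scenario Z) s \<omega>\<bar>)"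
        by (rule suminf_finite) (auto simp: delta_scenario)
      thus ?thesis using Z(2) by (simp add: delta_scenario)
    qed
    hence "(\<integral>\<^sup>+\<omega>. (\<Sum>s. ennreal \<bar>delta (scenario Z) s \<omega>\<bar>) \<partial>M) = (\<integral>\<^sup>+\<omega>. (\<Sum>s\<in>{t..T}. ennreal (Z (s, \<omega>))) \<partial>M)"
      by simp
    also have "\<dots> = (\<Sum>s\<in>{t..T}. \<integral>\<^sup>+\<omega>. ennreal (Z (s, \<omega>)) \<partial>M)"
    proof (rule nn_integral_sum)
      fix s assume "s \<in> {t..T}"
      from borel_measurable_integrable[OF Zs[OF this]]
      show "(\<lambda>\<omega>. ennreal (Z (s, \<omega>))) \<in> borel_measurable M" by measurable
    qed
    also have "\<dots> = (\<Sum>s\<in>{t..T}. ennreal (\<integral>\<omega>. Z (s, \<omega>) \<partial>M))"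
      using Zs Z(2) by (intro sum.cong nn_integral_eq_integral) auto
    also have "\<dots> < \<infinity>" by simp
    finally show ?thesis .
  qed
  ultimately have "scenario Z \<in> A1plus M F"
    using Z(2) by (auto simp: A1plus_def A1_def delta_scenario)
  moreover have "pi_tT t T (scenario Z) = scenario Z"
    using tT by (auto simp: pi_tT_def scenario_def fun_eq_iff)
  ultimately have 1: "scenario Z \<in> pi_tT t T ` A1plus M F" by (metis imageI)
  have eq: "(\<lambda>\<omega>. \<Sum>s\<in>{t..T}. 1 * delta (scenario Z) s \<omega>) = (\<lambda>\<omega>. \<Sum>s\<in>{t..T}. Z (s, \<omega>))"
    by (auto simp: delta_scenario fun_eq_iff)
  have "AE \<omega> in M. real_cond_exp M (F t) (\<lambda>\<omega>. \<Sum>s\<in>{t..T}. Z (s, \<omega>)) \<omega> = 1"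
  proof (rule cond.real_cond_exp_charact)
    fix A assume A: "A \<in> sets (F t)"
    hence AM: "A \<in> sets M" using sub[of t] by (auto simp: subalgebra_def)
    have "(\<integral>\<omega>\<in>A. (\<Sum>s\<in>{t..T}. Z (s, \<omega>)) \<partial>M) = (\<integral>\<omega>. (\<Sum>s\<in>{t..T}. Z (s, \<omega>) * indicator A \<omega>) \<partial>M)"
      unfolding set_lebesgue_integral_def real_scaleR_def sum_distrib_left by (simp only: mult.commute)
    also have "\<dots> = (\<Sum>s\<in>{t..T}. \<integral>\<omega>. Z (s, \<omega>) * indicator A \<omega> \<partial>M)"
      using Zs AM by (intro Bochner_Integration.integral_sum integrable_real_mult_indicator)
    also have "\<dots> = (\<integral>\<omega>\<in>A. 1 \<partial>M)" using norm[OF A] AM by (simp add: set_lebesgue_integral_def)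
    finally show "(\<integral>\<omega>\<in>A. (\<Sum>s\<in>{t..T}. Z (s, \<omega>)) \<partial>M) = (\<integral>\<omega>\<in>A. 1 \<partial>M)" .
  qed (use Zs in auto)
  hence "AE \<omega> in M. pair (\<lambda>s \<omega>. 1) (scenario Z) \<omega> = 1" unfolding pairing_def eq .
  thus ?thesis using 1 by (simp add: D_tT_def)
qed

end

section \<open>Concave monetary utility functions\<close>

locale concave_utility = filtered_space M F t T
  for M :: "'a measure" and F :: "nat \<Rightarrow> 'a measure" and t T :: nat +
  fixes \<phi> :: "'a proc \<Rightarrow> 'a \<Rightarrow> real"
  assumes monetary: "monetary_utility M F t T \<phi>"
    and concave: "concave_mu M F t T \<phi>"
    and continuous: "cont_bdd_decr M F t T \<phi>"
begin

lemma phi_L: "X \<in> R \<Longrightarrow> \<phi> X \<in> L"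
  using monetary unfolding monetary_utility_def by blast

lemma phi_indicator:
  "X \<in> R \<Longrightarrow> A \<in> sets (F t) \<Longrightarrow> AE \<omega> in M. \<phi> (\<lambda>s \<omega>'. indicator A \<omega>' * X s \<omega>') \<omega> = indicator A \<omega> * \<phi> X \<omega>"
  using monetary unfolding monetary_utility_def by blast

lemma phi_mono:
  "X \<in> R \<Longrightarrow> Y \<in> R \<Longrightarrow> AE \<omega> in M. \<forall>s. X s \<omega> \<le> Y s \<omega> \<Longrightarrow> AE \<omega> in M. \<phi> X \<omega> \<le> \<phi> Y \<omega>"
  using monetary unfolding monetary_utility_def by blast

lemma phi_shift:
  "X \<in> R \<Longrightarrow> k \<in> L \<Longrightarrow> AE \<omega> in M. \<phi> (\<lambda>s \<omega>'. X s \<omega>' + k \<omega>' * indicator {t..} s) \<omega> = \<phi> X \<omega> + k \<omega>"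
  using monetary unfolding monetary_utility_def by blast

text \<open>phi acts on functions, not on classes; monotonicity in both directions makes it respect
  almost sure equality.\<close>

lemma phi_cong:
  assumes "X \<in> R" "Y \<in> R" "AE \<omega> in M. \<forall>s. X s \<omega> = Y s \<omega>"
  shows "AE \<omega> in M. \<phi> X \<omega> = \<phi> Y \<omega>"
proof -
  have "AE \<omega> in M. \<phi> X \<omega> \<le> \<phi> Y \<omega>" by (rule phi_mono[OF assms(1,2)]) (use assms(3) in auto)
  moreover have "AE \<omega> in M. \<phi> Y \<omega> \<le> \<phi> X \<omega>" by (rule phi_mono[OF assms(2,1)]) (use assms(3) in auto)
  ultimately show ?thesis by eventually_elim simp
qed

text \<open>Locality at the empty event, where the right-hand side vanishes.\<close>

lemma phi_zero: "AE \<omega> in M. \<phi> (\<lambda>s \<omega>. 0) \<omega> = 0"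
  using phi_indicator[OF R_zero, of "{}"] by simp

lemma phi_bound:
  assumes X: "X \<in> R" and m: "AE \<omega> in M. \<forall>s. \<bar>X s \<omega>\<bar> \<le> m"
  shows "AE \<omega> in M. \<bar>\<phi> X \<omega>\<bar> \<le> m"
proof -
  have c: "AE \<omega> in M. \<phi> (\<lambda>s \<omega>. c * indicator {t..} s) \<omega> = c" for c
    using phi_shift[OF R_zero L_const[of c]] phi_zero by auto
  have XX: "\<bar>X s \<omega>\<bar> \<le> m * indicator {t..} s" if "\<forall>s. \<bar>X s \<omega>\<bar> \<le> m" for s \<omega>
    using that R_before[OF X, of s \<omega>] by (auto simp: indicator_def not_le)
  have "AE \<omega> in M. \<phi> X \<omega> \<le> \<phi> (\<lambda>s \<omega>. m * indicator {t..} s) \<omega>"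
  proof (rule phi_mono[OF X R_scale[OF one_R]])
    show "AE \<omega> in M. \<forall>s. X s \<omega> \<le> m * indicator {t..} s"
      using m by eventually_elim (use XX abs_le_D1 in blast)
  qed
  moreover have "AE \<omega> in M. \<phi> (\<lambda>s \<omega>. (- m) * indicator {t..} s) \<omega> \<le> \<phi> X \<omega>"
  proof (rule phi_mono[OF R_scale[OF one_R] X])
    show "AE \<omega> in M. \<forall>s. - m * indicator {t..} s \<le> X s \<omega>" using m
    proof eventually_elim
      case (elim \<omega>)
      show ?case
      proof
        fix s
        show "- m * indicator {t..} s \<le> X s \<omega>" using XX[OF elim, of s] by (simp add: abs_le_iff)
      qed
    qed
  qed
  ultimately show ?thesis using c[of m] c[of "- m"] by eventually_elim (auto simp: abs_le_iff)
qed

lemma phi_measurable: "X \<in> R \<Longrightarrow> \<phi> X \<in> borel_measurable M"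
  by (rule measurable_FM[OF L_measurable[OF phi_L order_refl]])

lemma phi_integrable: "X \<in> R \<Longrightarrow> integrable M (\<phi> X)"
proof -
  assume X: "X \<in> R"
  obtain m where "AE \<omega> in M. \<bar>\<phi> X \<omega>\<bar> \<le> m" using L_bound[OF phi_L[OF X]] by blast
  thus ?thesis using phi_measurable[OF X] by (intro integrable_const_bound[where B=m]) auto
qed

lemma R_paste:
  assumes "X \<in> R" "Y \<in> R" "A \<in> sets (F t)"
  shows "(\<lambda>s \<omega>. indicator A \<omega> * X s \<omega> + (1 - indicator A \<omega>) * Y s \<omega>) \<in> R"
  by (rule R_lincomb[OF assms(1,2) L_indicator[OF assms(3)] L_one_minus_indicator[OF assms(3)]])

text \<open>Locality is applied on \<open>A\<close> and on its complement: there the pasted process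
  agrees with X and with Y respectively.\<close>

lemma phi_paste:
  assumes X: "X \<in> R" and Y: "Y \<in> R" and A: "A \<in> sets (F t)"
  shows "AE \<omega> in M. \<phi> (\<lambda>s \<omega>. indicator A \<omega> * X s \<omega> + (1 - indicator A \<omega>) * Y s \<omega>) \<omega>
     = indicator A \<omega> * \<phi> X \<omega> + (1 - indicator A \<omega>) * \<phi> Y \<omega>"
proof -
  define Z where "Z = (\<lambda>s \<omega>. indicator A \<omega> * X s \<omega> + (1 - indicator A \<omega>) * Y s \<omega>)"
  define B where "B = space M - A"
  have B: "B \<in> sets (F t)" unfolding B_def space_F[of t, symmetric] using A by (rule sets.compl_sets)
  have Z: "Z \<in> R" unfolding Z_def by (rule R_paste[OF X Y A])
  have eqA: "(\<lambda>s \<omega>. indicator A \<omega> * Z s \<omega>) = (\<lambda>s \<omega>. indicator A \<omega> * X s \<omega>)"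
    by (auto simp: Z_def indicator_def fun_eq_iff)
  have eqB: "(\<lambda>s \<omega>. indicator B \<omega> * Z s \<omega>) = (\<lambda>s \<omega>. indicator B \<omega> * Y s \<omega>)"
    by (auto simp: Z_def B_def indicator_def fun_eq_iff)
  have "AE \<omega> in M. indicator A \<omega> * \<phi> Z \<omega> = indicator A \<omega> * \<phi> X \<omega>"
    using phi_indicator[OF Z A] phi_indicator[OF X A] unfolding eqA by eventually_elim auto
  moreover have "AE \<omega> in M. indicator B \<omega> * \<phi> Z \<omega> = indicator B \<omega> * \<phi> Y \<omega>"
    using phi_indicator[OF Z B] phi_indicator[OF Y B] unfolding eqB by eventually_elim auto
  ultimately have "AE \<omega> in M. \<phi> Z \<omega> = indicator A \<omega> * \<phi> X \<omega> + (1 - indicator A \<omega>) * \<phi> Y \<omega>"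
    using AE_space by eventually_elim (auto simp: indicator_def B_def split: if_splits)
  thus ?thesis by (simp add: Z_def)
qed

text \<open>An approximate supergradient: up to e, the expected pairing with a single scenario
  bounds every change of E phi from \<open>X0\<close>.\<close>

lemma exists_scenario:
  assumes X0: "X0 \<in> R" and e: "e > 0"
  shows "\<exists>a\<in>D. \<forall>Y\<in>R. (\<integral>\<omega>. \<phi> Y \<omega> \<partial>M) - (\<integral>\<omega>. \<phi> X0 \<omega> \<partial>M)
      \<le> e + ((\<integral>\<omega>. pair Y a \<omega> \<partial>M) - (\<integral>\<omega>. pair X0 a \<omega> \<partial>M))"
proof -
  interpret N: finite_measure opt by (rule opt_finite_measure)
  let ?V = "bounded_measurable opt"
  note V = linear_subspace_bounded_measurable[of opt]
  define X where "X H = (\<lambda>s \<omega>. X0 s \<omega> + opt_proc H s \<omega>)" for H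
  define f where "f H = (\<integral>\<omega>. \<phi> (X H) \<omega> \<partial>M)" for H
  define f0 where "f0 = (\<integral>\<omega>. \<phi> X0 \<omega> \<partial>M)"
  have XR: "X H \<in> R" if "H \<in> ?V" for H unfolding X_def by (rule R_add[OF X0 opt_proc_R[OF that]])
  have cV: "(\<lambda>x. c) \<in> ?V" for c by (rule bounded_measurableI[of _ _ "\<bar>c\<bar>"]) auto
  have X_0: "X (\<lambda>x. 0) = X0" by (simp add: X_def opt_proc_def)
  \<comment> \<open>Cash additivity in expectation. Constant amounts serve to move functions to the
    boundary of \<open>C\<close>, indicators of events of \<open>F t\<close> to find the conditional
    mass of the density.\<close>
  have shift: "f (\<lambda>x. H x + k (snd x)) = f H + (\<integral>\<omega>. k \<omega> \<partial>M)"
    if H: "H \<in> ?V" and k: "k \<in> L" for H k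
  proof -
    obtain mk where mk: "AE \<omega> in M. \<bar>k \<omega>\<bar> \<le> mk" using L_bound[OF k] by blast
    have ki: "integrable M k"
      using mk measurable_FM[OF L_measurable[OF k order_refl]] by (intro integrable_const_bound[where B=mk]) auto
    have eq: "X (\<lambda>x. H x + k (snd x)) = (\<lambda>s \<omega>. X H s \<omega> + k \<omega> * indicator {t..} s)"
      by (auto simp: X_def opt_proc_def fun_eq_iff indicator_def)
    have "f (\<lambda>x. H x + k (snd x)) = (\<integral>\<omega>. \<phi> (X H) \<omega> + k \<omega> \<partial>M)"
      unfolding f_def eq
      using phi_measurable[OF R_shift[OF XR[OF H] k]] phi_measurable[OF XR[OF H]] borel_measurable_integrable[OF ki]
      by (intro integral_cong_AE phi_shift[OF XR[OF H] k]) auto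
    thus ?thesis using phi_integrable[OF XR[OF H]] ki by (simp add: f_def)
  qed
  have shift_const: "f (\<lambda>x. H x + c) = f H + c" if "H \<in> ?V" for H c
    using shift[OF that L_const[of c]] by (simp add: prob_space)
  have fmono: "f H \<le> f G" if "H \<in> ?V" "G \<in> ?V" "AE x in opt. H x \<le> G x" for H G
    unfolding f_def
  proof (intro integral_mono_AE phi_integrable XR that phi_mono)
    show "AE \<omega> in M. \<forall>s. X H s \<omega> \<le> X G s \<omega>"
      using opt_proc_AE_mono[OF that(3)] by eventually_elim (auto simp: X_def)
  qed
  \<comment> \<open>The margin e keeps 0 outside, since f at 0 is f0; the constant e belongs to
    \<open>C\<close>, which is therefore nonempty.\<close>
  define C where "C = {H \<in> ?V. f0 + e \<le> f H}"
  have "\<exists>Z. Z \<in> borel_measurable opt \<and> (\<forall>x. 0 \<le> Z x) \<and> integrable opt Z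
      \<and> (\<forall>H\<in>C. 1 \<le> (\<integral>x. Z x * H x \<partial>opt))"
  proof (rule N.l1_strict_separation)
    show "C \<subseteq> ?V" by (auto simp: C_def)
    have "f (\<lambda>x. 0 + e) = f0 + e" using shift_const[OF cV[of 0], of e] X_0 by (simp add: f_def f0_def)
    hence "(\<lambda>x. e) \<in> C" using cV by (simp add: C_def)
    thus "C \<noteq> {}" by auto
    have "f (\<lambda>x. 0) = f0" by (simp add: f_def f0_def X_0)
    thus "(\<lambda>x. 0) \<notin> C" using e by (simp add: C_def)
  next
    fix H G and u :: real assume HG: "H \<in> C" "G \<in> C" and u: "0 \<le> u" "u \<le> 1"
    hence HV: "H \<in> ?V" and GV: "G \<in> ?V" by (auto simp: C_def)
    have UV: "(\<lambda>x. u * H x + (1 - u) * G x) \<in> ?V" by (rule linear_subspaceD(5)[OF V HV GV])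
    have eq: "X (\<lambda>x. u * H x + (1 - u) * G x) = (\<lambda>s \<omega>. u * X H s \<omega> + (1 - u) * X G s \<omega>)"
      by (auto simp: X_def opt_proc_def fun_eq_iff algebra_simps)
    have "AE \<omega> in M. u * \<phi> (X H) \<omega> + (1 - u) * \<phi> (X G) \<omega> \<le> \<phi> (X (\<lambda>x. u * H x + (1 - u) * G x)) \<omega>"
      unfolding eq
      using concave[unfolded concave_mu_def, rule_format, OF XR[OF HV] XR[OF GV] L_const[of u]] u by simp
    hence "(\<integral>\<omega>. u * \<phi> (X H) \<omega> + (1 - u) * \<phi> (X G) \<omega> \<partial>M) \<le> f (\<lambda>x. u * H x + (1 - u) * G x)"
      unfolding f_def using phi_integrable[OF XR[OF HV]] phi_integrable[OF XR[OF GV]] phi_integrable[OF XR[OF UV]]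
      by (intro integral_mono_AE) auto
    hence "u * f H + (1 - u) * f G \<le> f (\<lambda>x. u * H x + (1 - u) * G x)"
      using phi_integrable[OF XR[OF HV]] phi_integrable[OF XR[OF GV]] by (simp add: f_def)
    moreover have "u * (f0 + e) + (1 - u) * (f0 + e) \<le> u * f H + (1 - u) * f G"
      using HG u by (intro add_mono mult_left_mono) (auto simp: C_def)
    ultimately show "(\<lambda>x. u * H x + (1 - u) * G x) \<in> C" using UV by (simp add: C_def algebra_simps)
  next
    fix H G assume "H \<in> C" "G \<in> ?V" "AE x in opt. H x \<le> G x"
    thus "G \<in> C" using fmono[of H G] by (auto simp: C_def)
  next
    fix h :: "nat \<Rightarrow> nat \<times> 'a \<Rightarrow> real" and g m
    assume hC: "\<And>n. h n \<in> C" and hm: "\<And>n x. \<bar>h n x\<bar> \<le> m" and gV: "g \<in> ?V"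
      and lim: "AE x in opt. (\<lambda>n. h n x) \<longlonglongrightarrow> g x"
    have hV: "h n \<in> ?V" for n using hC by (simp add: C_def)
    \<comment> \<open>The upper envelopes of the tails decrease to g wherever h converges and
      dominate h, so monotonicity keeps f (K k) >= f0 + e. They supply the decreasing sequence that
      the continuity hypothesis asks for.\<close>
    define K where "K k x = (SUP j. h (j + k) x)" for k x
    have bdd: "bdd_above (range (\<lambda>j. h (j + k) x))" for k x
      by (rule bdd_aboveI2) (rule abs_le_D1[OF hm])
    have hK: "h (j + k) x \<le> K k x" for j k x unfolding K_def by (rule cSUP_upper[OF _ bdd]) simp
    have Kle: "K k x \<le> b" if "\<And>j. h (j + k) x \<le> b" for k x b unfolding K_def by (rule cSUP_least) (use that in auto)
    have Km: "\<bar>K k x\<bar> \<le> m" for k x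
    proof -
      have "h k x \<le> K k x" using hK[of 0 k x] by simp
      hence "- m \<le> K k x" using hm[of k x] by linarith
      moreover have "K k x \<le> m" by (rule Kle) (rule abs_le_D1[OF hm])
      ultimately show ?thesis by (simp add: abs_le_iff)
    qed
    have KV: "K k \<in> ?V" for k
    proof (rule bounded_measurableI[OF _ Km])
      show "K k \<in> borel_measurable opt" unfolding K_def
        using bounded_measurableD(1)[OF hV] bdd by (intro borel_measurable_cSUP) auto
    qed
    have Kdec: "K (Suc k) x \<le> K k x" for k x
      by (rule Kle) (use hK[of "Suc j" k x for j] in simp)
    have Klim: "(\<lambda>k. K k x) \<longlonglongrightarrow> g x" if l: "(\<lambda>n. h n x) \<longlonglongrightarrow> g x" for x
    proof (rule LIMSEQ_I)
      fix d :: real assume d: "0 < d"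
      obtain N where N: "\<And>n. n \<ge> N \<Longrightarrow> \<bar>h n x - g x\<bar> < d/2" using LIMSEQ_D[OF l, of "d/2"] d by auto
      have "norm (K k x - g x) < d" if k: "k \<ge> N" for k
      proof -
        have "K k x \<le> g x + d/2"
        proof (rule Kle)
          fix j
          have "\<bar>h (j + k) x - g x\<bar> < d/2" by (rule N) (use k in simp)
          thus "h (j + k) x \<le> g x + d/2" by linarith
        qed
        moreover have "g x - d/2 < K k x" using N[OF k] hK[of 0 k x] unfolding add_0 by linarith
        ultimately show ?thesis using d unfolding real_norm_def by linarith
      qed
      thus "\<exists>no. \<forall>n\<ge>no. norm (K n x - g x) < d" by blast
    qed
    have limM: "AE \<omega> in M. \<forall>s. (\<lambda>k. X (K k) s \<omega>) \<longlonglongrightarrow> X g s \<omega>"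
    proof -
      have "AE \<omega> in M. \<forall>s\<in>{t..T}. (\<lambda>n. h n (s, \<omega>)) \<longlonglongrightarrow> g (s, \<omega>)"
        by (rule AE_finite_allI) (use opt_AE[OF lim] in auto)
      thus ?thesis
      proof eventually_elim
        case (elim \<omega>)
        show ?case
        proof
          fix s
          have "(\<lambda>k. K k (min s T, \<omega>)) \<longlonglongrightarrow> g (min s T, \<omega>)" if "t \<le> s"
            by (rule Klim) (use elim that tT in auto)
          thus "(\<lambda>k. X (K k) s \<omega>) \<longlonglongrightarrow> X g s \<omega>"
            unfolding X_def opt_proc_def by (cases "t \<le> s") (auto intro!: tendsto_intros)
        qed
      qed
    qed
    have decM: "AE \<omega> in M. \<forall>k s. X (K (Suc k)) s \<omega> \<le> X (K k) s \<omega>"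
      using Kdec by (auto simp: X_def opt_proc_def intro!: AE_I2)
    have phi_lim: "AE \<omega> in M. (\<lambda>k. \<phi> (X (K k)) \<omega>) \<longlonglongrightarrow> \<phi> (X g) \<omega>"
      using continuous[unfolded cont_bdd_decr_def, rule_format, OF XR[OF gV], of "\<lambda>k. X (K k)"] XR[OF KV] decM limM
      by blast
    obtain m0 where m0: "AE \<omega> in M. \<forall>s. \<bar>X0 s \<omega>\<bar> \<le> m0" using R_bound[OF X0] by blast
    have m_nn: "0 \<le> m" using hm[of 0 undefined] by (meson abs_ge_zero order_trans)
    have phi_b: "AE \<omega> in M. norm (\<phi> (X (K k)) \<omega>) \<le> m0 + m" for k
    proof -
      have "AE \<omega> in M. \<bar>\<phi> (X (K k)) \<omega>\<bar> \<le> m0 + m"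
      proof (rule phi_bound[OF XR[OF KV]])
        show "AE \<omega> in M. \<forall>s. \<bar>X (K k) s \<omega>\<bar> \<le> m0 + m" using m0
        proof eventually_elim
          case (elim \<omega>)
          show ?case
          proof
            fix s
            have "\<bar>opt_proc (K k) s \<omega>\<bar> \<le> m" using Km m_nn by (simp add: opt_proc_def)
            thus "\<bar>X (K k) s \<omega>\<bar> \<le> m0 + m" using elim[rule_format, of s] unfolding X_def by linarith
          qed
        qed
      qed
      thus ?thesis by simp
    qed
    have "(\<lambda>k. f (K k)) \<longlonglongrightarrow> f g" unfolding f_def
      by (rule integral_dominated_convergence[where w="\<lambda>_. m0 + m"])
        (use phi_measurable[OF XR[OF gV]] phi_measurable[OF XR[OF KV]] phi_lim phi_b in auto)
    moreover have "f0 + e \<le> f (K k)" for k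
    proof -
      have "f (h k) \<le> f (K k)" by (rule fmono[OF hV KV]) (use hK[of 0 k] in auto)
      thus ?thesis using hC[of k] by (simp add: C_def)
    qed
    ultimately have "f0 + e \<le> f g" by (intro LIMSEQ_le_const) auto
    thus "g \<in> C" using gV by (simp add: C_def)
  qed
  then obtain Z where Z: "Z \<in> borel_measurable opt" "\<And>x. 0 \<le> Z x" "integrable opt Z"
    and ZC: "\<And>H. H \<in> C \<Longrightarrow> 1 \<le> (\<integral>x. Z x * H x \<partial>opt)" by blast
  have ZH: "integrable opt (\<lambda>x. Z x * H x)" if H: "H \<in> ?V" for H
  proof -
    obtain m where m: "\<forall>x. \<bar>H x\<bar> \<le> m" using bounded_measurableD(2)[OF H] by blast
    show ?thesis
    proof (rule Bochner_Integration.integrable_bound)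
      show "integrable opt (\<lambda>x. m * Z x)" using Z(3) by simp
      show "AE x in opt. norm (Z x * H x) \<le> norm (m * Z x)"
      proof (rule AE_I2)
        fix x
        have "\<bar>H x\<bar> \<le> \<bar>m\<bar>" using m[rule_format, of x] by linarith
        thus "norm (Z x * H x) \<le> norm (m * Z x)"
          by (simp add: abs_mult mult.commute mult_right_mono)
      qed
    qed (use Z(1) bounded_measurableD(1)[OF H] in measurable)
  qed
  define c where "c = (\<integral>x. Z x \<partial>opt)"
  \<comment> \<open>Adding the constant f0 + e - f H moves any H to the boundary of
    \<open>C\<close>, so the separation inequality becomes one for all bounded H.\<close>
  have key: "(f H - f0 - e) * c + 1 \<le> (\<integral>x. Z x * H x \<partial>opt)" if H: "H \<in> ?V" for H
  proof -
    have HV: "(\<lambda>x. H x + (f0 + e - f H)) \<in> ?V" using linear_subspaceD(1)[OF V H cV] .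
    have "(\<lambda>x. H x + (f0 + e - f H)) \<in> C" using HV shift_const[OF H, of "f0 + e - f H"] by (simp add: C_def)
    from ZC[OF this] have "1 \<le> (\<integral>x. Z x * H x + (f0 + e - f H) * Z x \<partial>opt)" by (simp add: algebra_simps)
    also have "\<dots> = (\<integral>x. Z x * H x \<partial>opt) + (f0 + e - f H) * c" using ZH[OF H] Z(3) by (simp add: c_def)
    finally show ?thesis by (simp add: algebra_simps)
  qed
  \<comment> \<open>H = 0 in \<open>key\<close> gives 1 <= e c, so the density can be normalised by
    its mass c.\<close>
  have cpos: "0 < c"
  proof -
    have "(f (\<lambda>x. 0) - f0 - e) * c + 1 \<le> 0" using key[OF cV[of 0]] by simp
    hence "1 \<le> e * c" by (simp add: f_def f0_def X_0)
    thus ?thesis using e by (meson less_le_trans zero_less_mult_pos zero_less_one)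
  qed
  define Z' where "Z' x = Z x / c" for x
  have Z': "integrable opt Z'" "\<And>x. 0 \<le> Z' x" using Z cpos by (auto simp: Z'_def[abs_def])
  have key': "f H - f0 \<le> e + (\<Sum>s\<in>{t..T}. \<integral>\<omega>. Z' (s, \<omega>) * H (s, \<omega>) \<partial>M)" if H: "H \<in> ?V" for H
  proof -
    have "(f H - f0 - e) * c \<le> (\<integral>x. Z x * H x \<partial>opt)" using key[OF H] by simp
    hence "f H - f0 - e \<le> (\<integral>x. Z x * H x \<partial>opt) / c" using cpos by (simp add: pos_le_divide_eq)
    also have "\<dots> = (\<integral>x. Z' x * H x \<partial>opt)" by (simp add: Z'_def)
    also have "\<dots> = (\<Sum>s\<in>{t..T}. \<integral>\<omega>. Z' (s, \<omega>) * H (s, \<omega>) \<partial>M)"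
      using opt_integral(2)[of "\<lambda>x. Z' x * H x"] ZH[OF H] by (simp add: Z'_def)
    finally show ?thesis by simp
  qed
  define a where "a = scenario Z'"
  have aD: "a \<in> D" unfolding a_def
  proof (rule scenario_D[OF Z'])
    fix A assume A: "A \<in> sets (F t)"
    define S where "S = (\<Sum>s\<in>{t..T}. \<integral>\<omega>. Z' (s, \<omega>) * indicator A \<omega> \<partial>M)"
    have AM: "A \<in> sets M" using A sub[of t] by (auto simp: subalgebra_def)
    \<comment> \<open>Tested at r times the indicator of \<open>A\<close>, the inequality bounds a
      linear function of r above for every real r, positive or negative. Its slope, the defect of
      mass on \<open>A\<close>, must be 0.\<close>
    have le: "r * (measure M A - S) \<le> e" for r
    proof -
      have kL: "(\<lambda>\<omega>. r * indicator A \<omega>) \<in> L"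
        using A by (auto simp: Linf_def indicator_def intro!: exI[of _ "\<bar>r\<bar>"])
      have HV: "(\<lambda>x. r * indicator A (snd x)) \<in> ?V"
      proof (rule bounded_measurableI)
        show "(\<lambda>x. r * indicator A (snd x)) \<in> borel_measurable opt"
          unfolding opt_measurable_iff using L_measurable[OF kL] by simp
        show "\<bar>r * indicator A (snd x)\<bar> \<le> \<bar>r\<bar>" for x :: "nat \<times> 'a" by (auto simp: indicator_def)
      qed
      have "f (\<lambda>x. 0 + r * indicator A (snd x)) = f (\<lambda>x. 0) + (\<integral>\<omega>. r * indicator A \<omega> \<partial>M)"
        by (rule shift[OF cV kL])
      hence "f (\<lambda>x. r * indicator A (snd x)) - f0 = r * measure M A"
        using AM by (simp add: f_def f0_def X_0)
      moreover have "(\<Sum>s\<in>{t..T}. \<integral>\<omega>. Z' (s, \<omega>) * (r * indicator A \<omega>) \<partial>M) = r * S"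
        unfolding S_def sum_distrib_left by (intro sum.cong refl) (simp add: mult.left_commute)
      ultimately show ?thesis using key'[OF HV] by (simp add: algebra_simps)
    qed
    have "measure M A - S = 0"
    proof (rule ccontr)
      assume ne: "measure M A - S \<noteq> 0"
      have "((e + 1) / (measure M A - S)) * (measure M A - S) \<le> e" by (rule le)
      thus False using ne by simp
    qed
    thus "S = measure M A" unfolding S_def by simp
  qed
  have "(\<integral>\<omega>. \<phi> Y \<omega> \<partial>M) - f0 \<le> e + ((\<integral>\<omega>. pair Y a \<omega> \<partial>M) - (\<integral>\<omega>. pair X0 a \<omega> \<partial>M))" if Y: "Y \<in> R" for Y
  proof -
    define Q where "Q = (\<lambda>s \<omega>. 1 * Y s \<omega> + - 1 * X0 s \<omega>)"
    have QR: "Q \<in> R" unfolding Q_def by (rule R_lincomb[OF Y X0 L_const L_const])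
    obtain m where m: "m \<ge> 0" "AE \<omega> in M. \<forall>s. \<bar>Q s \<omega>\<bar> \<le> m" using R_bound[OF QR] by blast
    \<comment> \<open>The process Q is bounded only almost surely, while
      \<open>bounded_measurable\<close> asks for a bound at every point; clipping changes it only on
      a null set.\<close>
    define H where "H x = max (- m) (min m (Q (fst x) (snd x)))" for x
    have HV: "H \<in> ?V"
    proof (rule bounded_measurableI)
      show "H \<in> borel_measurable opt"
        unfolding opt_measurable_iff H_def using R_measurable[OF QR] by simp
      show "\<bar>H x\<bar> \<le> m" for x using m(1) by (auto simp: H_def)
    qed
    have HQ: "AE \<omega> in M. \<forall>s. H (s, \<omega>) = Q s \<omega>"
      using m(2)
    proof eventually_elim
      case (elim \<omega>)
      show ?case
      proof
        fix s show "H (s, \<omega>) = Q s \<omega>" using elim[rule_format, of s] by (auto simp: H_def abs_le_iff)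
      qed
    qed
    have "AE \<omega> in M. \<forall>s. X H s \<omega> = Y s \<omega>"
      using HQ
    proof eventually_elim
      case (elim \<omega>)
      show ?case
      proof
        fix s
        have "opt_proc H s \<omega> = Q s \<omega>"
          using elim R_before[OF QR, of s \<omega>] R_after[OF QR, of s \<omega>] by (auto simp: opt_proc_def not_le)
        thus "X H s \<omega> = Y s \<omega>" by (simp add: X_def Q_def)
      qed
    qed
    hence "AE \<omega> in M. \<phi> (X H) \<omega> = \<phi> Y \<omega>" by (rule phi_cong[OF XR[OF HV] Y])
    hence "f H = (\<integral>\<omega>. \<phi> Y \<omega> \<partial>M)" unfolding f_def
      by (intro integral_cong_AE phi_measurable XR HV Y)
    moreover have "(\<integral>\<omega>. Z' (s, \<omega>) * H (s, \<omega>) \<partial>M)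
        = (\<integral>\<omega>. Y s \<omega> * delta a s \<omega> \<partial>M) - (\<integral>\<omega>. X0 s \<omega> * delta a s \<omega> \<partial>M)" if s: "s \<in> {t..T}" for s
    proof -
      have "(\<integral>\<omega>. Z' (s, \<omega>) * H (s, \<omega>) \<partial>M) = (\<integral>\<omega>. Y s \<omega> * delta a s \<omega> - X0 s \<omega> * delta a s \<omega> \<partial>M)"
      proof (rule integral_cong_AE)
        have "integrable opt (\<lambda>x. Z' x * H x)" using ZH[OF HV] by (simp add: Z'_def)
        from opt_integral(1)[OF this s] show "(\<lambda>\<omega>. Z' (s, \<omega>) * H (s, \<omega>)) \<in> borel_measurable M" by auto
        show "(\<lambda>\<omega>. Y s \<omega> * delta a s \<omega> - X0 s \<omega> * delta a s \<omega>) \<in> borel_measurable M"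
          using R_delta_integrable[OF aD Y s] R_delta_integrable[OF aD X0 s] by (intro borel_measurable_diff) auto
        show "AE \<omega> in M. Z' (s, \<omega>) * H (s, \<omega>) = Y s \<omega> * delta a s \<omega> - X0 s \<omega> * delta a s \<omega>"
          using HQ
        proof eventually_elim
          case (elim \<omega>)
          hence "H (s, \<omega>) = Y s \<omega> - X0 s \<omega>" by (simp add: Q_def)
          thus ?case using s by (simp add: a_def delta_scenario right_diff_distrib mult.commute)
        qed
      qed
      thus ?thesis using R_delta_integrable[OF aD Y s] R_delta_integrable[OF aD X0 s] by simp
    qed
    hence "(\<Sum>s\<in>{t..T}. \<integral>\<omega>. Z' (s, \<omega>) * H (s, \<omega>) \<partial>M)
        = (\<integral>\<omega>. pair Y a \<omega> \<partial>M) - (\<integral>\<omega>. pair X0 a \<omega> \<partial>M)"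
      unfolding pair_integral(2)[OF aD Y] pair_integral(2)[OF aD X0] by (simp add: sum_subtractf)
    ultimately show ?thesis using key'[OF HV] by simp
  qed
  thus ?thesis using aD unfolding f0_def by blast
qed

end

section \<open>Dual representation\<close>

context concave_utility
begin

abbreviation "acc \<equiv> acceptance_set M F t T \<phi>"
abbreviation "sharp \<equiv> phi_sharp M F t T \<phi>"

lemma sharp_ess_inf:
  "is_ess_inf M ((\<lambda>X \<omega>. ereal (pair X a \<omega>)) ` acc) (sharp a)"
  unfolding phi_sharp_def by (rule ess_inf_countable(1)) auto

lemma sharp_measurable: "sharp a \<in> borel_measurable M"
  using sharp_ess_inf unfolding is_ess_inf_def by blast

text \<open>Subtracting its own utility makes any position acceptable, so an infimum over acceptable
  positions can be tested at arbitrary ones.\<close>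

lemma normalized_acc:
  assumes X: "X \<in> R"
  shows "(\<lambda>s \<omega>. X s \<omega> + - \<phi> X \<omega> * indicator {t..} s) \<in> acc"
    and "a \<in> D \<Longrightarrow> AE \<omega> in M. pair (\<lambda>s \<omega>. X s \<omega> + - \<phi> X \<omega> * indicator {t..} s) a \<omega> = pair X a \<omega> - \<phi> X \<omega>"
proof -
  note k = L_uminus[OF phi_L[OF X]]
  show "(\<lambda>s \<omega>. X s \<omega> + - \<phi> X \<omega> * indicator {t..} s) \<in> acc"
    using R_shift[OF X k] phi_shift[OF X k] by (auto simp: acceptance_set_def)
  show "AE \<omega> in M. pair (\<lambda>s \<omega>. X s \<omega> + - \<phi> X \<omega> * indicator {t..} s) a \<omega> = pair X a \<omega> - \<phi> X \<omega>" if "a \<in> D"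
    using pair_shift[OF that X k] by simp
qed

lemma fenchel_young:
  assumes a: "a \<in> D" and X: "X \<in> R"
  shows "AE \<omega> in M. sharp a \<omega> \<le> ereal (pair X a \<omega> - \<phi> X \<omega>)"
proof -
  have "AE \<omega> in M. sharp a \<omega> \<le> ereal (pair (\<lambda>s \<omega>. X s \<omega> + - \<phi> X \<omega> * indicator {t..} s) a \<omega>)"
    by (rule is_ess_inf_lower[OF sharp_ess_inf imageI[OF normalized_acc(1)[OF X]]])
  thus ?thesis using normalized_acc(2)[OF X a] by eventually_elim simp
qed

text \<open>Acceptable positions may be pasted along events of \<open>F t\<close>, so the essential infimum \<open>sharp a\<close> is a
  decreasing limit of pairings; this lets the expectation bound pass to it.\<close>

lemma dual_gap:
  assumes X0: "X0 \<in> R" and e: "e > 0"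
  shows "\<exists>a\<in>D. \<exists>g\<in>borel_measurable M. (\<integral>\<^sup>+\<omega>. g \<omega> \<partial>M) \<le> ennreal e \<and>
    (AE \<omega> in M. \<forall>d>0. g \<omega> < ennreal d \<longrightarrow> ereal (pair X0 a \<omega> - \<phi> X0 \<omega> - d) \<le> sharp a \<omega>)"
proof -
  obtain a where a: "a \<in> D" and gap: "\<And>Y. Y \<in> R \<Longrightarrow> (\<integral>\<omega>. \<phi> Y \<omega> \<partial>M) - (\<integral>\<omega>. \<phi> X0 \<omega> \<partial>M)
      \<le> e + ((\<integral>\<omega>. pair Y a \<omega> \<partial>M) - (\<integral>\<omega>. pair X0 a \<omega> \<partial>M))"
    using exists_scenario[OF X0 e] by blast
  have "\<exists>S'\<subseteq>(\<lambda>X \<omega>. ereal (pair X a \<omega>)) ` acc. countable S' \<and> (AE \<omega> in M. sharp a \<omega> = (INF f\<in>S'. f \<omega>))"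
    unfolding phi_sharp_def by (rule ess_inf_countable(2)) auto
  then obtain S' where S': "S' \<subseteq> (\<lambda>X \<omega>. ereal (pair X a \<omega>)) ` acc" "countable S'"
    and sharpS': "AE \<omega> in M. sharp a \<omega> = (INF f\<in>S'. f \<omega>)" by (elim exE conjE)
  obtain C where C: "countable C" "C \<subseteq> acc" "S' = (\<lambda>X \<omega>. ereal (pair X a \<omega>)) ` C"
    using countable_subset_image[of S' "\<lambda>X \<omega>. ereal (pair X a \<omega>)" acc] S' by auto
  note sharpC = sharpS'[unfolded C(3)]
  define Y0 where "Y0 = (\<lambda>s \<omega>. X0 s \<omega> + - \<phi> X0 \<omega> * indicator {t..} s)"
  have Y0: "Y0 \<in> acc" unfolding Y0_def by (rule normalized_acc(1)[OF X0])
  \<comment> \<open>\<open>Y0\<close> is added so that the enumerated set is nonempty and has an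
    enumeration by all natural numbers even if C is empty or finite.\<close>
  define Y where "Y = from_nat_into (insert Y0 C)"
  have Yacc: "Y k \<in> acc" for k
    using from_nat_into[of "insert Y0 C" k] Y0 C(2) by (auto simp: Y_def)
  have CY: "\<exists>k. X = Y k" if "X \<in> C" for X
    using from_nat_into_surj[of "insert Y0 C" X] C(1) that by (auto simp: Y_def)
  define A where "A k Q = {\<omega> \<in> space M. pair (Y k) a \<omega> < pair Q a \<omega>}" for k Q
  have A: "A k Q \<in> sets (F t)" for k Q
  proof -
    have [measurable]: "pair (Y k) a \<in> borel_measurable (F t)" "pair Q a \<in> borel_measurable (F t)"
      by (rule pair_measurable_F)+
    have "{\<omega> \<in> space (F t). pair (Y k) a \<omega> < pair Q a \<omega>} \<in> sets (F t)" by measurable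
    thus ?thesis by (simp add: A_def space_F)
  qed
  \<comment> \<open>Running minima: on the event where Y k pairs to less than the current position,
    switch to Y k. The event lies in \<open>F t\<close>, so locality keeps the result
    acceptable.\<close>
  define P where "P = rec_nat Y0 (\<lambda>k Q s \<omega>. indicator (A k Q) \<omega> * Y k s \<omega> + (1 - indicator (A k Q) \<omega>) * Q s \<omega>)"
  have P0: "P 0 = Y0" by (simp add: P_def)
  have PSuc: "P (Suc k) = (\<lambda>s \<omega>. indicator (A k (P k)) \<omega> * Y k s \<omega> + (1 - indicator (A k (P k)) \<omega>) * P k s \<omega>)" for k
    by (simp add: P_def)
  have accR: "Q \<in> R" "AE \<omega> in M. 0 \<le> \<phi> Q \<omega>" if "Q \<in> acc" for Q using that by (auto simp: acceptance_set_def)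
  have Pacc: "P k \<in> acc" for k
  proof (induction k)
    case 0
    show ?case using Y0 by (simp add: P0)
  next
    case (Suc k)
    have "P (Suc k) \<in> R" unfolding PSuc by (rule R_paste[OF accR(1)[OF Yacc] accR(1)[OF Suc] A])
    moreover have "AE \<omega> in M. 0 \<le> \<phi> (P (Suc k)) \<omega>"
      using phi_paste[OF accR(1)[OF Yacc[of k]] accR(1)[OF Suc] A[of k "P k"]] accR(2)[OF Yacc[of k]] accR(2)[OF Suc]
      unfolding PSuc by eventually_elim (auto simp: indicator_def)
    ultimately show ?case by (simp add: acceptance_set_def)
  qed
  have Pmin: "AE \<omega> in M. pair (P (Suc k)) a \<omega> = min (pair (Y k) a \<omega>) (pair (P k) a \<omega>)" for k
    using pair_lincomb[OF a accR(1)[OF Yacc[of k]] accR(1)[OF Pacc[of k]]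
        L_indicator[OF A[of k "P k"]] L_one_minus_indicator[OF A[of k "P k"]]] AE_space
    unfolding PSuc by eventually_elim (auto simp: indicator_def A_def min_def not_less split: if_splits)
  have Pmin': "AE \<omega> in M. \<forall>k. pair (P (Suc k)) a \<omega> = min (pair (Y k) a \<omega>) (pair (P k) a \<omega>)"
    using Pmin by (simp add: AE_all_countable)
  have Pdec: "AE \<omega> in M. \<forall>k. pair (P k) a \<omega> \<le> pair (P 0) a \<omega>" using Pmin'
  proof eventually_elim
    case (elim \<omega>)
    show ?case
    proof
      fix k show "pair (P k) a \<omega> \<le> pair (P 0) a \<omega>" by (induction k) (use elim in auto)
    qed
  qed
  have pP0: "AE \<omega> in M. pair (P 0) a \<omega> = pair X0 a \<omega> - \<phi> X0 \<omega>"
    using normalized_acc(2)[OF X0 a] by (simp add: P0 Y0_def)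
  have Pint: "integrable M (pair (P k) a)" for k by (rule pair_integral(1)[OF a accR(1)[OF Pacc]])
  \<comment> \<open>The supergradient bound at P k together with E phi (P k) >= 0. The starting
    position pairs to the pairing of \<open>X0\<close> minus its utility.\<close>
  have Pgap: "(\<integral>\<omega>. pair (P 0) a \<omega> - pair (P k) a \<omega> \<partial>M) \<le> e" for k
  proof -
    have "0 \<le> (\<integral>\<omega>. \<phi> (P k) \<omega> \<partial>M)" using accR(2)[OF Pacc] by (rule integral_nonneg_AE)
    moreover have "(\<integral>\<omega>. pair (P 0) a \<omega> \<partial>M) = (\<integral>\<omega>. pair X0 a \<omega> - \<phi> X0 \<omega> \<partial>M)"
      using phi_measurable[OF X0] by (intro integral_cong_AE pP0) auto
    moreover have "\<dots> = (\<integral>\<omega>. pair X0 a \<omega> \<partial>M) - (\<integral>\<omega>. \<phi> X0 \<omega> \<partial>M)"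
      using pair_integral(1)[OF a X0] phi_integrable[OF X0] by simp
    ultimately show ?thesis using gap[OF accR(1)[OF Pacc[of k]]] Pint by simp
  qed
  \<comment> \<open>The total drop of the running minima, with expectation at most e by monotone
    convergence. Where g < d, no position of the countable family pairs to less than the starting
    value minus d.\<close>
  define g where "g \<omega> = (SUP k. ennreal (pair (P 0) a \<omega> - pair (P k) a \<omega>))" for \<omega>
  have gm: "g \<in> borel_measurable M" unfolding g_def by measurable
  have "(\<integral>\<^sup>+\<omega>. g \<omega> \<partial>M) = (SUP k. \<integral>\<^sup>+\<omega>. ennreal (pair (P 0) a \<omega> - pair (P k) a \<omega>) \<partial>M)"
    unfolding g_def
  proof (rule nn_integral_monotone_convergence_SUP_AE)
    show "AE \<omega> in M. ennreal (pair (P 0) a \<omega> - pair (P k) a \<omega>) \<le> ennreal (pair (P 0) a \<omega> - pair (P (Suc k)) a \<omega>)" for k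
      using Pmin[of k] by eventually_elim (auto intro!: ennreal_leI)
  qed measurable
  also have "\<dots> \<le> ennreal e"
  proof (rule SUP_least)
    fix k
    have "(\<integral>\<^sup>+\<omega>. ennreal (pair (P 0) a \<omega> - pair (P k) a \<omega>) \<partial>M) = ennreal (\<integral>\<omega>. pair (P 0) a \<omega> - pair (P k) a \<omega> \<partial>M)"
      by (rule nn_integral_eq_integral) (use Pint Pdec in auto)
    also have "\<dots> \<le> ennreal e" by (rule ennreal_leI[OF Pgap])
    finally show "(\<integral>\<^sup>+\<omega>. ennreal (pair (P 0) a \<omega> - pair (P k) a \<omega>) \<partial>M) \<le> ennreal e" .
  qed
  finally have gint: "(\<integral>\<^sup>+\<omega>. g \<omega> \<partial>M) \<le> ennreal e" .
  have "AE \<omega> in M. \<forall>d>0. g \<omega> < ennreal d \<longrightarrow> ereal (pair X0 a \<omega> - \<phi> X0 \<omega> - d) \<le> sharp a \<omega>"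
    using sharpC pP0 Pmin'
  proof eventually_elim
    case (elim \<omega>)
    show ?case
    proof (intro allI impI)
      fix d :: real assume d: "0 < d" "g \<omega> < ennreal d"
      have "ereal (pair X0 a \<omega> - \<phi> X0 \<omega> - d) \<le> ereal (pair X a \<omega>)" if X: "X \<in> C" for X
      proof -
        obtain k where k: "X = Y k" using CY[OF X] by blast
        have "ennreal (pair (P 0) a \<omega> - pair (P (Suc k)) a \<omega>) \<le> g \<omega>"
          unfolding g_def by (rule SUP_upper) simp
        hence "ennreal (pair (P 0) a \<omega> - pair (P (Suc k)) a \<omega>) < ennreal d" using d(2) by (rule le_less_trans)
        hence "pair (P 0) a \<omega> - pair (P (Suc k)) a \<omega> < d" by (rule contrapos_pp) (simp add: not_less ennreal_leI)
        moreover have "pair (P (Suc k)) a \<omega> \<le> pair (Y k) a \<omega>" using elim(3)[rule_format, of k] by simp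
        ultimately show ?thesis using elim(2) k by simp
      qed
      thus "ereal (pair X0 a \<omega> - \<phi> X0 \<omega> - d) \<le> sharp a \<omega>" unfolding elim(1) by (auto intro: INF_greatest)
    qed
  qed
  thus ?thesis using a gm gint by blast
qed

text \<open>Stated for an arbitrary common bound W, so that the essential supremum over scenarios
  can be inserted directly. The opposite bound is \<open>fenchel_young\<close>.\<close>

theorem dual_representation:
  assumes X0: "X0 \<in> R"
    and W: "\<And>a. a \<in> D \<Longrightarrow> AE \<omega> in M. ereal (- pair X0 a \<omega>) + sharp a \<omega> \<le> W \<omega>"
  shows "AE \<omega> in M. ereal (- \<phi> X0 \<omega>) \<le> W \<omega>"
proof -
  define Q where "Q n a g \<longleftrightarrow> a \<in> D \<and> g \<in> borel_measurable M \<and> (\<integral>\<^sup>+\<omega>. g \<omega> \<partial>M) \<le> ennreal (1 / real (Suc n)) \<and>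
    (AE \<omega> in M. \<forall>d>0. g \<omega> < ennreal d \<longrightarrow> ereal (pair X0 a \<omega> - \<phi> X0 \<omega> - d) \<le> sharp a \<omega>)" for n a g
  have "\<exists>a g. Q n a g" for n
    unfolding Q_def using dual_gap[OF X0, of "1 / real (Suc n)"] by auto
  then obtain a g where Q: "\<And>n. Q n (a n) (g n)" by metis
  have a: "\<And>n. a n \<in> D" and gm[measurable]: "\<And>n. g n \<in> borel_measurable M"
    and gint: "\<And>n. (\<integral>\<^sup>+\<omega>. g n \<omega> \<partial>M) \<le> ennreal (1 / real (Suc n))"
    and gap: "\<And>n. AE \<omega> in M. \<forall>d>0. g n \<omega> < ennreal d \<longrightarrow> ereal (pair X0 (a n) \<omega> - \<phi> X0 \<omega> - d) \<le> sharp (a n) \<omega>"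
    using Q unfolding Q_def by auto
  have "(\<integral>\<^sup>+\<omega>. (INF n. g n \<omega>) \<partial>M) \<le> ennreal (1 / real (Suc n))" for n
  proof -
    have "(\<integral>\<^sup>+\<omega>. (INF n. g n \<omega>) \<partial>M) \<le> (\<integral>\<^sup>+\<omega>. g n \<omega> \<partial>M)" by (intro nn_integral_mono INF_lower) auto
    thus ?thesis using gint[of n] by (rule order_trans)
  qed
  moreover have "(\<lambda>n. ennreal (1 / real (Suc n))) \<longlonglongrightarrow> ennreal 0"
    by (intro tendsto_ennrealI LIMSEQ_inverse_real_of_nat[unfolded inverse_eq_divide])
  ultimately have "(\<integral>\<^sup>+\<omega>. (INF n. g n \<omega>) \<partial>M) \<le> ennreal 0" by (intro LIMSEQ_le_const) auto
  hence "(\<integral>\<^sup>+\<omega>. (INF n. g n \<omega>) \<partial>M) = 0" by simp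
  \<comment> \<open>At almost every point some scenario of the sequence has arbitrarily small gap.
    Which one may depend on the point, since W dominates the whole sequence simultaneously.\<close>
  hence inf0: "AE \<omega> in M. (INF n. g n \<omega>) = 0" by (subst (asm) nn_integral_0_iff_AE) auto
  have gap': "AE \<omega> in M. \<forall>n. \<forall>d>0. g n \<omega> < ennreal d \<longrightarrow> ereal (pair X0 (a n) \<omega> - \<phi> X0 \<omega> - d) \<le> sharp (a n) \<omega>"
    using gap by (simp add: AE_all_countable)
  have W': "AE \<omega> in M. \<forall>n. ereal (- pair X0 (a n) \<omega>) + sharp (a n) \<omega> \<le> W \<omega>"
    using W[OF a] by (simp add: AE_all_countable)
  show ?thesis using inf0 gap' W'
  proof eventually_elim
    case (elim \<omega>)
    show ?case
    proof (rule ereal_le_epsilon2)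
      fix d :: real assume d: "0 < d"
      have "(INF n. g n \<omega>) < ennreal d" using elim(1) d by simp
      then obtain n where "g n \<omega> < ennreal d" by (auto simp: INF_less_iff)
      hence "ereal (pair X0 (a n) \<omega> - \<phi> X0 \<omega> - d) \<le> sharp (a n) \<omega>" using elim(2) d by blast
      hence "ereal (- pair X0 (a n) \<omega>) + ereal (pair X0 (a n) \<omega> - \<phi> X0 \<omega> - d) \<le> ereal (- pair X0 (a n) \<omega>) + sharp (a n) \<omega>"
        by (rule add_left_mono)
      also have "\<dots> \<le> W \<omega>" using elim(3) by blast
      finally have "ereal (- \<phi> X0 \<omega> - d) \<le> W \<omega>" by simp
      hence "ereal (- \<phi> X0 \<omega> - d) + ereal d \<le> W \<omega> + ereal d" by (rule add_right_mono)
      thus "ereal (- \<phi> X0 \<omega>) \<le> W \<omega> + ereal d" by simp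
    qed
  qed
qed

end

section \<open>Worst case portfolios\<close>

context filtered_space
begin

lemma R_path_measurable:
  assumes "X \<in> R"
  shows "(\<lambda>\<omega>. \<lambda>s\<in>{t..T}. X s \<omega>) \<in> measurable M (PiM {t..T} (\<lambda>_. borel))"
  by (rule measurable_restrict) (rule measurable_FM[OF R_measurable[OF assms]])

text \<open>A bound is a measurable property of the path on t to T, hence determined by the law. The
  absolute value covers the times before t, where Y is 0.\<close>

lemma same_law_bound:
  assumes X: "X \<in> R" and Y: "Y \<in> R" and law: "same_law M t T Y X"
    and m: "AE \<omega> in M. \<forall>s. \<bar>X s \<omega>\<bar> \<le> m"
  shows "AE \<omega> in M. \<forall>s. \<bar>Y s \<omega>\<bar> \<le> \<bar>m\<bar>"
proof -
  let ?P = "PiM {t..T} (\<lambda>_. borel :: real measure)"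
  have S: "{x \<in> space ?P. \<forall>s\<in>{t..T}. \<bar>x s\<bar> \<le> m} \<in> sets ?P"
    by measurable
  have "AE x in law_tT M t T X. \<forall>s\<in>{t..T}. \<bar>x s\<bar> \<le> m"
    unfolding law_tT_def AE_distr_iff[OF R_path_measurable[OF X] S]
    using m by eventually_elim auto
  hence "AE x in law_tT M t T Y. \<forall>s\<in>{t..T}. \<bar>x s\<bar> \<le> m" unfolding law[unfolded same_law_def] .
  hence "AE \<omega> in M. \<forall>s\<in>{t..T}. \<bar>Y s \<omega>\<bar> \<le> m"
    unfolding law_tT_def AE_distr_iff[OF R_path_measurable[OF Y] S] by eventually_elim auto
  thus ?thesis
  proof eventually_elim
    case (elim \<omega>)
    show ?case
    proof
      fix s
      show "\<bar>Y s \<omega>\<bar> \<le> \<bar>m\<bar>"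
      proof (cases "t \<le> s")
        case True
        hence "\<bar>Y (min s T) \<omega>\<bar> \<le> m" using elim tT by auto
        thus ?thesis using R_after[OF Y True, of \<omega>] by linarith
      qed (use R_before[OF Y, of s \<omega>] in auto)
    qed
  qed
qed

abbreviation "Psi \<equiv> Psi_a M F t T"

lemma Psi_ess_sup:
  "is_ess_sup M ((\<lambda>Y \<omega>. ereal (pair Y a \<omega>)) ` {Y \<in> R. same_law M t T Y X}) (Psi a X)"
  unfolding Psi_a_def by (rule ess_sup) auto

lemma Psi_upper:
  assumes "Y \<in> R" "same_law M t T Y X"
  shows "AE \<omega> in M. ereal (pair Y a \<omega>) \<le> Psi a X \<omega>"
  by (rule is_ess_sup_upper[OF Psi_ess_sup imageI]) (use assms in simp)

lemma Psi_countable: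
  "\<exists>C\<subseteq>{Y \<in> R. same_law M t T Y X}. countable C \<and> (AE \<omega> in M. Psi a X \<omega> = (SUP Y\<in>C. ereal (pair Y a \<omega>)))"
proof -
  let ?f = "\<lambda>Y \<omega>. ereal (pair Y a \<omega>)" and ?A = "{Y \<in> R. same_law M t T Y X}"
  have "\<exists>S'\<subseteq>?f ` ?A. countable S' \<and> (AE \<omega> in M. Psi a X \<omega> = (SUP f\<in>S'. f \<omega>))"
    unfolding Psi_a_def by (rule ess_sup_countable) auto
  then obtain S' where S': "S' \<subseteq> ?f ` ?A" "countable S'" "AE \<omega> in M. Psi a X \<omega> = (SUP f\<in>S'. f \<omega>)"
    by (elim exE conjE)
  obtain C where C: "countable C" "C \<subseteq> ?A" "S' = ?f ` C"
    using countable_subset_image[of S' ?f ?A] S' by auto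
  have "AE \<omega> in M. Psi a X \<omega> = (SUP Y\<in>C. ereal (pair Y a \<omega>))"
    using S'(3) unfolding C(3) by (simp add: image_image)
  thus ?thesis using C(1,2) by blast
qed

text \<open>Finiteness lets the sum of the Psi be computed in the reals and gives each Psi
  near-maximisers. The upper bound comes from the common bound of all rearrangements, the lower one
  from X itself.\<close>

lemma Psi_finite:
  assumes a: "a \<in> D" and X: "X \<in> R"
  shows "AE \<omega> in M. \<bar>Psi a X \<omega>\<bar> \<noteq> \<infinity>"
proof -
  obtain m where m: "AE \<omega> in M. \<forall>s. \<bar>X s \<omega>\<bar> \<le> m" using R_bound[OF X] by blast
  have "AE \<omega> in M. Psi a X \<omega> \<le> ereal \<bar>m\<bar>"
  proof (rule is_ess_sup_least[OF Psi_ess_sup])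
    fix f assume "f \<in> (\<lambda>Y \<omega>. ereal (pair Y a \<omega>)) ` {Y \<in> R. same_law M t T Y X}"
    then obtain Y where Y: "Y \<in> R" "same_law M t T Y X" and f: "f = (\<lambda>\<omega>. ereal (pair Y a \<omega>))" by auto
    show "AE \<omega> in M. f \<omega> \<le> ereal \<bar>m\<bar>"
      using pair_bound[OF a Y(1) same_law_bound[OF X Y m]] by eventually_elim (simp add: f abs_le_iff)
  qed simp
  moreover have "AE \<omega> in M. ereal (pair X a \<omega>) \<le> Psi a X \<omega>"
    by (rule Psi_upper[OF X]) (simp add: same_law_def)
  ultimately show ?thesis by eventually_elim auto
qed

end

context concave_utility
begin

abbreviation "risk n X a \<equiv> avg_risk M F t T \<phi> n X a"

lemma risk_measurable: "risk n X a \<in> borel_measurable M"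
proof -
  have "Psi a Y \<in> borel_measurable M" for Y by (rule is_ess_sup_measurable[OF Psi_ess_sup])
  thus ?thesis unfolding avg_risk_def using sharp_measurable[of a] by measurable
qed

lemma fenchel_young_avg:
  assumes a: "a \<in> D" and Y: "\<And>i. i \<in> {1..n} \<Longrightarrow> Y i \<in> R"
  shows "AE \<omega> in M. ereal ((\<Sum>i\<in>{1..n}. pair (Y i) a \<omega>) / real n) + sharp a \<omega>
    \<le> ereal (insurance \<phi> (proc_avg n Y) \<omega>)"
proof -
  have YR: "proc_avg n Y \<in> R" by (rule proc_avg_R[OF Y])
  have "AE \<omega> in M. pair (proc_avg n Y) a \<omega> = (\<Sum>i\<in>{1..n}. pair (Y i) a \<omega>) / real n"
    by (rule pair_avg[OF a Y])
  with fenchel_young[OF a R_uminus[OF YR]] pair_uminus[OF a YR] show ?thesis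
  proof eventually_elim
    case (elim \<omega>)
    let ?p = "(\<Sum>i\<in>{1..n}. pair (Y i) a \<omega>) / real n"
    have "sharp a \<omega> \<le> ereal (- ?p + insurance \<phi> (proc_avg n Y) \<omega>)"
      using elim by (simp add: insurance_def)
    hence "ereal ?p + sharp a \<omega> \<le> ereal ?p + ereal (- ?p + insurance \<phi> (proc_avg n Y) \<omega>)"
      by (rule add_left_mono)
    thus ?case by simp
  qed
qed

lemma worst_case_portfolio:
  assumes n: "n \<ge> 1" and X: "\<And>i. i \<in> {1..n} \<Longrightarrow> X i \<in> R"
  defines "Lhs \<equiv> ess_sup M ((\<lambda>Y \<omega>. ereal (insurance \<phi> (proc_avg n Y) \<omega>)) ` rearrangements M F t T n X)"
    and "Rhs \<equiv> ess_sup M (risk n X ` D)"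
  shows "AE \<omega> in M. Lhs \<omega> = Rhs \<omega>"
    and "worst_scenario M F t T \<phi> n X a0 \<Longrightarrow> Xb \<in> rearrangements M F t T n X
      \<Longrightarrow> a_comonotone M F t T n a0 Xb \<Longrightarrow> AE \<omega> in M. Lhs \<omega> = ereal (insurance \<phi> (proc_avg n Xb) \<omega>)"
proof -
  let ?Re = "rearrangements M F t T n X"
  have ReR: "Y i \<in> R" "same_law M t T (Y i) (X i)" if "Y \<in> ?Re" "i \<in> {1..n}" for Y i
    using that by (auto simp: rearrangements_def)
  have avgR: "proc_avg n Y \<in> R" if "Y \<in> ?Re" for Y by (rule proc_avg_R[OF ReR(1)[OF that]])
  have avg: "AE \<omega> in M. pair (proc_avg n Y) a \<omega> = (\<Sum>i\<in>{1..n}. pair (Y i) a \<omega>) / real n"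
    if "a \<in> D" "Y \<in> ?Re" for a Y by (rule pair_avg[OF that(1) ReR(1)[OF that(2)]])
  have fy: "AE \<omega> in M. ereal ((\<Sum>i\<in>{1..n}. pair (Y i) a \<omega>) / real n) + sharp a \<omega>
      \<le> ereal (insurance \<phi> (proc_avg n Y) \<omega>)" if "a \<in> D" "Y \<in> ?Re" for a Y
    by (rule fenchel_young_avg[OF that(1) ReR(1)[OF that(2)]])
  have insm: "(\<lambda>\<omega>. ereal (insurance \<phi> (proc_avg n Y) \<omega>)) \<in> borel_measurable M" if "Y \<in> ?Re" for Y
    using phi_measurable[OF R_uminus[OF avgR[OF that]]]
    unfolding insurance_def by measurable
  have L: "is_ess_sup M ((\<lambda>Y \<omega>. ereal (insurance \<phi> (proc_avg n Y) \<omega>)) ` ?Re) Lhs"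
    unfolding Lhs_def by (rule ess_sup) (use insm in auto)
  have Rs: "is_ess_sup M (risk n X ` D) Rhs"
    unfolding Rhs_def by (rule ess_sup) (use risk_measurable in auto)
  have Lup: "AE \<omega> in M. ereal (insurance \<phi> (proc_avg n Y) \<omega>) \<le> Lhs \<omega>" if "Y \<in> ?Re" for Y
    by (rule is_ess_sup_upper[OF L imageI[OF that]])
  have "AE \<omega> in M. ereal (insurance \<phi> (proc_avg n Y) \<omega>) \<le> Rhs \<omega>" if Y: "Y \<in> ?Re" for Y
  proof -
    note YR = avgR[OF Y]
    \<comment> \<open>\<open>Rhs\<close> is the bound W: under each scenario the rearranged
      component i pairs to at most Psi a (X i).\<close>
    have "AE \<omega> in M. ereal (- \<phi> (\<lambda>s \<omega>. - proc_avg n Y s \<omega>) \<omega>) \<le> Rhs \<omega>"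
    proof (rule dual_representation[OF R_uminus[OF YR]])
      fix a assume a: "a \<in> D"
      have "AE \<omega> in M. \<forall>i\<in>{1..n}. ereal (pair (Y i) a \<omega>) \<le> Psi a (X i) \<omega>"
        by (rule AE_finite_allI) (use Psi_upper[OF ReR[OF Y]] in auto)
      moreover have "AE \<omega> in M. risk n X a \<omega> \<le> Rhs \<omega>" by (rule is_ess_sup_upper[OF Rs imageI[OF a]])
      moreover note pair_uminus[OF a YR] avg[OF a Y]
      ultimately show "AE \<omega> in M. ereal (- pair (\<lambda>s \<omega>. - proc_avg n Y s \<omega>) a \<omega>) + sharp a \<omega> \<le> Rhs \<omega>"
      proof eventually_elim
        case (elim \<omega>)
        have "ereal (- pair (\<lambda>s \<omega>. - proc_avg n Y s \<omega>) a \<omega>)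
            = ereal (1 / real n) * (\<Sum>i\<in>{1..n}. ereal (pair (Y i) a \<omega>))"
          using elim(3,4) by (simp add: sum_ereal)
        also have "\<dots> \<le> ereal (1 / real n) * (\<Sum>i\<in>{1..n}. Psi a (X i) \<omega>)"
          using elim(1) by (intro ereal_mult_left_mono sum_mono) auto
        finally have "ereal (- pair (\<lambda>s \<omega>. - proc_avg n Y s \<omega>) a \<omega>) + sharp a \<omega> \<le> risk n X a \<omega>"
          unfolding avg_risk_def by (rule add_right_mono)
        thus ?case using elim(2) by (rule order_trans)
      qed
    qed
    thus ?thesis by (simp add: insurance_def)
  qed
  hence LR: "AE \<omega> in M. Lhs \<omega> \<le> Rhs \<omega>"
    by (intro is_ess_sup_least[OF L is_ess_sup_measurable[OF Rs]]) auto
  \<comment> \<open>\<open>rearrangements\<close> constrains each component separately, so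
    near-maximisers of the individual Psi can be combined into one portfolio.\<close>
  have risk_le: "AE \<omega> in M. risk n X a \<omega> \<le> Lhs \<omega>" if a: "a \<in> D" for a
  proof -
    have "\<exists>C. \<forall>i. C i \<subseteq> {Y \<in> R. same_law M t T Y (X i)} \<and> countable (C i)
        \<and> (AE \<omega> in M. Psi a (X i) \<omega> = (SUP Y\<in>C i. ereal (pair Y a \<omega>)))"
      by (rule choice) (use Psi_countable in blast)
    then obtain C where C': "\<forall>i. C i \<subseteq> {Y \<in> R. same_law M t T Y (X i)} \<and> countable (C i)
        \<and> (AE \<omega> in M. Psi a (X i) \<omega> = (SUP Y\<in>C i. ereal (pair Y a \<omega>)))" by (rule exE)
    note C = C'[THEN spec, THEN conjunct1] C'[THEN spec, THEN conjunct2, THEN conjunct1]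
      C'[THEN spec, THEN conjunct2, THEN conjunct2]
    have "AE \<omega> in M. \<forall>i\<in>{1..n}. Psi a (X i) \<omega> = (SUP Y\<in>C i. ereal (pair Y a \<omega>))"
      by (rule AE_finite_allI) (use C(3) in auto)
    moreover have "AE \<omega> in M. \<forall>i\<in>{1..n}. \<bar>Psi a (X i) \<omega>\<bar> \<noteq> \<infinity>"
      by (rule AE_finite_allI) (use Psi_finite[OF a X] in auto)
    \<comment> \<open>A finite product of countable sets is countable, so one null set serves all
      combined portfolios.\<close>
    moreover have "AE \<omega> in M. \<forall>Y\<in>PiE {1..n} C. ereal ((\<Sum>i\<in>{1..n}. pair (Y i) a \<omega>) / real n) + sharp a \<omega> \<le> Lhs \<omega>"
    proof (subst AE_ball_countable)
      show "countable (PiE {1..n} C)" using C(2) by (intro countable_PiE) auto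
      show "\<forall>Y\<in>PiE {1..n} C. AE \<omega> in M. ereal ((\<Sum>i\<in>{1..n}. pair (Y i) a \<omega>) / real n) + sharp a \<omega> \<le> Lhs \<omega>"
      proof
        fix Y assume "Y \<in> PiE {1..n} C"
        hence Y: "Y \<in> ?Re" using C(1) by (force simp: rearrangements_def PiE_iff)
        show "AE \<omega> in M. ereal ((\<Sum>i\<in>{1..n}. pair (Y i) a \<omega>) / real n) + sharp a \<omega> \<le> Lhs \<omega>"
          using fy[OF a Y] Lup[OF Y] by eventually_elim (rule order_trans)
      qed
    qed
    ultimately show ?thesis
    proof eventually_elim
      case (elim \<omega>)
      define p where "p i = real_of_ereal (Psi a (X i) \<omega>)" for i
      have p: "Psi a (X i) \<omega> = ereal (p i)" if "i \<in> {1..n}" for i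
        using elim(2) that by (simp add: p_def ereal_real)
      show ?case
      proof (rule ereal_le_epsilon2)
        fix d :: real assume d: "0 < d"
        have "\<exists>Y\<in>C i. p i - d < pair Y a \<omega>" if i: "i \<in> {1..n}" for i
        proof -
          have "ereal (p i - d) < (SUP Y\<in>C i. ereal (pair Y a \<omega>))" using elim(1) i p[OF i] d by simp
          thus ?thesis by (auto simp: less_SUP_iff)
        qed
        \<comment> \<open>The selection depends on the sample point, but it stays within the
          countable product on which the inequality is already known at this point.\<close>
        then obtain Y where Y: "\<And>i. i \<in> {1..n} \<Longrightarrow> Y i \<in> C i \<and> p i - d < pair (Y i) a \<omega>" by metis
        define y where "y = (\<Sum>i\<in>{1..n}. pair (Y i) a \<omega>) / real n"
        \<comment> \<open>\<open>PiE\<close> contains only functions that are undefined off the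
          index set, hence the restriction.\<close>
        have "restrict Y {1..n} \<in> PiE {1..n} C" using Y by auto
        hence "ereal ((\<Sum>i\<in>{1..n}. pair (restrict Y {1..n} i) a \<omega>) / real n) + sharp a \<omega> \<le> Lhs \<omega>"
          using elim(3) by blast
        hence y: "ereal y + sharp a \<omega> \<le> Lhs \<omega>" by (simp add: y_def)
        have "(\<Sum>i\<in>{1..n}. p i) \<le> (\<Sum>i\<in>{1..n}. pair (Y i) a \<omega> + d)"
          using Y by (intro sum_mono) force
        also have "\<dots> = real n * (y + d)" using n by (simp add: sum.distrib y_def field_simps)
        finally have le: "(\<Sum>i\<in>{1..n}. p i) / real n \<le> y + d" using n by (simp add: divide_le_eq mult.commute)
        have "(\<Sum>i\<in>{1..n}. Psi a (X i) \<omega>) = ereal (\<Sum>i\<in>{1..n}. p i)"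
          unfolding sum_ereal[symmetric] by (rule sum.cong) (use p in auto)
        hence "risk n X a \<omega> = ereal ((\<Sum>i\<in>{1..n}. p i) / real n) + sharp a \<omega>"
          by (simp add: avg_risk_def)
        also have "\<dots> \<le> ereal (y + d) + sharp a \<omega>" using le by (intro add_right_mono) simp
        \<comment> \<open>Cases, because \<open>sharp\<close> takes extended values.\<close>
        also have "\<dots> = (ereal y + sharp a \<omega>) + ereal d"
          by (cases "sharp a \<omega>") auto
        also have "\<dots> \<le> Lhs \<omega> + ereal d" using y by (rule add_right_mono)
        finally show "risk n X a \<omega> \<le> Lhs \<omega> + ereal d" .
      qed
    qed
  qed
  hence "AE \<omega> in M. Rhs \<omega> \<le> Lhs \<omega>"
    by (intro is_ess_sup_least[OF Rs is_ess_sup_measurable[OF L]]) auto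
  with LR show eq: "AE \<omega> in M. Lhs \<omega> = Rhs \<omega>" by eventually_elim simp
  assume ws: "worst_scenario M F t T \<phi> n X a0" and Xb: "Xb \<in> ?Re" and com: "a_comonotone M F t T n a0 Xb"
  have a0: "a0 \<in> D" and a0R: "AE \<omega> in M. risk n X a0 \<omega> = Rhs \<omega>"
    using ws by (auto simp: worst_scenario_def Rhs_def)
  \<comment> \<open>Psi depends only on the law of the process, so comonotonicity of
    \<open>Xb\<close> evaluates it at X.\<close>
  have Psi_eq: "Psi a0 (X i) = Psi a0 (Xb i)" if "i \<in> {1..n}" for i
    using ReR(2)[OF Xb that] by (simp add: Psi_a_def same_law_def)
  have "AE \<omega> in M. \<forall>i\<in>{1..n}. Psi a0 (X i) \<omega> = ereal (pair (Xb i) a0 \<omega>)"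
    by (rule AE_finite_allI) (use com Psi_eq in \<open>auto simp: a_comonotone_def\<close>)
  with eq a0R fy[OF a0 Xb] Lup[OF Xb]
  show "AE \<omega> in M. Lhs \<omega> = ereal (insurance \<phi> (proc_avg n Xb) \<omega>)"
  proof eventually_elim
    case (elim \<omega>)
    have "(\<Sum>i\<in>{1..n}. Psi a0 (X i) \<omega>) = ereal (\<Sum>i\<in>{1..n}. pair (Xb i) a0 \<omega>)"
      unfolding sum_ereal[symmetric] by (rule sum.cong) (use elim(5) in auto)
    hence "risk n X a0 \<omega> = ereal ((\<Sum>i\<in>{1..n}. pair (Xb i) a0 \<omega>) / real n) + sharp a0 \<omega>"
      by (simp add: avg_risk_def)
    \<comment> \<open>The chain closes: Lhs = Rhs = risk at a0 = averaged pairing plus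
      \<open>sharp\<close> <= insurance of the portfolio <= Lhs.\<close>
    thus ?case using elim(1-4) by (intro antisym) auto
  qed
qed

end

theorem theorem3p1:
  fixes M :: "'a measure" and F :: "nat \<Rightarrow> 'a measure"
    and t T n :: nat and \<phi> :: "'a proc \<Rightarrow> 'a \<Rightarrow> real" and X :: "nat \<Rightarrow> 'a proc"
  assumes "filtered_prob_space M F"
    and "t \<le> T"
    and "monetary_utility M F t T \<phi>"
    and "law_invariant M F t T \<phi>"
    and "concave_mu M F t T \<phi>"
    and "cont_bdd_decr M F t T \<phi>"
    and "n \<ge> 1"
    and "\<forall>i\<in>{1..n}. X i \<in> Rinf_tT M F t T"
  shows "(AE \<omega> in M.
            ess_sup M ((\<lambda>Y \<omega>. ereal (insurance \<phi> (proc_avg n Y) \<omega>)) ` rearrangements M F t T n X) \<omega>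
          = ess_sup M (avg_risk M F t T \<phi> n X ` D_tT M F t T) \<omega>)
       \<and> (\<forall>a0 Xb. worst_scenario M F t T \<phi> n X a0
            \<longrightarrow> Xb \<in> rearrangements M F t T n X
            \<longrightarrow> a_comonotone M F t T n a0 Xb
            \<longrightarrow> (AE \<omega> in M.
                  ess_sup M ((\<lambda>Y \<omega>. ereal (insurance \<phi> (proc_avg n Y) \<omega>)) ` rearrangements M F t T n X) \<omega>
                = ereal (insurance \<phi> (proc_avg n Xb) \<omega>)))"
proof -
  interpret concave_utility M F t T \<phi> by unfold_locales (use assms in auto)
  have "\<And>i. i \<in> {1..n} \<Longrightarrow> X i \<in> Rinf_tT M F t T" using assms by blast
  note worst_case_portfolio[OF \<open>n \<ge> 1\<close>, of X, OF this]
  thus ?thesis by blast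
qed

end
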